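(* Let $1\le p<\infty$, $\alpha>-1$, let $u$ be an analytic function on the open unit disk $\mathbb{D}$ and $\varphi$ an analytic self-map of $\mathbb{D}$ such that the weighted composition operator $uC_\varphi:A^p_\alpha\to\mathcal{B}$ is bounded. Then $$\|uC_\varphi\|_{e,A^p_\alpha\to\mathcal{B}}\approx\max\Big\{\limsup_{j\to\infty}j^{(2+\alpha)/p}\|I_u(\varphi^j)\|_{\mathcal{B}},\ \limsup_{j\to\infty}j^{(2+\alpha)/p}\|J_u(\varphi^{j-1})\|_{\mathcal{B}}\Big\},$$ where, for $g$ analytic on $\mathbb{D}$ and $z\in\mathbb{D}$, $$I_ug(z)=\int_0^zg'(\xi)u(\xi)\,d\xi,\qquad J_ug(z)=\int_0^zg(\xi)u'(\xi)\,d\xi.$$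
   Context: $H(\mathbb{D})$ is the space of analytic functions on the open unit disk $\mathbb{D}\subset\mathbb{C}$. For $u\in H(\mathbb{D})$ and an analytic $\varphi:\mathbb{D}\to\mathbb{D}$, the weighted composition operator is $(uC_\varphi f)(z)=u(z)f(\varphi(z))$, $f\in H(\mathbb{D})$. The weighted Bergman space $A^p_\alpha$ consists of all $f\in H(\mathbb{D})$ with $\|f\|_{A^p_\alpha}^p=(\alpha+1)\int_{\mathbb{D}}|f(z)|^p(1-|z|^2)^\alpha\,dA(z)<\infty$, where $dA$ is Lebesgue area measure normalized so that $A(\mathbb{D})=1$. The Bloch space $\mathcal{B}$ consists of all $f\in H(\mathbb{D})$ with $\sup_{z\in\mathbb{D}}(1-|z|^2)|f'(z)|<\infty$, with norm $\|f\|_{\mathcal{B}}=|f(0)|+\sup_{z\in\mathbb{D}}(1-|z|^2)|f'(z)|$. The essential norm of a bounded linear operator $T:X\to Y$ between Banach spaces is $\|T\|_{e,X\to Y}=\inf\{\|T-K\|_{X\to Y}: K:X\to Y \text{ compact}\}$. $\varphi^j$ denotes the $j$-th pointwise power of $\varphi$ (not an iterate), with $\varphi^0=1$. $X\lesssim Y$ means that there exists a constant $C$ such that $X\le CY$, and $X\approx Y$ means $X\lesssim Y\lesssim X$. *)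

theory Defs
  imports "HOL-Complex_Analysis.Complex_Analysis"
begin

abbreviation unit_disc :: "complex set" where
  "unit_disc \<equiv> ball 0 1"

text \<open>
  Analytic functions on the disc are represented by their extension by 0 to the whole type, so
  that two elements agree on the disc iff they are equal in HOL.
\<close>
definition hol_disc :: "(complex \<Rightarrow> complex) set" where
  "hol_disc = {f. f holomorphic_on unit_disc \<and> (\<forall>z. z \<notin> unit_disc \<longrightarrow> f z = 0)}"


subsection \<open>Normed spaces of analytic functions and their operators\<close>

text \<open>
  A normed space of analytic functions is given by its norm \<open>N\<close>, taking the value \<open>\<infinity>\<close> off the space.
  In the following, \<open>N\<close> is the norm of the domain and \<open>M\<close> the norm of the codomain.
\<close>
definition fspace :: "((complex \<Rightarrow> complex) \<Rightarrow> ennreal) \<Rightarrow> (complex \<Rightarrow> complex) set" where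
  "fspace N = {f \<in> hol_disc. N f < \<infinity>}"

definition linear_op ::
  "((complex \<Rightarrow> complex) \<Rightarrow> ennreal) \<Rightarrow> ((complex \<Rightarrow> complex) \<Rightarrow> ennreal) \<Rightarrow>
   ((complex \<Rightarrow> complex) \<Rightarrow> (complex \<Rightarrow> complex)) \<Rightarrow> bool" where
  "linear_op N M T \<longleftrightarrow>
     (\<forall>f\<in>fspace N. T f \<in> fspace M) \<and>
     (\<forall>f\<in>fspace N. \<forall>g\<in>fspace N. T (\<lambda>z. f z + g z) = (\<lambda>z. T f z + T g z)) \<and>
     (\<forall>c. \<forall>f\<in>fspace N. T (\<lambda>z. c * f z) = (\<lambda>z. c * T f z))"

definition bounded_op ::
  "((complex \<Rightarrow> complex) \<Rightarrow> ennreal) \<Rightarrow> ((complex \<Rightarrow> complex) \<Rightarrow> ennreal) \<Rightarrow>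
   ((complex \<Rightarrow> complex) \<Rightarrow> (complex \<Rightarrow> complex)) \<Rightarrow> bool" where
  "bounded_op N M T \<longleftrightarrow>
     linear_op N M T \<and> (\<exists>C::real. \<forall>f\<in>fspace N. M (T f) \<le> ennreal C * N f)"

definition compact_op ::
  "((complex \<Rightarrow> complex) \<Rightarrow> ennreal) \<Rightarrow> ((complex \<Rightarrow> complex) \<Rightarrow> ennreal) \<Rightarrow>
   ((complex \<Rightarrow> complex) \<Rightarrow> (complex \<Rightarrow> complex)) \<Rightarrow> bool" where
  "compact_op N M K \<longleftrightarrow>
     linear_op N M K \<and>
     (\<forall>f :: nat \<Rightarrow> complex \<Rightarrow> complex.
        (\<forall>n. f n \<in> fspace N) \<and> (\<exists>B::real. \<forall>n. N (f n) \<le> ennreal B) \<longrightarrow>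
        (\<exists>r g. strict_mono r \<and> g \<in> fspace M \<and>
               (\<lambda>n. M (\<lambda>z. K (f (r n)) z - g z)) \<longlonglongrightarrow> 0))"

definition op_norm ::
  "((complex \<Rightarrow> complex) \<Rightarrow> ennreal) \<Rightarrow> ((complex \<Rightarrow> complex) \<Rightarrow> ennreal) \<Rightarrow>
   ((complex \<Rightarrow> complex) \<Rightarrow> (complex \<Rightarrow> complex)) \<Rightarrow> ennreal" where
  "op_norm N M T = (SUP f\<in>{f \<in> fspace N. N f \<le> 1}. M (T f))"

definition essential_norm ::
  "((complex \<Rightarrow> complex) \<Rightarrow> ennreal) \<Rightarrow> ((complex \<Rightarrow> complex) \<Rightarrow> ennreal) \<Rightarrow>
   ((complex \<Rightarrow> complex) \<Rightarrow> (complex \<Rightarrow> complex)) \<Rightarrow> ennreal" where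
  "essential_norm N M T = (INF K\<in>{K. compact_op N M K}. op_norm N M (\<lambda>f z. T f z - K f z))"


subsection \<open>Bergman and Bloch norms\<close>

definition bergman_integral :: "real \<Rightarrow> real \<Rightarrow> (complex \<Rightarrow> complex) \<Rightarrow> ennreal" where
  "bergman_integral p \<alpha> f =
     ennreal (\<alpha> + 1) *
     (\<integral>\<^sup>+ z. ennreal (cmod (f z) powr p * (1 - (cmod z)\<^sup>2) powr \<alpha>)
        \<partial>uniform_measure lborel unit_disc)"

text \<open>There is no \<open>powr\<close> on \<^typ>\<open>ennreal\<close>, so the \<open>p\<close>-th root is taken in the reals.\<close>
definition bergman_norm :: "real \<Rightarrow> real \<Rightarrow> (complex \<Rightarrow> complex) \<Rightarrow> ennreal" where
  "bergman_norm p \<alpha> f =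
     (if bergman_integral p \<alpha> f = \<infinity> then \<infinity>
      else ennreal (enn2real (bergman_integral p \<alpha> f) powr (1 / p)))"

definition bloch_norm :: "(complex \<Rightarrow> complex) \<Rightarrow> ennreal" where
  "bloch_norm f =
     ennreal (cmod (f 0)) +
     (SUP z\<in>unit_disc. ennreal ((1 - (cmod z)\<^sup>2) * cmod (deriv f z)))"


subsection \<open>The operators\<close>

definition wcomp ::
  "(complex \<Rightarrow> complex) \<Rightarrow> (complex \<Rightarrow> complex) \<Rightarrow> (complex \<Rightarrow> complex) \<Rightarrow> complex \<Rightarrow> complex" where
  "wcomp u \<phi> f = (\<lambda>z. if z \<in> unit_disc then u z * f (\<phi> z) else 0)"

definition I_op :: "(complex \<Rightarrow> complex) \<Rightarrow> (complex \<Rightarrow> complex) \<Rightarrow> complex \<Rightarrow> complex" where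
  "I_op u g = (\<lambda>z. if z \<in> unit_disc
     then contour_integral (linepath 0 z) (\<lambda>\<xi>. deriv g \<xi> * u \<xi>) else 0)"

definition J_op :: "(complex \<Rightarrow> complex) \<Rightarrow> (complex \<Rightarrow> complex) \<Rightarrow> complex \<Rightarrow> complex" where
  "J_op u g = (\<lambda>z. if z \<in> unit_disc
     then contour_integral (linepath 0 z) (\<lambda>\<xi>. g \<xi> * deriv u \<xi>) else 0)"

end

theory Submission
  imports Defs
begin

text \<open>
  Put \<open>s = (2 + \<alpha>) / p\<close>, \<open>A = (1 - |z|\<^sup>2) |u'|\<close> and \<open>B = (1 - |z|\<^sup>2) |u \<phi>'|\<close>. Choosing \<open>j\<close> comparable to
  \<open>1 / (1 - |\<phi>(z)|)\<close> shows that the two limits superior are comparable to those of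
  \<open>A / (1 - |\<phi>|\<^sup>2)\<^sup>s\<close> and \<open>B / (1 - |\<phi>|\<^sup>2)\<^bsup>s + 1\<^esup>\<close> as \<open>|\<phi>(z)|\<close> tends to 1.
  These dominate the essential norm: approximate \<open>u C\<^sub>\<phi>\<close> by the compact operators \<open>u C\<^bsub>r\<phi>\<^esub>\<close> and use
  \<open>|f(w)| \<lesssim> (1 - |w|)\<^bsup>-s\<^esup>\<close> on the unit ball, together with Cauchy's estimates for the derivatives.
  Conversely, at a point \<open>z\<close> the two quotients are the Bloch densities of \<open>u C\<^sub>\<phi>\<close> applied to
  kernel functions peaking at \<open>\<phi>(z)\<close>, whose norms are bounded by the Forelli-Rudin estimate; along a
  sequence with \<open>|\<phi>(z)| \<rightarrow> 1\<close> a compact operator cannot see the difference of two such functions.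
\<close>

subsection \<open>Rotation invariance of the area measure\<close>

text \<open>The equivalence must hold with a constant that depends on p and \<alpha> only. The
  constants of the final estimate are therefore fixed in the locale \<open>bergman\<close>, before u
  and \<phi> exist. The bound \<open>S\<close> of \<open>density_bounds\<close> is different: it
  comes from the norm of the operator, so it may enter only in a qualitative statement, such as
  compactness, or next to a factor that can be made small (large j while |\<phi>(z)| stays away from
  1, or r close to 1).

  Two facts do the work of polar coordinates: area is invariant under rotations, so an integrand may
  be replaced by its averages over circles, and 1 - |z|^2 is uniformly distributed on [0,1] for z
  uniform on the disc. The first gives the mean value inequality behind the growth bound for f;
  together they give the Forelli-Rudin estimate.

  Two kernel families are used because the derivative of u(z) f(\<phi>(z)) mixes f and f'. At the
  chosen point one family has derivative zero and the other has value zero, so each isolates one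
  quotient.\<close>

lemma negligible_rotation_image:
  fixes S :: "complex set"
  assumes "negligible S"
  shows "negligible ((*) c ` S)"
proof (rule negligible_differentiable_image_negligible[OF _ assms])
  show "(*) c differentiable_on S"
    by (intro differentiable_on_mult differentiable_on_const differentiable_on_id[unfolded id_def])
qed simp

lemma image_mult_eq_vimage:
  fixes c :: "'a::field"
  assumes "c \<noteq> 0"
  shows "(*) c ` U = (*) (inverse c) -` U"
proof (intro set_eqI iffI)
  fix w assume "w \<in> (*) (inverse c) -` U"
  then show "w \<in> (*) c ` U"
    using assms by (intro image_eqI[of _ _ "inverse c * w"]) (auto simp: mult.assoc[symmetric])
qed (use assms in \<open>auto simp: mult.assoc[symmetric]\<close>)

lemma emeasure_ball_complex:
  fixes x y :: complex
  shows "emeasure lborel (ball x r) = emeasure lborel (ball y r)"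
proof (cases "r \<le> 0")
  case True
  then show ?thesis by (simp only: ball_empty)
next
  case False
  then show ?thesis by (simp add: emeasure_ball)
qed

text \<open>Rotations map balls to balls, so Vitali's covering theorem does the rest.\<close>
lemma emeasure_rotation_open_le:
  fixes c :: complex
  assumes c: "cmod c = 1" and U: "open U"
  shows "emeasure lborel ((*) c ` U) \<le> emeasure lborel U"
proof -
  define K where "K = {(x::complex, r::real). 0 < r \<and> ball x r \<subseteq> U}"
  have cov: "\<exists>i. i \<in> K \<and> x \<in> ball (fst i) (snd i) \<and> snd i < d" if xd: "x \<in> U" "0 < d" for x d
  proof -
    obtain e where e: "e > 0" "ball x e \<subseteq> U" using U xd(1) by (meson openE)
    have "ball x (min e (d/2)) \<subseteq> U" using e by (auto simp: subset_iff)
    then have "(x, min e (d/2)) \<in> K" using e that by (auto simp: K_def)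
    moreover have "x \<in> ball x (min e (d/2))" using e that by auto
    ultimately show ?thesis using that by (intro exI[of _ "(x, min e (d/2))"]) auto
  qed
  obtain C where C: "countable C" "C \<subseteq> K"
     "pairwise (\<lambda>i j. disjnt (ball (fst i) (snd i)) (ball (fst j) (snd j))) C"
     "negligible (U - (\<Union>i \<in> C. ball (fst i) (snd i)))"
    using Vitali_covering_theorem_balls[of U K fst snd, OF cov] by blast
  define N where "N = (*) c ` (U - (\<Union>i \<in> C. ball (fst i) (snd i)))"
  have N: "N \<in> null_sets lebesgue"
    using negligible_rotation_image[OF C(4)] by (simp add: N_def negligible_iff_null_sets)
  have dist: "dist (c * x) (c * y) = dist x y" for x y
    using c by (simp add: dist_norm norm_mult flip: right_diff_distrib)
  have img: "(*) c ` ball x r = ball (c * x) r" for x r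
  proof (intro subset_antisym subsetI)
    fix w assume "w \<in> ball (c * x) r"
    moreover have w: "w = c * (w / c)" using c by auto
    ultimately have "w / c \<in> ball x r" using dist[of x "w / c"] by (simp only: mem_ball)
    then show "w \<in> (*) c ` ball x r" using w by (rule rev_image_eqI)
  qed (auto simp: dist)
  have disj: "disjoint_family_on (\<lambda>i. ball (fst i) (snd i)) C"
    using C(3) by (auto simp: disjoint_family_on_def pairwise_def disjnt_def)
  have disj': "disjoint_family_on (\<lambda>i. ball (c * fst i) (snd i)) C"
  proof -
    have "inj ((*) c)" using c by (intro injI) auto
    then show ?thesis
      using disj unfolding disjoint_family_on_def by (simp flip: img image_Int)
  qed
  have sub: "(*) c ` U \<subseteq> (\<Union>i\<in>C. ball (c * fst i) (snd i)) \<union> N"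
  proof
    fix w assume "w \<in> (*) c ` U"
    then obtain z where z: "z \<in> U" "w = c * z" by auto
    show "w \<in> (\<Union>i\<in>C. ball (c * fst i) (snd i)) \<union> N"
    proof (cases "z \<in> (\<Union>i \<in> C. ball (fst i) (snd i))")
      case True
      then obtain i where "i \<in> C" "z \<in> ball (fst i) (snd i)" by auto
      then show ?thesis using img[of "fst i" "snd i", symmetric] z by blast
    next
      case False
      then have "z \<in> U - (\<Union>i \<in> C. ball (fst i) (snd i))" using z by blast
      then show ?thesis using z(2) unfolding N_def by blast
    qed
  qed
  have opn: "open ((*) c ` U)"
  proof -
    have "(*) c ` U = (*) (inverse c) -` U" using c by (intro image_mult_eq_vimage) auto
    then show ?thesis
      using U by (simp only:) (intro open_vimage continuous_intros)
  qed
  \<comment> \<open>The computation passes through Lebesgue measure because the image N of the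
    uncovered remainder is known as a Lebesgue null set.\<close>
  have "emeasure lborel ((*) c ` U) = emeasure lebesgue ((*) c ` U)"
    using opn by simp
  also have "\<dots> \<le> emeasure lebesgue ((\<Union>i\<in>C. ball (c * fst i) (snd i)) \<union> N)"
    using sub N C(1) by (intro emeasure_mono) (auto intro!: sets.Un sets.countable_UN')
  also have "\<dots> = emeasure lebesgue (\<Union>i\<in>C. ball (c * fst i) (snd i))"
    using N C(1) by (intro emeasure_Un_null_set) (auto intro!: sets.countable_UN')
  also have "\<dots> = emeasure lborel (\<Union>i\<in>C. ball (c * fst i) (snd i))"
  proof -
    have "open (\<Union>i\<in>C. ball (c * fst i) (snd i))" by auto
    then show ?thesis by simp
  qed
  also have "\<dots> = (\<integral>\<^sup>+ i. emeasure lborel (ball (c * fst i) (snd i)) \<partial>count_space C)"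
    using C(1) disj' by (intro emeasure_UN_countable) auto
  also have "\<dots> = (\<integral>\<^sup>+ i. emeasure lborel (ball (fst i) (snd i)) \<partial>count_space C)"
    by (intro nn_integral_cong emeasure_ball_complex)
  also have "\<dots> = emeasure lborel (\<Union>i\<in>C. ball (fst i) (snd i))"
    using C(1) disj by (intro emeasure_UN_countable[symmetric]) auto
  also have "\<dots> \<le> emeasure lborel U"
    using C(2) U unfolding K_def by (intro emeasure_mono UN_least) (fastforce, simp)
  finally show ?thesis .
qed

text \<open>On open sets the previous inequality, used for c and for its inverse, becomes an
  equality. Open sets form an intersection-stable generator of the Borel sets, and the balls
  \<open>ball 0 (real i)\<close> exhaust the plane with finite measure.\<close>

lemma lborel_distr_rotation:
  fixes c :: complex
  assumes c: "cmod c = 1"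
  shows "distr lborel borel ((*) c) = lborel"
proof (rule measure_eqI_generator_eq[where E="{U. open U}" and \<Omega>=UNIV and A="\<lambda>i. ball 0 (real i)"])
  show "Int_stable {U::complex set. open U}"
    by (auto simp: Int_stable_def)
  show "emeasure (distr lborel borel ((*) c)) U = emeasure lborel U" if "U \<in> {U. open U}" for U
  proof -
    have U: "open U" using that by simp
    have c0: "c \<noteq> 0" and ci: "cmod (inverse c) = 1" using c by (auto simp: norm_inverse)
    have "emeasure (distr lborel borel ((*) c)) U = emeasure lborel ((*) c -` U)"
      using U by (subst emeasure_distr) auto
    also have eq: "(*) c -` U = (*) (inverse c) ` U"
      using c0 image_mult_eq_vimage[of "inverse c" U] by simp
    finally have 1: "emeasure (distr lborel borel ((*) c)) U = emeasure lborel ((*) (inverse c) ` U)" .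
    have op: "open ((*) (inverse c) ` U)"
      unfolding eq[symmetric] using U by (intro open_vimage continuous_intros)
    have "(*) c ` ((*) (inverse c) ` U) = U" using c0 by (auto simp: image_image mult.assoc[symmetric])
    then have "emeasure lborel U \<le> emeasure lborel ((*) (inverse c) ` U)"
      using emeasure_rotation_open_le[OF c op] by simp
    with emeasure_rotation_open_le[OF ci U] 1 show ?thesis by simp
  qed
  show "emeasure (distr lborel borel ((*) c)) (ball 0 (real i)) \<noteq> \<infinity>" for i
  proof -
    have "(*) c -` ball 0 (real i) = ball 0 (real i)" using c by (auto simp: norm_mult)
    then show ?thesis by (subst emeasure_distr) (auto simp: emeasure_ball)
  qed
  show "(\<Union>i. ball 0 (real i)) = (UNIV :: complex set)"
    using reals_Archimedean2 by (auto simp: dist_norm)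
qed (auto simp: borel_def)

lemma nn_integral_rotation:
  fixes c :: complex
  assumes "cmod c = 1" "f \<in> borel_measurable borel"
  shows "(\<integral>\<^sup>+z. f (c * z) \<partial>lborel) = (\<integral>\<^sup>+z. f z \<partial>lborel)"
proof -
  have "(\<integral>\<^sup>+z. f z \<partial>lborel) = (\<integral>\<^sup>+z. f z \<partial>distr lborel borel ((*) c))"
    using lborel_distr_rotation[OF assms(1)] by simp
  also have "\<dots> = (\<integral>\<^sup>+z. f (c * z) \<partial>lborel)"
    using assms(2) by (subst nn_integral_distr) auto
  finally show ?thesis by simp
qed

text \<open>Period 1, matching \<open>circlepath 0 1\<close>, so that circle averages are plain
  integrals over {0..1}.\<close>

definition circle_point :: "real \<Rightarrow> complex" where
  "circle_point t = exp (2 * of_real pi * \<i> * of_real t)"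

lemma norm_circle_point [simp]: "cmod (circle_point t) = 1"
  by (simp add: circle_point_def norm_exp_eq_Re)

lemma continuous_on_circle_point [continuous_intros]: "continuous_on A circle_point"
  unfolding circle_point_def by (intro continuous_intros)

lemma borel_measurable_circle_point [measurable]: "circle_point \<in> borel_measurable borel"
  by (intro borel_measurable_continuous_onI continuous_intros)

text \<open>Each single rotation leaves the area integral unchanged, hence so does the average over
  all of them; Tonelli moves that average inside.\<close>

lemma nn_integral_rotation_average:
  fixes f :: "complex \<Rightarrow> ennreal"
  assumes f: "f \<in> borel_measurable borel"
  shows "(\<integral>\<^sup>+z. f z \<partial>lborel) = (\<integral>\<^sup>+z. (\<integral>\<^sup>+t\<in>{0..1}. f (circle_point t * z) \<partial>lborel) \<partial>lborel)"
proof -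
  note f [measurable]
  have "(\<integral>\<^sup>+z. (\<integral>\<^sup>+t. f (circle_point t * z) * indicator {0..1} t \<partial>lborel) \<partial>lborel)
      = (\<integral>\<^sup>+t. (\<integral>\<^sup>+z. f (circle_point t * z) * indicator {0..1} t \<partial>lborel) \<partial>lborel)"
    by (rule lborel_pair.Fubini') measurable
  also have "\<dots> = (\<integral>\<^sup>+t. (\<integral>\<^sup>+z. f z \<partial>lborel) * indicator {0..1::real} t \<partial>lborel)"
    by (intro nn_integral_cong) (auto simp: indicator_def nn_integral_rotation f)
  also have "\<dots> = (\<integral>\<^sup>+z. f z \<partial>lborel)"
    by (simp add: nn_integral_cmult_indicator)
  finally show ?thesis by simp
qed

subsection \<open>Mean value inequalities\<close>

lemma holomorphic_circle_mean:
  assumes "g holomorphic_on cball 0 1"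
  shows "((\<lambda>t. g (circle_point t)) has_integral g 0) {0..1}"
proof -
  have "((\<lambda>u. g u / (u - 0)) has_contour_integral (2 * of_real pi * \<i> * g 0)) (circlepath 0 1)"
    by (rule Cauchy_integral_circlepath_simple) (use assms in auto)
  \<comment> \<open>The velocity of the circle is 2 pi i times its position, which cancels the
    denominator in Cauchy's formula.\<close>
  then have "((\<lambda>t. (2 * of_real pi * \<i>) * g (circle_point t)) has_integral (2 * of_real pi * \<i>) * g 0) {0..1}"
    unfolding has_contour_integral
    by (rule has_integral_eq[rotated])
       (simp add: vector_derivative_circlepath, simp add: circlepath circle_point_def mult_ac)
  from has_integral_mult_right[OF this, of "inverse (2 * of_real pi * \<i>)"]
  show ?thesis by (simp add: field_simps)
qed

lemma holomorphic_circle_submean: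
  assumes "g holomorphic_on cball 0 1"
  shows "ennreal (cmod (g 0)) \<le> (\<integral>\<^sup>+t\<in>{0..1}. ennreal (cmod (g (circle_point t))) \<partial>lborel)"
proof -
  have c: "continuous_on {0..1} (\<lambda>t. cmod (g (circle_point t)))"
    by (intro continuous_on_norm continuous_on_compose2[OF holomorphic_on_imp_continuous_on[OF assms]]
        continuous_on_circle_point) auto
  define I where "I = integral {0..1} (\<lambda>t. cmod (g (circle_point t)))"
  have I: "((\<lambda>t. cmod (g (circle_point t))) has_integral I) {0..1}"
    unfolding I_def by (intro integrable_integral integrable_continuous_interval c)
  have "cmod (g 0) \<le> I"
    using integral_norm_bound_integral[of "\<lambda>t. g (circle_point t)" "{0..1}" "\<lambda>t. cmod (g (circle_point t))"]
      holomorphic_circle_mean[OF assms] I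
    by (simp add: has_integral_iff)
  moreover have "(\<integral>\<^sup>+t\<in>{0..1}. ennreal (cmod (g (circle_point t))) \<partial>lborel) = ennreal I"
    by (rule nn_integral_has_integral_lebesgue'[OF _ I]) auto
  ultimately show ?thesis by (simp add: ennreal_leI)
qed

text \<open>Nothing is known about f off the ball, so measurability is available only after cutting
  off with the indicator.\<close>

lemma holomorphic_measurable_on_ball:
  assumes "f holomorphic_on ball w r"
  shows "(\<lambda>z. ennreal (cmod (f z) powr p) * indicator (ball w r) z) \<in> borel_measurable borel"
proof -
  have [measurable]: "ball w r \<in> sets borel" by simp
  have "(\<lambda>z. indicator (ball w r) z *\<^sub>R f z) \<in> borel_measurable borel"
    by (intro borel_measurable_continuous_on_indicator holomorphic_on_imp_continuous_on assms) auto
  then have "(\<lambda>z. ennreal (cmod (indicator (ball w r) z *\<^sub>R f z) powr p) * indicator (ball w r) z)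
      \<in> borel_measurable borel"
    by measurable
  also have "(\<lambda>z. ennreal (cmod (indicator (ball w r) z *\<^sub>R f z) powr p) * indicator (ball w r) z)
    = (\<lambda>z. ennreal (cmod (f z) powr p) * indicator (ball w r) z)"
    by (auto simp: indicator_def)
  finally show ?thesis .
qed

text \<open>Averaging over rotations about w replaces |f| at w + z by its mean over the circle of
  radius |z|. By Cauchy's formula for \<zeta> -> f(w + \<zeta> z) this mean is at least
  |f(w)|.\<close>

lemma holomorphic_area_submean:
  assumes f: "f holomorphic_on ball w r"
  shows "ennreal (cmod (f w)) * emeasure lborel (ball w r)
       \<le> (\<integral>\<^sup>+z\<in>ball w r. ennreal (cmod (f z)) \<partial>lborel)"
proof -
  define F where "F = (\<lambda>z. ennreal (cmod (f (w + z))) * indicator (ball 0 r) z)"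
  have m1: "(\<lambda>z. ennreal (cmod (f z)) * indicator (ball w r) z) \<in> borel_measurable borel"
    using holomorphic_measurable_on_ball[OF f, of 1] by simp
  have F_eq: "F z = ennreal (cmod (f (w + z))) * indicator (ball w r) (w + z)" for z
    by (simp add: F_def indicator_def dist_norm)
  have Fm: "F \<in> borel_measurable borel"
    unfolding F_eq[abs_def] using m1 by measurable
  have "(\<integral>\<^sup>+z\<in>ball w r. ennreal (cmod (f z)) \<partial>lborel)
      = (\<integral>\<^sup>+z\<in>ball w r. ennreal (cmod (f z)) \<partial>distr lborel borel ((+) w))"
    by (simp only: lborel_distr_plus)
  also have "\<dots> = (\<integral>\<^sup>+z. F z \<partial>lborel)"
    unfolding F_eq using m1 by (subst nn_integral_distr) auto
  also have "\<dots> = (\<integral>\<^sup>+z. (\<integral>\<^sup>+t\<in>{0..1}. F (circle_point t * z) \<partial>lborel) \<partial>lborel)"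
    by (rule nn_integral_rotation_average[OF Fm])
  also have "\<dots> \<ge> (\<integral>\<^sup>+z. ennreal (cmod (f w)) * indicator (ball 0 r) (z::complex) \<partial>lborel)"
  proof (intro nn_integral_mono)
    fix z :: complex
    show "ennreal (cmod (f w)) * indicator (ball 0 r) z \<le> (\<integral>\<^sup>+t\<in>{0..1}. F (circle_point t * z) \<partial>lborel)"
    proof (cases "z \<in> ball 0 r")
      case True
      define g where "g = (\<lambda>\<zeta>. f (w + \<zeta> * z))"
      have "w + \<zeta> * z \<in> ball w r" if "cmod \<zeta> \<le> 1" for \<zeta>
        using True that mult_right_mono[OF that, of "cmod z"] by (auto simp: dist_norm norm_mult)
      then have "g holomorphic_on cball 0 1"
        unfolding g_def
        by (intro holomorphic_on_compose_gen[unfolded o_def, OF _ f] holomorphic_intros) auto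
      from holomorphic_circle_submean[OF this] True
      show ?thesis by (simp add: F_def g_def norm_mult)
    qed auto
  qed
  finally show ?thesis
    by (simp add: nn_integral_cmult_indicator emeasure_ball_complex[of w r 0])
qed

text \<open>Convexity: x^p lies above its tangent at m. This is Young's inequality for x and m^(p-1)
  with the exponents p and p/(p-1).\<close>

lemma powr_tangent_le:
  fixes x m p :: real
  assumes "1 \<le> p" "0 \<le> x" "0 \<le> m"
  shows "p * m powr (p - 1) * x \<le> x powr p + (p - 1) * m powr p"
proof (cases "p = 1")
  case True
  \<comment> \<open>The split is due to \<open>0 powr 0\<close> being 0.\<close>
  then show ?thesis using assms by (cases "m = 0") auto
next
  case False
  then have p: "p > 1" using assms by simp
  have "x * m powr (p - 1) \<le> x powr p / p + (m powr (p - 1)) powr (p / (p - 1)) / (p / (p - 1))"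
    using p assms by (intro Youngs_inequality) (auto simp: field_simps)
  also have "(m powr (p - 1)) powr (p / (p - 1)) = m powr p"
    using p by (simp add: powr_powr)
  finally show ?thesis using p by (simp add: field_simps)
qed

text \<open>A hands-on Jensen inequality: integrate the tangent inequality at m = |f(w)| over the
  ball and insert the mean value inequality for |f|. The constant term (p - 1) m^p has a finite
  integral, so it can be cancelled on both sides.\<close>

lemma holomorphic_area_submean_powr:
  assumes f: "f holomorphic_on ball w r" and p: "1 \<le> p"
  shows "ennreal (cmod (f w) powr p) * emeasure lborel (ball w r)
       \<le> (\<integral>\<^sup>+z\<in>ball w r. ennreal (cmod (f z) powr p) \<partial>lborel)"
proof (cases "f w = 0")
  case False
  define m where "m = cmod (f w)"
  have m: "m > 0" using False by (simp add: m_def)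
  let ?B = "ball w r"
  let ?mu = "emeasure lborel ?B"
  have mup: "m powr (p - 1) * m = m powr p"
    using m powr_add[of m "p - 1" 1] by simp
  define I1 where "I1 = (\<integral>\<^sup>+z. ennreal (p * m powr (p - 1)) * (ennreal (cmod (f z)) * indicator ?B z) \<partial>lborel)"
  define I2 where "I2 = (\<integral>\<^sup>+z. ennreal (cmod (f z) powr p) * indicator ?B z
      + ennreal ((p - 1) * m powr p) * indicator ?B z \<partial>lborel)"
  have fin: "ennreal ((p - 1) * m powr p) * ?mu \<noteq> \<infinity>"
    by (cases "r \<le> 0") (auto simp: emeasure_ball ennreal_mult_eq_top_iff ball_empty)
  have "ennreal (m powr p) * ?mu + ennreal ((p - 1) * m powr p) * ?mu
      = ennreal (p * m powr (p - 1)) * (ennreal m * ?mu)"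
  proof -
    have "ennreal (m powr p) + ennreal ((p - 1) * m powr p) = ennreal (p * m powr p)"
      using p mult_right_mono[OF p, of "m powr p"] by (subst ennreal_plus[symmetric]) (auto simp: algebra_simps)
    also have "\<dots> = ennreal (p * m powr (p - 1)) * ennreal m"
      using p m by (simp add: mult.assoc mup flip: ennreal_mult)
    finally show ?thesis by (simp only: mult.assoc distrib_right[symmetric])
  qed
  also have "\<dots> \<le> ennreal (p * m powr (p - 1)) * (\<integral>\<^sup>+z\<in>?B. ennreal (cmod (f z)) \<partial>lborel)"
    unfolding m_def by (intro mult_left_mono holomorphic_area_submean f) auto
  also have "\<dots> = I1"
    unfolding I1_def
    using holomorphic_measurable_on_ball[OF f, of 1] by (subst nn_integral_cmult) auto
  finally have 1: "ennreal (m powr p) * ?mu + ennreal ((p - 1) * m powr p) * ?mu \<le> I1" .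
  have 2: "I1 \<le> I2"
    unfolding I1_def I2_def
  proof (intro nn_integral_mono)
    fix z
    have "ennreal (p * m powr (p - 1)) * ennreal (cmod (f z)) = ennreal (p * m powr (p - 1) * cmod (f z))"
      using p by (intro ennreal_mult[symmetric]) auto
    also have "\<dots> \<le> ennreal (cmod (f z) powr p + (p - 1) * m powr p)"
      using powr_tangent_le[OF p, of "cmod (f z)" m] m by (intro ennreal_leI) auto
    also have "\<dots> = ennreal (cmod (f z) powr p) + ennreal ((p - 1) * m powr p)"
      using p by (intro ennreal_plus) auto
    finally have "ennreal (p * m powr (p - 1)) * ennreal (cmod (f z))
        \<le> ennreal (cmod (f z) powr p) + ennreal ((p - 1) * m powr p)" .
    then show "ennreal (p * m powr (p - 1)) * (ennreal (cmod (f z)) * indicator ?B z)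
      \<le> ennreal (cmod (f z) powr p) * indicator ?B z + ennreal ((p - 1) * m powr p) * indicator ?B z"
      by (cases "z \<in> ?B")
        (simp_all only: indicator_simps mult_1_right mult_zero_right add_0_right order_refl not_False_eq_True)
  qed
  have 3: "I2 = (\<integral>\<^sup>+z\<in>?B. ennreal (cmod (f z) powr p) \<partial>lborel) + ennreal ((p - 1) * m powr p) * ?mu"
  proof -
    have "I2 = (\<integral>\<^sup>+z\<in>?B. ennreal (cmod (f z) powr p) \<partial>lborel)
        + (\<integral>\<^sup>+z. ennreal ((p - 1) * m powr p) * indicator ?B z \<partial>lborel)"
      unfolding I2_def
    proof (rule nn_integral_add)
      show "(\<lambda>z. ennreal (cmod (f z) powr p) * indicator ?B z) \<in> borel_measurable lborel"
        using holomorphic_measurable_on_ball[OF f, of p] by (simp only: measurable_lborel2)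
      show "(\<lambda>z. ennreal ((p - 1) * m powr p) * indicator ?B z) \<in> borel_measurable lborel"
        by (intro borel_measurable_times_ennreal borel_measurable_const borel_measurable_indicator) simp
    qed
    then show ?thesis by (simp only: nn_integral_cmult_indicator sets_lborel borel_open open_ball)
  qed
  have "ennreal ((p - 1) * m powr p) * ?mu + ennreal (m powr p) * ?mu
      \<le> ennreal ((p - 1) * m powr p) * ?mu + (\<integral>\<^sup>+z\<in>?B. ennreal (cmod (f z) powr p) \<partial>lborel)"
    using order_trans[OF 1 2] unfolding 3 by (simp only: add.commute)
  then show ?thesis
    unfolding ennreal_add_left_cancel_le m_def[symmetric] using fin by blast
qed auto

text \<open>Split at t. Below t the maximum is constant and y^b is integrable at 0; above t the
  integrand is y^(b-c), integrable at infinity. Both pieces scale like t^(b+1-c).\<close>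

lemma nn_integral_powr_max_le:
  fixes b c t :: real
  assumes b: "-1 < b" and c: "b + 1 < c" and t: "0 < t"
  shows "(\<integral>\<^sup>+y\<in>{0..}. ennreal (y powr b * max y t powr (-c)) \<partial>lborel)
     \<le> ennreal ((1 / (b + 1) + 1 / (c - b - 1)) * t powr (b + 1 - c))"
proof -
  have "(\<integral>\<^sup>+y\<in>{0..}. ennreal (y powr b * max y t powr (-c)) \<partial>lborel)
    \<le> (\<integral>\<^sup>+y. ennreal (t powr (-c)) * (ennreal (y powr b) * indicator {0..t} y)
         + ennreal (y powr (b - c)) * indicator {t..} y \<partial>lborel)"
    using t by (intro nn_integral_mono)
      (auto simp: indicator_def max_def powr_add[symmetric] ennreal_mult[symmetric] mult.commute)
  also have "\<dots> = ennreal (t powr (-c)) * ennreal (t powr (b + 1) / (b + 1))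
     + ennreal (- (t powr (b - c + 1)) / (b - c + 1))"
    using has_integral_powr_from_0[OF b, of t] has_integral_powr_to_inf[of "b - c" t] t c
    by (simp add: nn_integral_add nn_integral_cmult nn_integral_has_integral_lebesgue' flip: ennreal_mult)
  also have "\<dots> = ennreal (t powr (-c) * (t powr (b + 1) / (b + 1)) + - (t powr (b - c + 1)) / (b - c + 1))"
  proof (subst ennreal_plus)
    show "0 \<le> t powr (-c) * (t powr (b + 1) / (b + 1))" using b by simp
    show "0 \<le> - (t powr (b - c + 1)) / (b - c + 1)" using c by (intro divide_nonpos_neg) auto
    show "ennreal (t powr (-c)) * ennreal (t powr (b + 1) / (b + 1)) + ennreal (- (t powr (b - c + 1)) / (b - c + 1))
      = ennreal (t powr (-c) * (t powr (b + 1) / (b + 1))) + ennreal (- (t powr (b - c + 1)) / (b - c + 1))"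
      using b by (subst ennreal_mult) auto
  qed
  also have "t powr (-c) * (t powr (b + 1) / (b + 1)) + - (t powr (b - c + 1)) / (b - c + 1)
     = (1 / (b + 1) + 1 / (c - b - 1)) * t powr (b + 1 - c)"
  proof -
    have "t powr (-c) * t powr (b + 1) = t powr (b + 1 - c)"
      by (simp add: powr_add[symmetric])
    moreover have "- (t powr (b - c + 1)) / (b - c + 1) = t powr (b + 1 - c) / (c - b - 1)"
      using c by (simp add: field_simps)
    ultimately show ?thesis by (simp add: distrib_right)
  qed
  finally show ?thesis .
qed

subsection \<open>The Forelli-Rudin estimate\<close>

text \<open>Up to pi/3 the cosine is at least 1/2, so the mean value theorem applies. Beyond pi/3
  the sine is at least sqrt 3 / 2, which exceeds pi/4.\<close>

lemma sin_ge_half: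
  fixes x :: real
  assumes "0 \<le> x" "x \<le> pi / 2"
  shows "x / 2 \<le> sin x"
proof (cases "x \<le> pi / 3")
  case True
  have "\<exists>y. 0 < y \<and> y < x \<and> sin x - sin 0 = (x - 0) * cos y" if "0 < x"
    using that by (intro MVT2) (auto intro!: derivative_eq_intros)
  moreover have "1 / 2 \<le> cos y" if "0 < y" "y < x" for y
    using that True cos_mono_le_eq[of y "pi / 3"] by (simp add: cos_60)
  ultimately show ?thesis
    using assms(1) by (cases "x = 0") (force simp: field_simps)+
next
  case False
  have "x / 2 \<le> sqrt 3 / 2"
    using assms pi_less_4 real_le_rsqrt[of "17/10" 3] pi_approx by (simp add: power2_eq_square)
  also have "\<dots> \<le> sin x"
    using False assms sin_mono_le_eq[of "pi / 3" x] by (simp add: sin_60)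
  finally show ?thesis .
qed

lemma circle_point_add: "circle_point (s + t) = circle_point s * circle_point t"
  by (simp add: circle_point_def distrib_left exp_add)

lemma circle_point_of_int [simp]: "circle_point (of_int k) = 1"
  by (simp add: circle_point_def exp_eq_1)

text \<open>The exact formula |1 - r e^(2 pi i x)|^2 = (1 - r)^2 + 4 r sin^2(pi x) reduces the claim
  to the larger of its two terms. If the distance from x to k exceeds 1 - r, then r is at least 1/2,
  so the factor r does not spoil the sine term.\<close>

lemma norm_one_minus_circle_point_ge:
  assumes r: "0 \<le> r" "r < 1" and k: "\<bar>x - of_int k\<bar> \<le> 1 / 2"
  shows "max (1 - r) \<bar>x - of_int k\<bar> / 2 \<le> cmod (1 - of_real r * circle_point x)"
proof -
  define y where "y = \<bar>x - of_int k\<bar>"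
  have y: "0 \<le> y" "y \<le> 1 / 2" using k by (auto simp: y_def)
  have "circle_point x = circle_point (x - of_int k)"
    using circle_point_add[of "x - of_int k" "of_int k"] by simp
  then have "Re (circle_point x) = cos (2 * (pi * (x - of_int k)))"
    by (simp add: circle_point_def Re_exp mult.assoc)
  also have "\<dots> = cos \<bar>2 * (pi * (x - of_int k))\<bar>" by (rule cos_abs_real[symmetric])
  also have "\<bar>2 * (pi * (x - of_int k))\<bar> = 2 * (pi * y)" by (simp add: y_def abs_mult)
  finally have Re: "Re (circle_point x) = cos (2 * (pi * y))" .
  have "(cmod (1 - of_real r * circle_point x))\<^sup>2 = 1 - 2 * r * Re (circle_point x) + r\<^sup>2 * (cmod (circle_point x))\<^sup>2"
    unfolding cmod_power2 by (simp add: power2_eq_square algebra_simps)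
  also have "\<dots> = (1 - r)\<^sup>2 + 4 * r * (sin (pi * y))\<^sup>2"
    unfolding Re cos_double_sin by (simp add: power2_eq_square algebra_simps)
  finally have eq: "(cmod (1 - of_real r * circle_point x))\<^sup>2 = (1 - r)\<^sup>2 + 4 * r * (sin (pi * y))\<^sup>2" .
  have "y \<le> pi * y / 2" using y mult_right_mono[OF pi_ge_two, of y] by simp
  also have "\<dots> \<le> sin (pi * y)" using y by (intro sin_ge_half) (auto simp: field_simps)
  finally have s: "y\<^sup>2 \<le> (sin (pi * y))\<^sup>2" using y by (intro power_mono) auto
  have "(max (1 - r) y / 2)\<^sup>2 \<le> (cmod (1 - of_real r * circle_point x))\<^sup>2"
  proof (cases "1 - r \<ge> y")
    case True
    then show ?thesis unfolding eq using r by (simp add: max_def power_divide)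
  next
    case False
    then have "r \<ge> 1 / 2" using y by simp
    then have "y\<^sup>2 / 4 \<le> 4 * r * (sin (pi * y))\<^sup>2"
      using s mult_mono[of "2" "4 * r" "y\<^sup>2" "(sin (pi * y))\<^sup>2"] zero_le_power2[of y] by linarith
    then show ?thesis unfolding eq using False
      by (simp add: max_def power_divide) (smt (verit) zero_le_power2)
  qed
  then show ?thesis unfolding y_def[symmetric] by (rule power2_le_imp_le) simp
qed

lemma nn_integral_powr_max_abs_le:
  fixes c t :: real
  assumes c: "1 < c" and t: "0 < t"
  shows "(\<integral>\<^sup>+y. ennreal (max \<bar>y\<bar> t powr (-c)) \<partial>lborel)
     \<le> ennreal (2 * (1 + 1 / (c - 1)) * t powr (1 - c))"
proof -
  define h where "h = (\<lambda>y. ennreal (y powr 0 * max y t powr (-c)) * indicator {0..} y)"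
  have [measurable]: "h \<in> borel_measurable borel" unfolding h_def by measurable
  have h: "(\<integral>\<^sup>+y. h y \<partial>lborel) \<le> ennreal ((1 + 1 / (c - 1)) * t powr (1 - c))"
    using nn_integral_powr_max_le[of 0 c t] c t by (simp add: h_def)
  \<comment> \<open>At y = 0 the factor \<open>y powr 0\<close> makes both copies of h vanish, so
    the pointwise bound holds only almost everywhere.\<close>
  have "AE y in lborel. y \<noteq> (0::real)" by (rule AE_lborel_singleton)
  then have "(\<integral>\<^sup>+y. ennreal (max \<bar>y\<bar> t powr (-c)) \<partial>lborel) \<le> (\<integral>\<^sup>+y. h y + h (0 + (-1) * y) \<partial>lborel)"
    by (intro nn_integral_mono_AE, elim AE_mp) (auto intro!: AE_I2 simp: h_def indicator_def abs_if)
  also have "\<dots> = (\<integral>\<^sup>+y. h y \<partial>lborel) + (\<integral>\<^sup>+y. h y \<partial>lborel)"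
    using nn_integral_real_affine[of h "-1" 0] by (subst nn_integral_add) auto
  also have "\<dots> \<le> ennreal ((1 + 1 / (c - 1)) * t powr (1 - c)) + ennreal ((1 + 1 / (c - 1)) * t powr (1 - c))"
    by (intro add_mono h)
  also have "\<dots> = ennreal (2 * (1 + 1 / (c - 1)) * t powr (1 - c))"
    using c by (subst ennreal_plus[symmetric]) auto
  finally show ?thesis .
qed

text \<open>With \<zeta> = r e^(2 pi i x0) and |x0| \<le> 1/2, the angle x0 + t stays in
  [-1/2, 3/2], so an integer within 1/2 of it can be chosen as 0 or 1. Two translates of h therefore
  dominate the integrand. The constant collects 2^c from halving the maximum, and 4 from two
  translates with two half-lines each.\<close>

lemma circle_integral_kernel_le:
  assumes c: "1 < c" and \<zeta>: "cmod \<zeta> < 1"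
  shows "(\<integral>\<^sup>+t\<in>{0..1}. ennreal (cmod (1 - \<zeta> * circle_point t) powr (-c)) \<partial>lborel)
    \<le> ennreal (2 powr c * (4 * (1 + 1 / (c - 1))) * (1 - cmod \<zeta>) powr (1 - c))"
proof -
  define r where "r = cmod \<zeta>"
  define x0 where "x0 = Arg \<zeta> / (2 * pi)"
  have r: "0 \<le> r" "r < 1" using \<zeta> by (auto simp: r_def)
  have x0: "\<bar>x0\<bar> \<le> 1 / 2"
    using Arg_bounded[of \<zeta>] by (auto simp: x0_def abs_le_iff field_simps)
  have z: "\<zeta> = of_real r * circle_point x0"
    using Arg_eq[of \<zeta>] by (cases "\<zeta> = 0") (auto simp: r_def x0_def circle_point_def mult_ac)
  define h where "h = (\<lambda>y::real. ennreal (max \<bar>y\<bar> (1 - r) powr (-c)))"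
  have [measurable]: "h \<in> borel_measurable borel" unfolding h_def by measurable
  have shift: "(\<integral>\<^sup>+t. h (x + 1 * t) \<partial>lborel) = (\<integral>\<^sup>+t. h t \<partial>lborel)" for x
    using nn_integral_real_affine[of h 1 x] by simp
  have pt: "ennreal (cmod (1 - \<zeta> * circle_point t) powr (-c)) * indicator {0..1} t
     \<le> ennreal (2 powr c) * (h (x0 + 1 * t) + h ((x0 - 1) + 1 * t))" for t
  proof (cases "t \<in> {0..1}")
    case True
    define x where "x = x0 + t"
    have x: "- 1 / 2 \<le> x" "x \<le> 3 / 2" using True x0 by (auto simp: x_def abs_le_iff)
    define k where "k = (if x \<le> 1 / 2 then 0 else 1 :: int)"
    have k: "\<bar>x - of_int k\<bar> \<le> 1 / 2" using x by (auto simp: k_def abs_if)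
    have "cmod (1 - \<zeta> * circle_point t) powr (-c) = cmod (1 - of_real r * circle_point x) powr (-c)"
      by (subst z) (simp add: x_def circle_point_add mult.assoc)
    also have "\<dots> \<le> (max (1 - r) \<bar>x - of_int k\<bar> / 2) powr (-c)"
      using norm_one_minus_circle_point_ge[OF r k] r c by (intro powr_mono2') auto
    also have "\<dots> = 2 powr c * max \<bar>x - of_int k\<bar> (1 - r) powr (-c)"
      using r by (simp add: powr_divide powr_minus field_simps max.commute)
    finally have "ennreal (cmod (1 - \<zeta> * circle_point t) powr (-c)) \<le> ennreal (2 powr c) * h (x - of_int k)"
      unfolding h_def by (simp flip: ennreal_mult)
    also have "\<dots> \<le> ennreal (2 powr c) * (h x + h (x - 1))"
      by (intro mult_left_mono) (auto simp: k_def)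
    finally show ?thesis using True by (simp add: x_def algebra_simps)
  qed auto
  have "(\<integral>\<^sup>+t\<in>{0..1}. ennreal (cmod (1 - \<zeta> * circle_point t) powr (-c)) \<partial>lborel)
     \<le> (\<integral>\<^sup>+t. ennreal (2 powr c) * (h (x0 + 1 * t) + h ((x0 - 1) + 1 * t)) \<partial>lborel)"
    by (intro nn_integral_mono pt)
  also have "\<dots> = ennreal (2 powr c) * (\<integral>\<^sup>+t. h (x0 + 1 * t) + h ((x0 - 1) + 1 * t) \<partial>lborel)"
    by (rule nn_integral_cmult) measurable
  also have "(\<integral>\<^sup>+t. h (x0 + 1 * t) + h ((x0 - 1) + 1 * t) \<partial>lborel)
      = (\<integral>\<^sup>+t. h (x0 + 1 * t) \<partial>lborel) + (\<integral>\<^sup>+t. h ((x0 - 1) + 1 * t) \<partial>lborel)"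
    by (rule nn_integral_add; measurable)
  also have "\<dots> = (\<integral>\<^sup>+t. h t \<partial>lborel) + (\<integral>\<^sup>+t. h t \<partial>lborel)"
    by (simp only: shift)
  also have "ennreal (2 powr c) * ((\<integral>\<^sup>+t. h t \<partial>lborel) + (\<integral>\<^sup>+t. h t \<partial>lborel))
      \<le> ennreal (2 powr c) * (ennreal (2 * (1 + 1 / (c - 1)) * (1 - r) powr (1 - c))
       + ennreal (2 * (1 + 1 / (c - 1)) * (1 - r) powr (1 - c)))"
    unfolding h_def using r by (intro mult_left_mono add_mono nn_integral_powr_max_abs_le c) auto
  also have "\<dots> = ennreal (2 powr c * (4 * (1 + 1 / (c - 1))) * (1 - r) powr (1 - c))"
    using c by (subst ennreal_plus[symmetric]) (auto simp flip: ennreal_mult simp: mult.assoc)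
  finally show ?thesis by (simp add: r_def)
qed

text \<open>Change of variables by comparing measures: for x in [0,1] the set where 1 - |z|^2 > x is
  a disc of area pi (1 - x), so the image of area on the disc and pi times length on [0,1] agree on
  all half-lines.\<close>

lemma nn_integral_disc_radial:
  fixes h :: "real \<Rightarrow> ennreal"
  assumes [measurable]: "h \<in> borel_measurable borel"
  shows "(\<integral>\<^sup>+z\<in>unit_disc. h (1 - (cmod z)\<^sup>2) \<partial>lborel) = ennreal pi * (\<integral>\<^sup>+y\<in>{0..1}. h y \<partial>lborel)"
proof -
  define M where "M = distr (density lborel (indicator unit_disc)) borel (\<lambda>z::complex. 1 - (cmod z)\<^sup>2)"
  define N where "N = density lborel (\<lambda>y. ennreal pi * indicator {0..1::real} y)"
  have [measurable]: "unit_disc \<in> sets borel" by simp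
  have eM: "emeasure M {x<..} = ennreal (pi * (1 - max 0 (min 1 x)))" for x
  proof -
    have "emeasure M {x<..} = emeasure lborel ({z. x < 1 - (cmod z)\<^sup>2} \<inter> unit_disc)"
      unfolding M_def by (subst emeasure_distr) (auto simp: emeasure_restricted vimage_def Int_commute)
    also have "{z. x < 1 - (cmod z)\<^sup>2} \<inter> unit_disc = ball 0 (sqrt (1 - max 0 (min 1 x)))"
    proof (intro set_eqI)
      fix z :: complex
      have "cmod z < sqrt (1 - max 0 (min 1 x)) \<longleftrightarrow> sqrt ((cmod z)\<^sup>2) < sqrt (1 - max 0 (min 1 x))"
        by simp
      also have "\<dots> \<longleftrightarrow> (cmod z)\<^sup>2 < 1 - max 0 (min 1 x)" by (simp only: real_sqrt_less_iff)
      also have "\<dots> \<longleftrightarrow> x < 1 - (cmod z)\<^sup>2 \<and> (cmod z)\<^sup>2 < 1"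
        using zero_le_power2[of "cmod z"] by (smt (verit) max_def min_def)
      also have "(cmod z)\<^sup>2 < 1 \<longleftrightarrow> cmod z < 1"
        by (simp add: power_less_one_iff)
      finally show "z \<in> {z. x < 1 - (cmod z)\<^sup>2} \<inter> unit_disc \<longleftrightarrow> z \<in> ball 0 (sqrt (1 - max 0 (min 1 x)))"
        by simp
    qed
    also have "emeasure lborel (ball (0::complex) (sqrt (1 - max 0 (min 1 x)))) = ennreal (pi * (1 - max 0 (min 1 x)))"
      by (subst emeasure_ball) (auto simp: unit_ball_vol_2)
    finally show ?thesis .
  qed
  have eN: "emeasure N {x<..} = ennreal (pi * (1 - max 0 (min 1 x)))" for x
  proof -
    have "emeasure N {x<..} = (\<integral>\<^sup>+y. ennreal pi * indicator ({0..1} \<inter> {x<..}) y \<partial>lborel)"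
      unfolding N_def by (subst emeasure_density)
        (auto intro!: nn_integral_cong split: split_indicator)
    also have "\<dots> = ennreal pi * emeasure lborel ({0..1} \<inter> {x<..})"
      by (simp add: nn_integral_cmult_indicator)
    also have "{0..1} \<inter> {x<..} = (if x < 0 then {0..1} else {x<..1})" by auto
    also have "emeasure lborel \<dots> = ennreal (1 - max 0 (min 1 x))"
      by (auto simp: max_def min_def)
    finally show ?thesis by (simp add: ennreal_mult)
  qed
  have "M = N"
    by (rule measure_eqI_lessThan) (auto simp: eM eN, auto simp: M_def N_def)
  have "(\<integral>\<^sup>+z\<in>unit_disc. h (1 - (cmod z)\<^sup>2) \<partial>lborel) = (\<integral>\<^sup>+y. h y \<partial>M)"
    unfolding M_def by (subst nn_integral_distr) (auto simp: nn_integral_density mult.commute)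
  also have "\<dots> = ennreal pi * (\<integral>\<^sup>+y\<in>{0..1}. h y \<partial>lborel)"
    unfolding \<open>M = N\<close> N_def
    by (subst nn_integral_density) (auto simp: mult_ac nn_integral_cmult[symmetric])
  finally show ?thesis .
qed

text \<open>Factors in the order in which they arise: the circle integral with exponent c, the
  halved maximum raised to c - 1, pi from the radial substitution, and the truncated power integral
  with exponents \<alpha> and c - 1.\<close>

definition kernel_const :: "real \<Rightarrow> real \<Rightarrow> real" where
  "kernel_const \<alpha> c = 2 powr c * (4 * (1 + 1 / (c - 1))) * 2 powr (c - 1) * pi * (1 / (\<alpha> + 1) + 1 / (c - 1 - \<alpha> - 1))"

text \<open>Averaging over rotations turns the kernel into (1 - |a||z|)^(1-c), and 1 - |a||z| is at
  least half the maximum of 1 - |z|^2 and 1 - |a|^2. What remains is a truncated power integral with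
  t = 1 - |a|^2, finite because c - 1 > \<alpha> + 1.\<close>

lemma disc_integral_kernel_le:
  assumes \<alpha>: "-1 < \<alpha>" and c: "2 + \<alpha> < c" and a: "cmod a < 1"
  shows "(\<integral>\<^sup>+z\<in>unit_disc. ennreal ((1 - (cmod z)\<^sup>2) powr \<alpha> * cmod (1 - cnj a * z) powr (-c)) \<partial>lborel)
    \<le> ennreal (kernel_const \<alpha> c * (1 - (cmod a)\<^sup>2) powr (2 + \<alpha> - c))"
proof -
  define F where "F = (\<lambda>z. ennreal ((1 - (cmod z)\<^sup>2) powr \<alpha> * cmod (1 - cnj a * z) powr (-c)) * indicator unit_disc z)"
  define t where "t = 1 - (cmod a)\<^sup>2"
  define K where "K = 2 powr c * (4 * (1 + 1 / (c - 1)))"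
  have K: "K \<ge> 0" using \<alpha> c by (simp add: K_def)
  have t: "0 < t" using a by (simp add: t_def power_less_one_iff)
  have [measurable]: "unit_disc \<in> sets borel" by simp
  have [measurable]: "F \<in> borel_measurable borel" unfolding F_def by measurable
  define H where "H = (\<lambda>y. ennreal (K * 2 powr (c - 1)) * ennreal (y powr \<alpha> * max y t powr (-(c - 1))))"
  have [measurable]: "H \<in> borel_measurable borel" unfolding H_def by measurable
  have pt: "(\<integral>\<^sup>+s\<in>{0..1}. F (circle_point s * z) \<partial>lborel) \<le> H (1 - (cmod z)\<^sup>2) * indicator unit_disc z" for z
  proof (cases "z \<in> unit_disc")
    case True
    then have z: "cmod z < 1" by simp
    have az: "cmod (cnj a * z) \<le> cmod z" "cmod (cnj a * z) \<le> cmod a"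
      using a z by (auto simp: norm_mult mult_left_le_one_le mult_right_le_one_le)
    have sq: "1 - x\<^sup>2 \<le> 2 * (1 - x)" for x :: real
      using zero_le_power2[of "1 - x"] by (simp add: power2_eq_square algebra_simps)
    have lower: "max (1 - (cmod z)\<^sup>2) t / 2 \<le> 1 - cmod (cnj a * z)"
      using az sq[of "cmod z"] sq[of "cmod a"] by (auto simp: t_def)
    have "(\<integral>\<^sup>+s\<in>{0..1}. F (circle_point s * z) \<partial>lborel)
      = (\<integral>\<^sup>+s. ennreal ((1 - (cmod z)\<^sup>2) powr \<alpha>) *
          (ennreal (cmod (1 - (cnj a * z) * circle_point s) powr (-c)) * indicator {0..1} s) \<partial>lborel)"
      using z by (intro nn_integral_cong)
        (auto simp: F_def norm_mult indicator_def ennreal_mult[symmetric] mult_ac)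
    also have "\<dots> = ennreal ((1 - (cmod z)\<^sup>2) powr \<alpha>) *
       (\<integral>\<^sup>+s\<in>{0..1}. ennreal (cmod (1 - (cnj a * z) * circle_point s) powr (-c)) \<partial>lborel)"
      by (rule nn_integral_cmult) measurable
    also have "\<dots> \<le> ennreal ((1 - (cmod z)\<^sup>2) powr \<alpha>) * ennreal (K * (1 - cmod (cnj a * z)) powr (1 - c))"
      unfolding K_def using az z c \<alpha> by (intro mult_left_mono circle_integral_kernel_le) auto
    also have "(1 - cmod (cnj a * z)) powr (1 - c) \<le> (max (1 - (cmod z)\<^sup>2) t / 2) powr (1 - c)"
      using lower t c \<alpha> by (intro powr_mono2') auto
    also have "(max (1 - (cmod z)\<^sup>2) t / 2) powr (1 - c) = 2 powr (c - 1) * max (1 - (cmod z)\<^sup>2) t powr (-(c - 1))"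
      using t powr_minus[of 2 "c - 1"] by (simp add: powr_divide field_simps)
    also have "ennreal ((1 - (cmod z)\<^sup>2) powr \<alpha>) * ennreal (K * (2 powr (c - 1) * max (1 - (cmod z)\<^sup>2) t powr (-(c - 1))))
      = H (1 - (cmod z)\<^sup>2)"
      unfolding H_def using K by (simp add: ennreal_mult[symmetric] mult_ac)
    finally show ?thesis using True K by (simp add: mult_left_mono ennreal_leI)
  qed (simp add: F_def norm_mult)
  have "(\<integral>\<^sup>+z. F z \<partial>lborel) = (\<integral>\<^sup>+z. (\<integral>\<^sup>+s\<in>{0..1}. F (circle_point s * z) \<partial>lborel) \<partial>lborel)"
    by (rule nn_integral_rotation_average) measurable
  also have "\<dots> \<le> (\<integral>\<^sup>+z\<in>unit_disc. H (1 - (cmod z)\<^sup>2) \<partial>lborel)"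
    by (intro nn_integral_mono pt)
  also have "\<dots> = ennreal pi * (\<integral>\<^sup>+y\<in>{0..1}. H y \<partial>lborel)"
    by (rule nn_integral_disc_radial) measurable
  also have "\<dots> \<le> ennreal pi * (\<integral>\<^sup>+y. ennreal (K * 2 powr (c - 1)) *
      (ennreal (y powr \<alpha> * max y t powr (-(c - 1))) * indicator {0..} y) \<partial>lborel)"
    by (intro mult_left_mono nn_integral_mono) (auto simp: H_def indicator_def)
  also have "\<dots> = ennreal pi * (ennreal (K * 2 powr (c - 1)) *
      (\<integral>\<^sup>+y\<in>{0..}. ennreal (y powr \<alpha> * max y t powr (-(c - 1))) \<partial>lborel))"
    by (subst nn_integral_cmult) simp_all
  also have "\<dots> \<le> ennreal pi * (ennreal (K * 2 powr (c - 1)) *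
      ennreal ((1 / (\<alpha> + 1) + 1 / (c - 1 - \<alpha> - 1)) * t powr (\<alpha> + 1 - (c - 1))))"
    using c t by (intro mult_left_mono nn_integral_powr_max_le \<alpha>) auto
  also have "\<dots> = ennreal (kernel_const \<alpha> c * t powr (2 + \<alpha> - c))"
  proof -
    define Q where "Q = 1 / (\<alpha> + 1) + 1 / (c - 1 - \<alpha> - 1)"
    have Q: "Q \<ge> 0" using \<alpha> c by (simp add: Q_def)
    have e: "\<alpha> + 1 - (c - 1) = 2 + \<alpha> - c" by simp
    have kc: "kernel_const \<alpha> c = pi * (K * 2 powr (c - 1) * Q)"
      by (simp only: kernel_const_def K_def Q_def mult_ac)
    show ?thesis
      unfolding Q_def[symmetric] e kc using K Q by (simp add: ennreal_mult[symmetric] mult.assoc)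
  qed
  finally show ?thesis by (simp add: F_def t_def)
qed

subsection \<open>Weighted Bergman norms and point evaluations\<close>

lemma hol_discD:
  assumes "f \<in> hol_disc"
  shows "f holomorphic_on unit_disc" "\<And>z. z \<notin> unit_disc \<Longrightarrow> f z = 0"
  using assms by (auto simp: hol_disc_def)

lemma hol_disc_borel_measurable:
  assumes "f \<in> hol_disc"
  shows "f \<in> borel_measurable borel"
proof -
  have "(\<lambda>z. indicator unit_disc z *\<^sub>R f z) \<in> borel_measurable borel"
    by (intro borel_measurable_continuous_on_indicator holomorphic_on_imp_continuous_on
        hol_discD(1) assms) auto
  also have "(\<lambda>z. indicator unit_disc z *\<^sub>R f z) = f"
    using hol_discD(2)[OF assms] by (auto simp: indicator_def)
  finally show ?thesis .
qed

lemma hol_disc_lincomb: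
  assumes "f \<in> hol_disc" "g \<in> hol_disc"
  shows "(\<lambda>z. b * f z + c * g z) \<in> hol_disc"
  using assms by (auto simp: hol_disc_def intro!: holomorphic_intros)

text \<open>Cauchy's estimate on the circle about w of radius d/2, half the distance to the
  boundary. There 1 - |z| is still at least d/2, which costs 2^t; dividing by the radius costs
  another 2.\<close>

lemma deriv_growth:
  assumes f: "f holomorphic_on unit_disc" and t: "0 \<le> t"
    and le: "\<And>z. z \<in> unit_disc \<Longrightarrow> cmod (f z) \<le> M * (1 - cmod z) powr (-t)"
    and w: "w \<in> unit_disc"
  shows "cmod (deriv f w) \<le> 2 powr (t + 1) * M * (1 - cmod w) powr (-(t + 1))"
proof -
  define d where "d = 1 - cmod w"
  have d: "d > 0" using w by (simp add: d_def)
  have M: "M \<ge> 0"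
    using order_trans[OF norm_ge_zero le[of 0]] by simp
  have sub: "cball w (d / 2) \<subseteq> unit_disc"
  proof
    fix z assume "z \<in> cball w (d / 2)"
    then have "cmod z \<le> cmod w + d / 2"
      using norm_triangle_ineq2[of z w] by (simp add: dist_norm norm_minus_commute)
    then show "z \<in> unit_disc" using d by (simp add: d_def field_simps)
  qed
  have "cmod ((deriv ^^ 1) f w) \<le> fact 1 * (M * (d / 2) powr (-t)) / (d / 2) ^ 1"
  proof (rule Cauchy_inequality)
    show "f holomorphic_on ball w (d / 2)"
      using f sub by (meson ball_subset_cball holomorphic_on_subset subset_trans)
    show "continuous_on (cball w (d / 2)) f"
      using f sub by (meson holomorphic_on_imp_continuous_on holomorphic_on_subset)
    fix z assume z: "cmod (w - z) = d / 2"
    then have "cmod (f z) \<le> M * (1 - cmod z) powr (-t)"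
      using sub by (intro le) (auto simp: dist_norm)
    also have "d / 2 \<le> 1 - cmod z"
      using norm_triangle_ineq2[of z w] z by (simp add: d_def norm_minus_commute)
    then have "M * (1 - cmod z) powr (-t) \<le> M * (d / 2) powr (-t)"
      using d t M by (intro mult_left_mono powr_mono2') auto
    finally show "cmod (f z) \<le> M * (d / 2) powr (-t)" .
  qed (use d in auto)
  also have "\<dots> = 2 powr (t + 1) * M * d powr (-(t + 1))"
    using d by (simp add: powr_divide powr_add powr_minus powr_diff field_simps)
  finally show ?thesis by (simp add: d_def)
qed

lemma power_add_le:
  fixes x y p :: real
  assumes "0 \<le> x" "0 \<le> y" "0 \<le> p"
  shows "(x + y) powr p \<le> 2 powr p * (x powr p + y powr p)"
proof -
  have "(x + y) powr p \<le> (2 * max x y) powr p"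
    using assms by (intro powr_mono2) auto
  also have "\<dots> = 2 powr p * max x y powr p"
    using assms by (simp add: powr_mult)
  also have "\<dots> \<le> 2 powr p * (x powr p + y powr p)"
    by (intro mult_left_mono) (auto simp: max_def)
  finally show ?thesis .
qed

lemma cmod_diff_le_moebius:
  assumes "cmod a < 1" "cmod z < 1"
  shows "cmod (z - a) \<le> cmod (1 - cnj a * z)"
proof -
  have "(cmod (1 - cnj a * z))\<^sup>2 - (cmod (z - a))\<^sup>2 = (1 - (cmod a)\<^sup>2) * (1 - (cmod z)\<^sup>2)"
    unfolding cmod_power2 by (simp add: power2_eq_square algebra_simps)
  also have "\<dots> \<ge> 0"
    using assms by (intro mult_nonneg_nonneg) (auto simp: power_le_one_iff)
  finally have "(cmod (z - a))\<^sup>2 \<le> (cmod (1 - cnj a * z))\<^sup>2" by linarith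
  then show ?thesis by (rule power2_le_imp_le) (rule norm_ge_zero)
qed

locale bergman =
  fixes p \<alpha> :: real
  assumes p: "1 \<le> p" and \<alpha>: "-1 < \<alpha>"
begin

definition s :: real where "s = (2 + \<alpha>) / p"
text \<open>An integer above s: the kernels are then ordinary powers of 1 / (1 - cnj a z), free of
  branches, and N p > 2 + \<alpha> puts their p-th powers in the range of the Forelli-Rudin
  estimate.\<close>

definition N :: nat where "N = nat \<lceil>s\<rceil> + 1"

lemma s_pos: "0 < s" using p \<alpha> by (simp add: s_def)
lemma s_p: "s * p = 2 + \<alpha>" using p by (simp add: s_def)
lemma N_gt: "s < real N" unfolding N_def by linarith
lemma N_pos: "1 \<le> N" unfolding N_def by simp

abbreviation "BI \<equiv> bergman_integral p \<alpha>"
abbreviation "BN \<equiv> bergman_norm p \<alpha>"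

lemma bergman_measurable:
  assumes "f \<in> hol_disc"
  shows "(\<lambda>z. ennreal (cmod (f z) powr p * (1 - (cmod z)\<^sup>2) powr \<alpha>)) \<in> borel_measurable borel"
  using hol_disc_borel_measurable[OF assms] by measurable

lemma bergman_integral_eq:
  assumes "f \<in> hol_disc"
  shows "BI f = ennreal ((\<alpha> + 1) / pi) *
     (\<integral>\<^sup>+z\<in>unit_disc. ennreal (cmod (f z) powr p * (1 - (cmod z)\<^sup>2) powr \<alpha>) \<partial>lborel)"
proof -
  have e: "emeasure lborel unit_disc = ennreal pi"
    by (subst emeasure_ball) (auto simp: unit_ball_vol_2)
  have "BI f = ennreal (\<alpha> + 1) *
     ((\<integral>\<^sup>+z\<in>unit_disc. ennreal (cmod (f z) powr p * (1 - (cmod z)\<^sup>2) powr \<alpha>) \<partial>lborel) / ennreal pi)"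
    unfolding bergman_integral_def e[symmetric] using bergman_measurable[OF assms]
    by (subst nn_integral_uniform_measure) simp_all
  also have "\<dots> = ennreal (\<alpha> + 1) * inverse (ennreal pi) *
    (\<integral>\<^sup>+z\<in>unit_disc. ennreal (cmod (f z) powr p * (1 - (cmod z)\<^sup>2) powr \<alpha>) \<partial>lborel)"
    by (simp add: divide_ennreal_def mult_ac)
  also have "ennreal (\<alpha> + 1) * inverse (ennreal pi) = ennreal ((\<alpha> + 1) / pi)"
    using \<alpha> by (simp add: inverse_ennreal ennreal_mult[symmetric] divide_inverse)
  finally show ?thesis .
qed

text \<open>Moves the p-th root and the case distinction in \<open>bergman_norm\<close> out of the
  way, so that norm bounds can be proved on the integral.\<close>

lemma bergman_norm_le_iff:
  assumes B: "0 \<le> B"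
  shows "BN f \<le> ennreal B \<longleftrightarrow> BI f \<le> ennreal (B powr p)"
proof (cases "BI f = \<infinity>")
  case True
  then show ?thesis by (simp add: bergman_norm_def top_unique)
next
  case False
  then obtain x where x: "BI f = ennreal x" "0 \<le> x" by (cases "BI f") auto
  have "x powr (1 / p) \<le> B \<longleftrightarrow> x \<le> B powr p"
  proof
    assume "x powr (1 / p) \<le> B"
    then have "(x powr (1 / p)) powr p \<le> B powr p" using p by (intro powr_mono2) auto
    then show "x \<le> B powr p" using p x by (simp add: powr_powr)
  next
    assume "x \<le> B powr p"
    then have "x powr (1 / p) \<le> (B powr p) powr (1 / p)" using p x by (intro powr_mono2) auto
    then show "x powr (1 / p) \<le> B" using p B by (simp add: powr_powr)
  qed
  then show ?thesis using False x B by (simp add: bergman_norm_def)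
qed

text \<open>Stands in for Minkowski's inequality: the crude bound (x + y)^p \<le> 2^p (x^p + y^p) is
  integrated pointwise.\<close>

lemma bergman_integral_lincomb_le:
  assumes f: "f \<in> hol_disc" and g: "g \<in> hol_disc"
  shows "BI (\<lambda>z. b * f z + c * g z) \<le>
    ennreal (2 powr p * cmod b powr p) * BI f + ennreal (2 powr p * cmod c powr p) * BI g"
proof -
  let ?w = "\<lambda>h z. ennreal (cmod (h z) powr p * (1 - (cmod z)\<^sup>2) powr \<alpha>) * indicator unit_disc z"
  let ?b = "2 powr p * cmod b powr p" and ?c = "2 powr p * cmod c powr p"
  have [measurable]: "unit_disc \<in> sets borel" by simp
  have mf: "?w f \<in> borel_measurable lborel" and mg: "?w g \<in> borel_measurable lborel"
    using hol_disc_borel_measurable[OF f] hol_disc_borel_measurable[OF g] by measurable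
  have pt: "?w (\<lambda>z. b * f z + c * g z) z \<le> ennreal ?b * ?w f z + ennreal ?c * ?w g z" for z
  proof (cases "z \<in> unit_disc")
    case True
    have "cmod (b * f z + c * g z) powr p \<le> (cmod (b * f z) + cmod (c * g z)) powr p"
      using p by (intro powr_mono2 norm_triangle_ineq) auto
    also have "\<dots> \<le> 2 powr p * (cmod (b * f z) powr p + cmod (c * g z) powr p)"
      using p by (intro power_add_le) auto
    also have "\<dots> = ?b * cmod (f z) powr p + ?c * cmod (g z) powr p"
      by (simp add: norm_mult powr_mult distrib_left mult.assoc)
    finally have "cmod (b * f z + c * g z) powr p * (1 - (cmod z)\<^sup>2) powr \<alpha>
       \<le> (?b * cmod (f z) powr p + ?c * cmod (g z) powr p) * (1 - (cmod z)\<^sup>2) powr \<alpha>"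
      by (intro mult_right_mono) auto
    then have "ennreal (cmod (b * f z + c * g z) powr p * (1 - (cmod z)\<^sup>2) powr \<alpha>)
       \<le> ennreal ((?b * cmod (f z) powr p + ?c * cmod (g z) powr p) * (1 - (cmod z)\<^sup>2) powr \<alpha>)"
      by (rule ennreal_leI)
    also have "(?b * cmod (f z) powr p + ?c * cmod (g z) powr p) * (1 - (cmod z)\<^sup>2) powr \<alpha>
      = ?b * (cmod (f z) powr p * (1 - (cmod z)\<^sup>2) powr \<alpha>)
      + ?c * (cmod (g z) powr p * (1 - (cmod z)\<^sup>2) powr \<alpha>)"
      by (simp only: distrib_right mult.assoc)
    also have "ennreal \<dots> = ennreal ?b * ennreal (cmod (f z) powr p * (1 - (cmod z)\<^sup>2) powr \<alpha>)
      + ennreal ?c * ennreal (cmod (g z) powr p * (1 - (cmod z)\<^sup>2) powr \<alpha>)"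
      by (subst ennreal_plus) (auto simp: ennreal_mult)
    finally show ?thesis using True by (simp only: indicator_simps mult_1_right)
  qed simp
  have "(\<integral>\<^sup>+z. ?w (\<lambda>z. b * f z + c * g z) z \<partial>lborel)
     \<le> (\<integral>\<^sup>+z. ennreal ?b * ?w f z + ennreal ?c * ?w g z \<partial>lborel)"
    by (intro nn_integral_mono pt)
  also have "\<dots> = (\<integral>\<^sup>+z. ennreal ?b * ?w f z \<partial>lborel) + (\<integral>\<^sup>+z. ennreal ?c * ?w g z \<partial>lborel)"
    by (rule nn_integral_add; intro borel_measurable_times_ennreal borel_measurable_const mf mg)
  also have "(\<integral>\<^sup>+z. ennreal ?b * ?w f z \<partial>lborel) = ennreal ?b * (\<integral>\<^sup>+z. ?w f z \<partial>lborel)"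
    by (rule nn_integral_cmult[OF mf])
  also have "(\<integral>\<^sup>+z. ennreal ?c * ?w g z \<partial>lborel) = ennreal ?c * (\<integral>\<^sup>+z. ?w g z \<partial>lborel)"
    by (rule nn_integral_cmult[OF mg])
  finally have "ennreal ((\<alpha> + 1) / pi) * (\<integral>\<^sup>+z. ?w (\<lambda>z. b * f z + c * g z) z \<partial>lborel) \<le>
     ennreal ((\<alpha> + 1) / pi) * (ennreal ?b * (\<integral>\<^sup>+z. ?w f z \<partial>lborel) + ennreal ?c * (\<integral>\<^sup>+z. ?w g z \<partial>lborel))"
    by (rule mult_left_mono) simp
  then show ?thesis
    unfolding bergman_integral_eq[OF f] bergman_integral_eq[OF g]
      bergman_integral_eq[OF hol_disc_lincomb[OF f g]]
    by (simp only: distrib_left mult.left_commute)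
qed

lemma fspace_bergman_iff: "f \<in> fspace BN \<longleftrightarrow> f \<in> hol_disc \<and> BI f < \<infinity>"
  by (auto simp: fspace_def bergman_norm_def top.not_eq_extremum)

lemma fspace_bergman_lincomb:
  assumes "f \<in> fspace BN" "g \<in> fspace BN"
  shows "(\<lambda>z. b * f z + c * g z) \<in> fspace BN"
proof -
  have "ennreal (2 powr p * cmod b powr p) * BI f + ennreal (2 powr p * cmod c powr p) * BI g < \<infinity>"
    using assms by (auto simp: fspace_bergman_iff ennreal_mult_less_top)
  then show ?thesis
    using assms bergman_integral_lincomb_le[of f g b c]
    by (auto simp: fspace_bergman_iff intro!: hol_disc_lincomb intro: le_less_trans)
qed

text \<open>The p-th root of a product: 4 comes from the radius d/2 of the averaging ball,
  3^|\<alpha>| from the variation of the weight on it, and 1/(\<alpha> + 1) from the normalization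
  of the Bergman norm.\<close>

definition eval_const :: real where
  "eval_const = (4 * 3 powr \<bar>\<alpha>\<bar> / (\<alpha> + 1)) powr (1 / p)"

lemma eval_const_pos: "eval_const > 0"
  using \<alpha> by (simp add: eval_const_def)

text \<open>Mean value inequality for |f|^p on the ball about w of radius d/2, d = 1 - |w|. The
  weight there is comparable to d^\<alpha> and the area to d^2, so |f(w)|^p d^(2+\<alpha>) is
  controlled by the norm, and 2 + \<alpha> = s p.\<close>

lemma bergman_point_evaluation:
  assumes f: "f \<in> hol_disc" and B: "0 \<le> B" and n: "BN f \<le> ennreal B" and w: "w \<in> unit_disc"
  shows "cmod (f w) \<le> eval_const * B * (1 - cmod w) powr (-s)"
proof -
  define d where "d = 1 - cmod w"
  have d: "d > 0" using w by (simp add: d_def)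
  define \<rho> where "\<rho> = d / 2"
  define W where "W = (\<lambda>z. ennreal (cmod (f z) powr p * (1 - (cmod z)\<^sup>2) powr \<alpha>))"
  have [measurable]: "unit_disc \<in> sets borel" by simp
  have Wm: "(\<lambda>z. W z * indicator unit_disc z) \<in> borel_measurable lborel"
    using hol_disc_borel_measurable[OF f] unfolding W_def by measurable
  have dist: "d / 2 < 1 - cmod z" "1 - cmod z < 3 * d / 2" if "z \<in> ball w \<rho>" for z
    using that norm_triangle_ineq2[of z w] norm_triangle_ineq2[of w z]
    by (auto simp: d_def \<rho>_def dist_norm norm_minus_commute)
  have sub: "ball w \<rho> \<subseteq> unit_disc"
    using dist d by fastforce
  \<comment> \<open>On the ball 1 - |z|^2 lies between d/3 and 3 d; the sign of \<alpha> decides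
    which of the two bounds is used.\<close>
  have weight: "3 powr (-\<bar>\<alpha>\<bar>) * d powr \<alpha> \<le> (1 - (cmod z)\<^sup>2) powr \<alpha>" if z: "z \<in> ball w \<rho>" for z
  proof -
    have e: "1 - (cmod z)\<^sup>2 = (1 - cmod z) * (1 + cmod z)"
      by (simp add: power2_eq_square algebra_simps)
    have z1: "cmod z < 1" using sub z by auto
    have lo: "d / 3 \<le> 1 - (cmod z)\<^sup>2"
    proof -
      have "d / 3 \<le> (1 - cmod z) * 1" using dist[OF z] d by simp
      also have "\<dots> \<le> 1 - (cmod z)\<^sup>2" unfolding e using z1 by (intro mult_left_mono) auto
      finally show ?thesis .
    qed
    have hi: "1 - (cmod z)\<^sup>2 \<le> 3 * d"
    proof -
      have "1 - (cmod z)\<^sup>2 \<le> (1 - cmod z) * 2" unfolding e using z1 by (intro mult_left_mono) auto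
      then show ?thesis using dist[OF z] by simp
    qed
    show ?thesis
    proof (cases "\<alpha> \<ge> 0")
      case True
      have "(d / 3) powr \<alpha> \<le> (1 - (cmod z)\<^sup>2) powr \<alpha>" using lo d True by (intro powr_mono2) auto
      then show ?thesis using True d by (simp add: powr_divide powr_minus field_simps)
    next
      case False
      have "(3 * d) powr \<alpha> \<le> (1 - (cmod z)\<^sup>2) powr \<alpha>" using hi lo d False by (intro powr_mono2') auto
      then show ?thesis using False d by (simp add: powr_mult)
    qed
  qed
  have pt: "ennreal (cmod (f z) powr p) * indicator (ball w \<rho>) z
     \<le> ennreal (3 powr \<bar>\<alpha>\<bar> * d powr (-\<alpha>)) * (W z * indicator unit_disc z)" for z
  proof (cases "z \<in> ball w \<rho>")
    case True
    have "cmod (f z) powr p = 3 powr \<bar>\<alpha>\<bar> * d powr (-\<alpha>) * (cmod (f z) powr p * (3 powr (-\<bar>\<alpha>\<bar>) * d powr \<alpha>))"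
      using d by (simp add: powr_minus field_simps)
    also have "\<dots> \<le> 3 powr \<bar>\<alpha>\<bar> * d powr (-\<alpha>) * (cmod (f z) powr p * (1 - (cmod z)\<^sup>2) powr \<alpha>)"
      by (intro mult_left_mono weight True) auto
    finally have "ennreal (cmod (f z) powr p) \<le> ennreal (3 powr \<bar>\<alpha>\<bar> * d powr (-\<alpha>)) * W z"
      unfolding W_def by (simp add: ennreal_leI ennreal_mult[symmetric])
    then show ?thesis using True sub by (auto simp: subset_iff)
  qed simp
  have "ennreal ((\<alpha> + 1) / pi) * (ennreal (cmod (f w) powr p) * emeasure lborel (ball w \<rho>))
     \<le> ennreal ((\<alpha> + 1) / pi) * (\<integral>\<^sup>+z\<in>ball w \<rho>. ennreal (cmod (f z) powr p) \<partial>lborel)"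
    using sub hol_discD(1)[OF f] p
    by (intro mult_left_mono holomorphic_area_submean_powr) (auto intro: holomorphic_on_subset)
  also have "\<dots> \<le> ennreal ((\<alpha> + 1) / pi) *
      (\<integral>\<^sup>+z. ennreal (3 powr \<bar>\<alpha>\<bar> * d powr (-\<alpha>)) * (W z * indicator unit_disc z) \<partial>lborel)"
    by (intro mult_left_mono nn_integral_mono pt) simp
  also have "\<dots> = ennreal (3 powr \<bar>\<alpha>\<bar> * d powr (-\<alpha>)) * BI f"
    unfolding bergman_integral_eq[OF f] nn_integral_cmult[OF Wm]
    by (simp only: W_def mult.left_commute)
  also have "\<dots> \<le> ennreal (3 powr \<bar>\<alpha>\<bar> * d powr (-\<alpha>)) * ennreal (B powr p)"
    using n bergman_norm_le_iff[OF B] by (intro mult_left_mono) auto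
  also have "\<dots> = ennreal (3 powr \<bar>\<alpha>\<bar> * d powr (-\<alpha>) * B powr p)"
    by (simp add: ennreal_mult)
  finally have 1: "ennreal ((\<alpha> + 1) / pi) * (ennreal (cmod (f w) powr p) * emeasure lborel (ball w \<rho>))
     \<le> ennreal (3 powr \<bar>\<alpha>\<bar> * d powr (-\<alpha>) * B powr p)" .
  have "emeasure lborel (ball w \<rho>) = ennreal (pi * \<rho>\<^sup>2)"
    using d by (subst emeasure_ball) (auto simp: unit_ball_vol_2 \<rho>_def)
  with 1 have "ennreal ((\<alpha> + 1) / pi * (cmod (f w) powr p * (pi * \<rho>\<^sup>2)))
     \<le> ennreal (3 powr \<bar>\<alpha>\<bar> * d powr (-\<alpha>) * B powr p)"
    using \<alpha> by (simp add: ennreal_mult[symmetric])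
  then have "(\<alpha> + 1) / pi * (cmod (f w) powr p * (pi * \<rho>\<^sup>2)) \<le> 3 powr \<bar>\<alpha>\<bar> * d powr (-\<alpha>) * B powr p"
    by (subst (asm) ennreal_le_iff) auto
  then have "cmod (f w) powr p * ((\<alpha> + 1) * d\<^sup>2) \<le> 4 * 3 powr \<bar>\<alpha>\<bar> * d powr (-\<alpha>) * B powr p"
  proof -
    let ?x = "cmod (f w) powr p"
    have "?x * ((\<alpha> + 1) * d\<^sup>2) = 4 * ((\<alpha> + 1) / pi * (?x * (pi * \<rho>\<^sup>2)))"
      by (simp add: \<rho>_def power_divide)
    also have "\<dots> \<le> 4 * (3 powr \<bar>\<alpha>\<bar> * d powr (-\<alpha>) * B powr p)"
      by (intro mult_left_mono \<open>(\<alpha> + 1) / pi * _ \<le> _\<close>) simp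
    finally show ?thesis by (simp only: mult.assoc)
  qed
  then have "cmod (f w) powr p \<le> 4 * 3 powr \<bar>\<alpha>\<bar> * d powr (-\<alpha>) * B powr p / ((\<alpha> + 1) * d\<^sup>2)"
    using d \<alpha> by (subst pos_le_divide_eq) auto
  also have "\<dots> = (eval_const * B * d powr (-s)) powr p"
  proof -
    have "(eval_const * B * d powr (-s)) powr p = (4 * 3 powr \<bar>\<alpha>\<bar> / (\<alpha> + 1)) * B powr p * d powr (-(2 + \<alpha>))"
      using p B d \<alpha> by (simp add: eval_const_def powr_mult powr_powr s_p)
    also have "d powr (-(2 + \<alpha>)) = d powr (-\<alpha>) / d\<^sup>2"
      using d powr_diff[of d "-\<alpha>" 2] by (simp add: powr_numeral algebra_simps)
    finally show ?thesis by simp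
  qed
  finally have "(cmod (f w) powr p) powr (1 / p) \<le> ((eval_const * B * d powr (-s)) powr p) powr (1 / p)"
    by (rule powr_mono2[rotated 2]) (use p in auto)
  moreover have "(x powr p) powr (1 / p) = x" if "x \<ge> 0" for x :: real
    using that p by (simp add: powr_powr)
  ultimately show ?thesis
    using B eval_const_pos by (simp only: norm_ge_zero mult_nonneg_nonneg less_imp_le powr_ge_zero d_def)
qed

end

subsection \<open>Test functions\<close>

lemma norm_one_minus_cnj_mult_ge:
  assumes "cmod z \<le> 1"
  shows "1 - cmod a \<le> cmod (1 - cnj a * z)"
proof -
  have "cmod (cnj a * z) \<le> cmod a"
    using assms by (simp add: norm_mult mult_left_le)
  then show ?thesis using norm_triangle_ineq2[of 1 "cnj a * z"] by simp
qed

lemma norm_one_minus_cnj_mult_pos: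
  assumes "cmod z \<le> 1" "cmod a < 1"
  shows "0 < cmod (1 - cnj a * z)"
  using norm_one_minus_cnj_mult_ge[OF assms(1), of a] assms(2) by linarith

context bergman
begin

text \<open>
  The factor \<open>(z - a) / (1 - cnj a z)\<close> has modulus at most 1 and a simple zero at \<open>a\<close>, so that
  \<open>b\<close> and \<open>c\<close> prescribe the value and the derivative at \<open>a\<close> at no cost in the norm.
\<close>
definition kern :: "complex \<Rightarrow> complex \<Rightarrow> complex \<Rightarrow> complex \<Rightarrow> complex" where
  "kern a b c z = of_real ((1 - (cmod a)\<^sup>2) powr (real N - s)) * inverse (1 - cnj a * z) ^ N
     * (b + c * ((z - a) * inverse (1 - cnj a * z)))"

definition test_fun :: "complex \<Rightarrow> complex \<Rightarrow> complex \<Rightarrow> complex \<Rightarrow> complex" where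
  "test_fun a b c z = (if z \<in> unit_disc then kern a b c z else 0)"

lemma kern_holomorphic: "kern a b c holomorphic_on {z. 1 - cnj a * z \<noteq> 0}"
  unfolding kern_def[abs_def] by (intro holomorphic_intros) auto

lemma cball_subset_kern_domain:
  assumes "cmod a < 1"
  shows "cball 0 1 \<subseteq> {z. 1 - cnj a * z \<noteq> 0}"
proof
  fix z :: complex assume "z \<in> cball 0 1"
  then have "0 < cmod (1 - cnj a * z)"
    using assms by (intro norm_one_minus_cnj_mult_pos) auto
  then show "z \<in> {z. 1 - cnj a * z \<noteq> 0}" by simp
qed

lemma open_kern_domain: "open {z. 1 - cnj a * z \<noteq> 0}"
  by (intro open_Collect_neq continuous_intros)

lemma test_fun_in_hol_disc:
  assumes "cmod a < 1"
  shows "test_fun a b c \<in> hol_disc"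
proof -
  have "kern a b c holomorphic_on unit_disc"
    using holomorphic_on_subset[OF kern_holomorphic] cball_subset_kern_domain[OF assms]
    by (meson ball_subset_cball subset_trans)
  then have "test_fun a b c holomorphic_on unit_disc"
    by (rule holomorphic_transform) (simp add: test_fun_def)
  then show ?thesis by (simp add: hol_disc_def test_fun_def)
qed

lemma deriv_test_fun:
  assumes "z \<in> unit_disc"
  shows "deriv (test_fun a b c) z = deriv (kern a b c) z"
proof (rule deriv_cong_ev[OF _ refl])
  show "\<forall>\<^sub>F w in nhds z. test_fun a b c w = kern a b c w"
    using assms by (intro eventually_nhds_in_open[THEN eventually_mono, of unit_disc]) (auto simp: test_fun_def)
qed

text \<open>The kernel is holomorphic on a neighbourhood of the closed disc, so it and its
  derivative are bounded there. The bound depends on a, and serves for one fixed test function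
  evaluated at points that run to the boundary.\<close>

lemma test_fun_bounded:
  assumes "cmod a < 1"
  obtains M where "\<And>z. z \<in> unit_disc \<Longrightarrow> cmod (test_fun a b c z) \<le> M"
    "\<And>z. z \<in> unit_disc \<Longrightarrow> cmod (deriv (test_fun a b c) z) \<le> M"
proof -
  let ?k = "kern a b c"
  have "continuous_on (cball 0 1) ?k" "continuous_on (cball 0 1) (deriv ?k)"
    using holomorphic_on_subset[OF kern_holomorphic cball_subset_kern_domain[OF assms]]
      holomorphic_on_subset[OF holomorphic_deriv[OF kern_holomorphic open_kern_domain]
        cball_subset_kern_domain[OF assms]]
    by (auto intro: holomorphic_on_imp_continuous_on)
  then have "bounded (?k ` cball 0 1)" "bounded (deriv ?k ` cball 0 1)"
    by (auto intro!: compact_imp_bounded compact_continuous_image)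
  then obtain A B where "\<And>z. z \<in> cball 0 1 \<Longrightarrow> cmod (?k z) \<le> A"
    "\<And>z. z \<in> cball 0 1 \<Longrightarrow> cmod (deriv ?k z) \<le> B"
    unfolding bounded_iff by blast
  then show ?thesis
    by (intro that[of "max A B"]) (auto simp: deriv_test_fun test_fun_def le_max_iff_disj)
qed

lemma one_minus_cmod_sq: "1 - cnj a * a = of_real (1 - (cmod a)\<^sup>2)"
  unfolding of_real_diff complex_norm_square by (simp add: mult.commute)

lemma test_fun_at:
  assumes "cmod a < 1"
  shows "test_fun a b c a = of_real ((1 - (cmod a)\<^sup>2) powr (-s)) * b"
proof -
  define t where "t = 1 - (cmod a)\<^sup>2"
  have t: "t > 0" using assms by (simp add: t_def power_less_one_iff)
  have "t powr (real N - s) * inverse t ^ N = t powr (-s)"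
    using t by (simp add: powr_diff powr_minus powr_realpow power_inverse divide_inverse)
  then have "of_real (t powr (real N - s)) * inverse (of_real t) ^ N = (of_real (t powr (-s)) :: complex)"
    by (metis of_real_inverse of_real_mult of_real_power)
  then show ?thesis
    using assms by (simp add: test_fun_def kern_def one_minus_cmod_sq t_def[symmetric] del: of_real_diff)
qed

lemma deriv_test_fun_at:
  assumes "cmod a < 1"
  shows "deriv (test_fun a b c) a = of_real ((1 - (cmod a)\<^sup>2) powr (-(s + 1))) * (b * of_nat N * cnj a + c)"
proof -
  define t where "t = 1 - (cmod a)\<^sup>2"
  define T :: complex where "T = of_real (t powr (real N - s))"
  have t: "t > 0" using assms by (simp add: t_def power_less_one_iff)
  have ne: "1 - cnj a * a \<noteq> 0" unfolding one_minus_cmod_sq t_def[symmetric] using t by simp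
  define v where "v = inverse (1 - cnj a * a)"
  have v: "v = of_real (inverse t)" unfolding v_def one_minus_cmod_sq t_def[symmetric] by simp
  let ?W = "\<lambda>z. inverse (1 - cnj a * z)"
  have "((\<lambda>z. 1 - cnj a * z) has_field_derivative - cnj a) (at a)"
    by (auto intro!: derivative_eq_intros)
  from DERIV_inverse_fun[OF this ne] have w: "(?W has_field_derivative cnj a * v\<^sup>2) (at a)"
    by (simp add: v_def power2_eq_square)
  have "((\<lambda>z. z - a) has_field_derivative 1) (at a)"
    by (auto intro!: derivative_eq_intros)
  from DERIV_mult[OF this w] have "((\<lambda>z. (z - a) * ?W z) has_field_derivative v) (at a)"
    by (simp add: v_def)
  from DERIV_add[OF DERIV_const[of b] DERIV_cmult[OF this, of c]]
  have 2: "((\<lambda>z. b + c * ((z - a) * ?W z)) has_field_derivative c * v) (at a)"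
    by simp
  have 1: "((\<lambda>z. T * ?W z ^ N) has_field_derivative T * (of_nat N * (v ^ (N - 1) * (cnj a * v\<^sup>2)))) (at a)"
    using DERIV_cmult[OF DERIV_power[OF w, of N], of T] by (simp add: v_def mult_ac)
  have "((\<lambda>z. T * ?W z ^ N * (b + c * ((z - a) * ?W z)))
     has_field_derivative (T * (of_nat N * (v ^ (N - 1) * (cnj a * v\<^sup>2))) * b + T * v ^ N * (c * v))) (at a)"
    using DERIV_mult[OF 1 2] by (simp add: v_def mult_ac)
  then have "deriv (kern a b c) a = T * (of_nat N * (v ^ (N - 1) * (cnj a * v\<^sup>2))) * b + T * v ^ N * (c * v)"
    unfolding kern_def[abs_def] T_def t_def by (rule DERIV_imp_deriv)
  also have "v ^ (N - 1) * (cnj a * v\<^sup>2) = v ^ Suc N * cnj a"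
    using N_pos by (cases N) (auto simp: power2_eq_square)
  also have "T * (of_nat N * (v ^ Suc N * cnj a)) * b + T * v ^ N * (c * v) = T * v ^ Suc N * (b * of_nat N * cnj a + c)"
    by (simp add: algebra_simps)
  also have "T * v ^ Suc N = of_real (t powr (real N - s) * inverse t ^ Suc N)"
    unfolding T_def v by simp
  also have "t powr (real N - s) * inverse t ^ Suc N = t powr (-(s + 1))"
    using t by (simp add: powr_diff powr_minus powr_add powr_realpow power_inverse divide_inverse)
  finally show ?thesis using deriv_test_fun[of a a b c] assms by (simp add: t_def)
qed

definition test_const :: real where
  "test_const = 2 * real N * ((\<alpha> + 1) / pi * kernel_const \<alpha> (real N * p)) powr (1 / p)"

lemma Np_gt: "2 + \<alpha> < real N * p"
  using mult_strict_right_mono[OF N_gt, of p] p s_p by simp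

lemma kernel_const_pos: "0 < kernel_const \<alpha> (real N * p)"
  using Np_gt \<alpha> unfolding kernel_const_def by (intro mult_pos_pos add_pos_pos) auto

lemma test_const_pos: "0 < test_const"
  using kernel_const_pos \<alpha> N_pos unfolding test_const_def by (intro mult_pos_pos) auto

text \<open>The bound is uniform in a: after raising to the power p, the normalizing factor
  contributes t^((N-s)p) with t = 1 - |a|^2, which cancels the Forelli-Rudin factor
  t^(2+\<alpha>-Np) exactly because s p = 2 + \<alpha>. The factor 2 N in \<open>test_const\<close>
  bounds |b| + |c|.\<close>

lemma bergman_norm_test_fun:
  assumes a: "cmod a < 1" and b: "cmod b \<le> real N" and c: "cmod c \<le> real N"
  shows "BN (test_fun a b c) \<le> ennreal test_const"
proof -
  define t where "t = 1 - (cmod a)\<^sup>2"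
  have t: "t > 0" using a by (simp add: t_def power_less_one_iff)
  let ?K = "2 * real N * t powr (real N - s)"
  have pt: "cmod (test_fun a b c z) powr p * (1 - (cmod z)\<^sup>2) powr \<alpha>
     \<le> ?K powr p * ((1 - (cmod z)\<^sup>2) powr \<alpha> * cmod (1 - cnj a * z) powr (-(real N * p)))" if z: "z \<in> unit_disc" for z
  proof -
    define q where "q = cmod (1 - cnj a * z)"
    have q: "q > 0" unfolding q_def using a z by (intro norm_one_minus_cnj_mult_pos) auto
    have "cmod ((z - a) * inverse (1 - cnj a * z)) \<le> 1"
      using cmod_diff_le_moebius[of a z] a z q by (simp add: norm_divide q_def divide_inverse[symmetric] divide_le_eq_1)
    then have "cmod (c * ((z - a) * inverse (1 - cnj a * z))) \<le> real N * 1"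
      unfolding norm_mult[of c] using c by (intro mult_mono) auto
    then have "cmod (b + c * ((z - a) * inverse (1 - cnj a * z))) \<le> 2 * real N"
      using b norm_triangle_ineq[of b "c * ((z - a) * inverse (1 - cnj a * z))"] by linarith
    then have "cmod (test_fun a b c z) \<le> t powr (real N - s) * inverse q ^ N * (2 * real N)"
      using z t q unfolding test_fun_def kern_def t_def[symmetric]
      by (auto simp: norm_mult norm_power norm_inverse q_def[symmetric] intro!: mult_left_mono)
    also have "\<dots> = ?K * q powr (- real N)"
      using q by (simp add: powr_minus powr_realpow power_inverse)
    finally have "cmod (test_fun a b c z) powr p \<le> (?K * q powr (- real N)) powr p"
      using p by (intro powr_mono2) auto
    also have "\<dots> = ?K powr p * q powr (-(real N * p))"
      by (simp add: powr_mult powr_powr)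
    finally have "cmod (test_fun a b c z) powr p * (1 - (cmod z)\<^sup>2) powr \<alpha>
       \<le> ?K powr p * q powr (-(real N * p)) * (1 - (cmod z)\<^sup>2) powr \<alpha>"
      by (intro mult_right_mono) auto
    then show ?thesis by (simp add: q_def mult_ac)
  qed
  have [measurable]: "unit_disc \<in> sets borel" by simp
  have "BI (test_fun a b c) = ennreal ((\<alpha> + 1) / pi) *
     (\<integral>\<^sup>+z\<in>unit_disc. ennreal (cmod (test_fun a b c z) powr p * (1 - (cmod z)\<^sup>2) powr \<alpha>) \<partial>lborel)"
    by (intro bergman_integral_eq test_fun_in_hol_disc a)
  also have "\<dots> \<le> ennreal ((\<alpha> + 1) / pi) *
     (\<integral>\<^sup>+z. ennreal (?K powr p) * (ennreal ((1 - (cmod z)\<^sup>2) powr \<alpha> * cmod (1 - cnj a * z) powr (-(real N * p)))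
       * indicator unit_disc z) \<partial>lborel)"
  proof (intro mult_left_mono nn_integral_mono)
    fix z
    show "ennreal (cmod (test_fun a b c z) powr p * (1 - (cmod z)\<^sup>2) powr \<alpha>) * indicator unit_disc z
      \<le> ennreal (?K powr p) * (ennreal ((1 - (cmod z)\<^sup>2) powr \<alpha> * cmod (1 - cnj a * z) powr (-(real N * p)))
       * indicator unit_disc z)"
      using ennreal_leI[OF pt, of z] by (cases "z \<in> unit_disc") (simp_all add: ennreal_mult)
  qed simp
  also have "\<dots> = ennreal ((\<alpha> + 1) / pi) * (ennreal (?K powr p) *
     (\<integral>\<^sup>+z\<in>unit_disc. ennreal ((1 - (cmod z)\<^sup>2) powr \<alpha> * cmod (1 - cnj a * z) powr (-(real N * p))) \<partial>lborel))"
    by (subst nn_integral_cmult) simp_all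
  also have "\<dots> \<le> ennreal ((\<alpha> + 1) / pi) * (ennreal (?K powr p) *
     ennreal (kernel_const \<alpha> (real N * p) * t powr (2 + \<alpha> - real N * p)))"
    unfolding t_def by (intro mult_left_mono disc_integral_kernel_le \<alpha> Np_gt a) auto
  also have "\<dots> = ennreal ((\<alpha> + 1) / pi * (?K powr p * (kernel_const \<alpha> (real N * p) * t powr (2 + \<alpha> - real N * p))))"
    using \<alpha> kernel_const_pos by (simp add: ennreal_mult[symmetric])
  also have "(\<alpha> + 1) / pi * (?K powr p * (kernel_const \<alpha> (real N * p) * t powr (2 + \<alpha> - real N * p))) = test_const powr p"
  proof -
    have "?K powr p * t powr (2 + \<alpha> - real N * p) = (2 * real N) powr p * (t powr ((real N - s) * p) * t powr (2 + \<alpha> - real N * p))"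
      by (simp add: powr_mult powr_powr)
    also have "t powr ((real N - s) * p) * t powr (2 + \<alpha> - real N * p) = 1"
      using t s_p by (simp add: powr_add[symmetric] algebra_simps)
    finally have 1: "?K powr p * t powr (2 + \<alpha> - real N * p) = (2 * real N) powr p" by simp
    have "test_const powr p = (2 * real N) powr p * ((\<alpha> + 1) / pi * kernel_const \<alpha> (real N * p))"
      using p \<alpha> kernel_const_pos by (simp add: test_const_def powr_mult powr_powr powr_divide)
    then show ?thesis unfolding 1[symmetric] by (simp add: mult_ac)
  qed
  finally show ?thesis
    using test_const_pos by (subst bergman_norm_le_iff) auto
qed

lemma test_fun_in_fspace:
  assumes a: "cmod a < 1" and b: "cmod b \<le> real N" and c: "cmod c \<le> real N"
  shows "test_fun a b c \<in> fspace BN"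
  using bergman_norm_test_fun[OF assms] test_fun_in_hol_disc[OF a]
  by (auto simp: fspace_def intro: le_less_trans)

end

subsection \<open>Weighted composition operators into the Bloch space\<close>

definition bloch_density :: "(complex \<Rightarrow> complex) \<Rightarrow> complex \<Rightarrow> real" where
  "bloch_density f z = (1 - (cmod z)\<^sup>2) * cmod (deriv f z)"

lemma one_minus_cmod_sq_pos: "z \<in> unit_disc \<Longrightarrow> 0 < 1 - (cmod z)\<^sup>2"
  by (simp add: power_less_one_iff)

lemma bloch_density_nonneg: "z \<in> unit_disc \<Longrightarrow> 0 \<le> bloch_density f z"
  using one_minus_cmod_sq_pos[of z] by (simp add: bloch_density_def)

lemma bloch_density_le:
  assumes "bloch_norm f \<le> ennreal c" "0 \<le> c" "z \<in> unit_disc"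
  shows "bloch_density f z \<le> c"
proof -
  have "ennreal (bloch_density f z) \<le> (SUP z\<in>unit_disc. ennreal ((1 - (cmod z)\<^sup>2) * cmod (deriv f z)))"
    unfolding bloch_density_def using assms(3) by (rule SUP_upper)
  also have "\<dots> \<le> bloch_norm f" by (simp add: bloch_norm_def)
  finally have "ennreal (bloch_density f z) \<le> ennreal c" using assms(1) by (rule order_trans)
  then show ?thesis using assms(2) by (simp add: ennreal_le_iff)
qed

lemma bloch_norm_le:
  assumes "cmod (f 0) \<le> c0" "\<And>z. z \<in> unit_disc \<Longrightarrow> bloch_density f z \<le> c" "0 \<le> c"
  shows "bloch_norm f \<le> ennreal (c0 + c)"
proof -
  have "bloch_norm f \<le> ennreal c0 + ennreal c"
    unfolding bloch_norm_def using assms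
    by (intro add_mono SUP_least ennreal_leI) (auto simp: bloch_density_def)
  also have "\<dots> = ennreal (c0 + c)"
    using assms(3) order_trans[OF norm_ge_zero assms(1)] by simp
  finally show ?thesis .
qed

lemma hol_disc_differentiable:
  assumes "f \<in> hol_disc" "z \<in> unit_disc"
  shows "f field_differentiable at z"
  using hol_discD(1)[OF assms(1)] assms(2) by (auto intro: holomorphic_on_imp_differentiable_at)

lemma deriv_lincomb:
  assumes "f \<in> hol_disc" "g \<in> hol_disc" "z \<in> unit_disc"
  shows "deriv (\<lambda>z. b * f z + c * g z) z = b * deriv f z + c * deriv g z"
  using assms
  by (intro DERIV_imp_deriv DERIV_add DERIV_cmult field_differentiable_derivI hol_disc_differentiable)

lemma deriv_diff_hol_disc:
  assumes "f \<in> hol_disc" "g \<in> hol_disc" "z \<in> unit_disc"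
  shows "deriv (\<lambda>z. f z - g z) z = deriv f z - deriv g z"
  using assms by (intro deriv_diff hol_disc_differentiable)

lemma wcomp_hol_disc:
  assumes u: "u holomorphic_on unit_disc" and \<psi>: "\<psi> holomorphic_on unit_disc"
    and map: "\<psi> ` unit_disc \<subseteq> unit_disc" and f: "f holomorphic_on unit_disc"
  shows "wcomp u \<psi> f \<in> hol_disc"
proof -
  have "(\<lambda>z. u z * f (\<psi> z)) holomorphic_on unit_disc"
    by (intro holomorphic_on_mult u holomorphic_on_compose_gen[unfolded o_def, OF \<psi> f]) (use map in auto)
  then have "wcomp u \<psi> f holomorphic_on unit_disc"
    by (rule holomorphic_transform) (simp add: wcomp_def)
  then show ?thesis by (simp add: hol_disc_def wcomp_def)
qed

lemma deriv_wcomp: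
  assumes u: "u holomorphic_on unit_disc" and \<psi>: "\<psi> holomorphic_on unit_disc"
    and map: "\<psi> ` unit_disc \<subseteq> unit_disc" and f: "f holomorphic_on unit_disc" and z: "z \<in> unit_disc"
  shows "deriv (wcomp u \<psi> f) z = deriv u z * f (\<psi> z) + u z * (deriv f (\<psi> z) * deriv \<psi> z)"
proof -
  have d: "(h has_field_derivative deriv h w) (at w)" if "h holomorphic_on unit_disc" "w \<in> unit_disc" for h w
    using that by (auto intro: holomorphic_derivI)
  have "((\<lambda>z. f (\<psi> z)) has_field_derivative deriv f (\<psi> z) * deriv \<psi> z) (at z)"
    using map z by (intro DERIV_chain2[OF d[OF f] d[OF \<psi>]]) blast+
  from DERIV_mult[OF d[OF u z] this]
  have "deriv (\<lambda>z. u z * f (\<psi> z)) z = deriv u z * f (\<psi> z) + deriv f (\<psi> z) * deriv \<psi> z * u z"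
    by (rule DERIV_imp_deriv)
  moreover have "deriv (wcomp u \<psi> f) z = deriv (\<lambda>z. u z * f (\<psi> z)) z"
  proof (rule deriv_cong_ev[OF _ refl])
    show "\<forall>\<^sub>F w in nhds z. wcomp u \<psi> f w = u w * f (\<psi> w)"
      using z by (intro eventually_nhds_in_open[THEN eventually_mono, of unit_disc]) (auto simp: wcomp_def)
  qed
  ultimately show ?thesis by (simp add: mult_ac)
qed

text \<open>The disc is convex, so h has a primitive F there and the segment integral is F w - F 0.
  Differentiation is local, so the extension by 0 does not interfere.\<close>

lemma deriv_contour_primitive:
  assumes h: "h holomorphic_on unit_disc" and z: "z \<in> unit_disc"
  shows "deriv (\<lambda>z. if z \<in> unit_disc then contour_integral (linepath 0 z) h else 0) z = h z"
proof -
  obtain F where F: "\<And>x. x \<in> unit_disc \<Longrightarrow> (F has_field_derivative h x) (at x within unit_disc)"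
    using holomorphic_convex_primitive'[OF convex_ball open_ball h] by blast
  have eq: "contour_integral (linepath 0 w) h = F w - F 0" if "w \<in> unit_disc" for w
  proof -
    have "path_image (linepath 0 w) \<subseteq> unit_disc"
      using that by (simp add: closed_segment_subset)
    then have "(h has_contour_integral F w - F 0) (linepath 0 w)"
      using contour_integral_primitive[OF F valid_path_linepath] by simp
    then show ?thesis by (rule contour_integral_unique)
  qed
  have "deriv (\<lambda>z. if z \<in> unit_disc then contour_integral (linepath 0 z) h else 0) z = deriv (\<lambda>w. F w - F 0) z"
  proof (rule deriv_cong_ev[OF _ refl])
    show "\<forall>\<^sub>F w in nhds z. (if w \<in> unit_disc then contour_integral (linepath 0 w) h else 0) = F w - F 0"
      using z eq by (intro eventually_nhds_in_open[THEN eventually_mono, of unit_disc]) auto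
  qed
  also have "\<dots> = h z"
  proof -
    have "(F has_field_derivative h z) (at z)"
      using F[OF z] at_within_open[OF z open_ball] by simp
    from DERIV_diff[OF this DERIV_const[of "F 0"]] show ?thesis
      by (intro DERIV_imp_deriv) simp
  qed
  finally show ?thesis .
qed

section \<open>The bounded operator and the Bloch densities of its images\<close>

locale bounded_wcomp = bergman +
  fixes u \<phi> :: "complex \<Rightarrow> complex"
  assumes u: "u holomorphic_on unit_disc" and \<phi>: "\<phi> holomorphic_on unit_disc"
    and \<phi>_disc: "\<phi> ` unit_disc \<subseteq> unit_disc"
    and bounded: "bounded_op (bergman_norm p \<alpha>) bloch_norm (wcomp u \<phi>)"
begin

abbreviation "T \<equiv> wcomp u \<phi>"

definition Au :: "complex \<Rightarrow> real" where
  "Au z = (1 - (cmod z)\<^sup>2) * cmod (deriv u z)"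
definition Bu :: "complex \<Rightarrow> real" where
  "Bu z = (1 - (cmod z)\<^sup>2) * (cmod (u z) * cmod (deriv \<phi> z))"

lemma norm_\<phi>: "z \<in> unit_disc \<Longrightarrow> cmod (\<phi> z) < 1"
  using \<phi>_disc[THEN subsetD, OF imageI] by simp

lemma Au_nonneg: "z \<in> unit_disc \<Longrightarrow> 0 \<le> Au z"
  using one_minus_cmod_sq_pos[of z] by (simp add: Au_def)
lemma Bu_nonneg: "z \<in> unit_disc \<Longrightarrow> 0 \<le> Bu z"
  using one_minus_cmod_sq_pos[of z] by (simp add: Bu_def)

lemma bloch_density_J:
  assumes z: "z \<in> unit_disc"
  shows "bloch_density (J_op u (\<lambda>z. \<phi> z ^ j)) z = cmod (\<phi> z) ^ j * Au z"
proof -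
  have "(\<lambda>z. \<phi> z ^ j * deriv u z) holomorphic_on unit_disc"
    by (intro holomorphic_intros \<phi> u) auto
  from deriv_contour_primitive[OF this z] show ?thesis
    by (simp add: bloch_density_def J_op_def Au_def norm_mult norm_power)
qed

lemma bloch_density_I:
  assumes z: "z \<in> unit_disc"
  shows "bloch_density (I_op u (\<lambda>z. \<phi> z ^ j)) z = real j * cmod (\<phi> z) ^ (j - 1) * Bu z"
proof -
  have "(\<lambda>z. \<phi> z ^ j) holomorphic_on unit_disc"
    by (intro holomorphic_intros \<phi>)
  then have "(\<lambda>z. deriv (\<lambda>z. \<phi> z ^ j) z * u z) holomorphic_on unit_disc"
    by (intro holomorphic_on_mult u holomorphic_deriv) auto
  from deriv_contour_primitive[OF this z]
  have "deriv (I_op u (\<lambda>z. \<phi> z ^ j)) z = deriv (\<lambda>z. \<phi> z ^ j) z * u z"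
    by (simp add: I_op_def)
  \<comment> \<open>For j = 0 both sides are 0, whatever the truncated exponent j - 1.\<close>
  also have "deriv (\<lambda>z. \<phi> z ^ j) z = of_nat j * (deriv \<phi> z * \<phi> z ^ (j - 1))"
    using DERIV_power[OF holomorphic_derivI[OF \<phi> _ z], of j] by (intro DERIV_imp_deriv) auto
  finally show ?thesis
    by (simp add: bloch_density_def Bu_def norm_mult norm_power)
qed

lemma I_op_0: "I_op u g 0 = 0" and J_op_0: "J_op u g 0 = 0"
  by (simp_all add: I_op_def J_op_def)

lemma bloch_density_wcomp_le:
  assumes f: "f holomorphic_on unit_disc" and z: "z \<in> unit_disc"
  shows "bloch_density (T f) z \<le> Au z * cmod (f (\<phi> z)) + Bu z * cmod (deriv f (\<phi> z))"
proof -
  have "bloch_density (T f) z \<le> (1 - (cmod z)\<^sup>2) * (cmod (deriv u z * f (\<phi> z)) + cmod (u z * (deriv f (\<phi> z) * deriv \<phi> z)))"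
    unfolding bloch_density_def deriv_wcomp[OF u \<phi> \<phi>_disc f z]
    using one_minus_cmod_sq_pos[OF z] by (intro mult_left_mono norm_triangle_ineq) auto
  then show ?thesis by (simp add: Au_def Bu_def norm_mult algebra_simps)
qed

text \<open>In \<open>deriv_test_fun_at\<close> the choice c = - N cnj a cancels the term coming
  from b = 1, so \<open>test_A a\<close> has derivative 0 at a. With b = 0 and c = 1,
  \<open>test_B a\<close> has value 0 at a and derivative (1 - |a|^2)^(-(s+1)).\<close>

definition test_A :: "complex \<Rightarrow> complex \<Rightarrow> complex" where
  "test_A a = test_fun a 1 (- of_nat N * cnj a)"
definition test_B :: "complex \<Rightarrow> complex \<Rightarrow> complex" where
  "test_B a = test_fun a 0 1"

lemma test_AB_fspace:
  assumes a: "cmod a < 1"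
  shows "test_A a \<in> fspace BN" "test_B a \<in> fspace BN"
    "BN (test_A a) \<le> ennreal test_const" "BN (test_B a) \<le> ennreal test_const"
proof -
  have "cmod (- of_nat N * cnj a) \<le> real N" "cmod 1 \<le> real N"
    using a N_pos by (auto simp: norm_mult mult_left_le)
  then show "test_A a \<in> fspace BN" "test_B a \<in> fspace BN"
    "BN (test_A a) \<le> ennreal test_const" "BN (test_B a) \<le> ennreal test_const"
    unfolding test_A_def test_B_def by (auto intro!: test_fun_in_fspace bergman_norm_test_fun a)
qed

lemma bloch_density_test_A:
  assumes z: "z \<in> unit_disc"
  shows "bloch_density (T (test_A (\<phi> z))) z = Au z * (1 - (cmod (\<phi> z))\<^sup>2) powr (-s)"
proof -
  note h = hol_discD(1)[OF test_fun_in_hol_disc[OF norm_\<phi>[OF z]]]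
  show ?thesis
    unfolding bloch_density_def test_A_def deriv_wcomp[OF u \<phi> \<phi>_disc h z]
      test_fun_at[OF norm_\<phi>[OF z]] deriv_test_fun_at[OF norm_\<phi>[OF z]]
    by (simp add: Au_def norm_mult)
qed

lemma bloch_density_test_B:
  assumes z: "z \<in> unit_disc"
  shows "bloch_density (T (test_B (\<phi> z))) z = Bu z * (1 - (cmod (\<phi> z))\<^sup>2) powr (-(s + 1))"
proof -
  note h = hol_discD(1)[OF test_fun_in_hol_disc[OF norm_\<phi>[OF z]]]
  show ?thesis
    unfolding bloch_density_def test_B_def deriv_wcomp[OF u \<phi> \<phi>_disc h z]
      test_fun_at[OF norm_\<phi>[OF z]] deriv_test_fun_at[OF norm_\<phi>[OF z]]
    by (simp add: Bu_def norm_mult)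
qed

text \<open>Boundedness tested on \<open>test_A\<close> and \<open>test_B\<close> at a = \<phi>(z)
  forces \<open>Au\<close> and \<open>Bu\<close> to decay like powers of 1 - |\<phi>(z)|^2. These
  powers are at most 1, which gives the plain bounds.\<close>

lemma density_bounds:
  obtains S where "S \<ge> 0"
    "\<And>z. z \<in> unit_disc \<Longrightarrow> Au z \<le> S * (1 - (cmod (\<phi> z))\<^sup>2) powr s"
    "\<And>z. z \<in> unit_disc \<Longrightarrow> Bu z \<le> S * (1 - (cmod (\<phi> z))\<^sup>2) powr (s + 1)"
    "\<And>z. z \<in> unit_disc \<Longrightarrow> Au z \<le> S" "\<And>z. z \<in> unit_disc \<Longrightarrow> Bu z \<le> S"
proof -
  obtain C :: real where C: "\<And>f. f \<in> fspace BN \<Longrightarrow> bloch_norm (T f) \<le> ennreal C * BN f"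
    using bounded by (auto simp: bounded_op_def)
  define S where "S = max C 0 * test_const"
  have S: "S \<ge> 0" using test_const_pos by (simp add: S_def)
  have le: "bloch_density (T f) z \<le> S" if "f \<in> fspace BN" "BN f \<le> ennreal test_const" "z \<in> unit_disc" for f z
  proof (rule bloch_density_le[OF _ S that(3)])
    have "bloch_norm (T f) \<le> ennreal (max C 0) * ennreal test_const"
      by (rule order_trans[OF C[OF that(1)]]) (intro mult_mono that ennreal_leI, auto)
    then show "bloch_norm (T f) \<le> ennreal S"
      using test_const_pos by (simp add: S_def ennreal_mult)
  qed
  have inv: "x \<le> S * t powr r" if "x * t powr (-r) \<le> S" "t > 0" for x t r :: real
    using that by (simp add: powr_minus field_simps)
  have A: "Au z \<le> S * (1 - (cmod (\<phi> z))\<^sup>2) powr s"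
    and B: "Bu z \<le> S * (1 - (cmod (\<phi> z))\<^sup>2) powr (s + 1)" if z: "z \<in> unit_disc" for z
  proof -
    have t: "0 < 1 - (cmod (\<phi> z))\<^sup>2" using norm_\<phi>[OF z] by (simp add: power_less_one_iff)
    note ts = test_AB_fspace[OF norm_\<phi>[OF z]]
    show "Au z \<le> S * (1 - (cmod (\<phi> z))\<^sup>2) powr s"
      using le[OF ts(1,3) z] t unfolding bloch_density_test_A[OF z] by (rule inv)
    show "Bu z \<le> S * (1 - (cmod (\<phi> z))\<^sup>2) powr (s + 1)"
      using le[OF ts(2,4) z] t unfolding bloch_density_test_B[OF z] by (rule inv)
  qed
  have pw: "S * (1 - (cmod (\<phi> z))\<^sup>2) powr t \<le> S" if "z \<in> unit_disc" "0 \<le> t" for z t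
    using norm_\<phi>[OF that(1)] that(2) S by (intro mult_left_le powr_le1) (auto simp: power_le_one_iff)
  show ?thesis
    using s_pos by (intro that[OF S A B] order_trans[OF A pw] order_trans[OF B pw]) auto
qed

end

subsection \<open>Lower bound\<close>

text \<open>Comes from \<open>x ^ n / n! \<le> exp x\<close> at \<open>x = 1 + (j - 1) y\<close>, where \<open>j y \<le> x\<close>.\<close>
definition growth_const :: "real \<Rightarrow> real" where
  "growth_const t = fact (nat \<lceil>t\<rceil>) * exp 1"

lemma powr_mult_power_le:
  fixes t y :: real
  assumes t: "0 < t" and y: "0 < y" "y \<le> 1" and j: "1 \<le> j"
  shows "real j powr t * (1 - y) ^ (j - 1) \<le> growth_const t * y powr (-t)"
proof -
  define v where "v = real (j - 1) * y"
  define n where "n = nat \<lceil>t\<rceil>"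
  have v: "0 \<le> v" using y by (simp add: v_def)
  have "(1 - y) ^ (j - 1) \<le> exp (- y) ^ (j - 1)"
    using y exp_ge_add_one_self[of "-y"] by (intro power_mono) auto
  also have "\<dots> = exp (- v)" by (simp add: v_def exp_of_nat_mult[symmetric])
  finally have 1: "(1 - y) ^ (j - 1) \<le> exp (- v)" .
  have "real j * y \<le> 1 + v"
    using j y by (simp add: v_def of_nat_diff left_diff_distrib)
  then have "(real j * y) powr t \<le> (1 + v) powr t"
    using y t by (intro powr_mono2) auto
  \<comment> \<open>The base is at least 1, so the exponent may be rounded up to an integer.\<close>
  also have "\<dots> \<le> (1 + v) powr real n"
    using v unfolding n_def by (intro powr_mono real_nat_ceiling_ge) auto
  also have "\<dots> = (1 + v) ^ n" using v by (simp add: powr_realpow)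
  also have "\<dots> \<le> fact n * exp (1 + v)"
  proof -
    have "inverse (fact n) *\<^sub>R (1 + v) ^ n \<le> exp (1 + v)"
      using sum_le_suminf[OF summable_exp_generic[of "1 + v"], of "{n}"] v
      by (simp add: exp_def)
    then show ?thesis by (simp add: field_simps)
  qed
  finally have "(real j * y) powr t * (1 - y) ^ (j - 1) \<le> fact n * exp (1 + v) * exp (- v)"
    using 1 y by (intro mult_mono) auto
  also have "\<dots> = growth_const t"
    by (simp add: growth_const_def n_def mult_exp_exp)
  finally show ?thesis
    using y by (simp add: powr_mult powr_minus field_simps)
qed

lemma growth_const_pos: "0 < growth_const t"
  by (simp add: growth_const_def)

text \<open>Where w is beyond \<delta>, the decay of X pays for the factor j^t uniformly in j.
  Elsewhere w^(j-1) decays geometrically, so the crude bound S contributes at most e for large j.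
  The factor 2^t comes from 1 - w^2 \<le> 2 (1 - w).\<close>

lemma eventually_powr_power_le:
  fixes X w :: "'a \<Rightarrow> real"
  assumes t: "0 < t" and \<delta>: "\<delta> < 1" and w: "\<And>z. z \<in> D \<Longrightarrow> 0 \<le> w z \<and> w z < 1"
    and S: "0 \<le> S" "\<And>z. z \<in> D \<Longrightarrow> X z \<le> S"
    and Y: "0 \<le> Y" "\<And>z. z \<in> D \<Longrightarrow> \<delta> < w z \<Longrightarrow> X z \<le> Y * (1 - (w z)\<^sup>2) powr t"
    and e: "0 < e"
  shows "\<forall>\<^sub>F j in sequentially. \<forall>z\<in>D. real j powr t * (w z ^ (j - 1) * X z) \<le> 2 powr t * growth_const t * Y + e"
proof -
  \<comment> \<open>\<delta> may be negative; the maximum keeps y0 at most 1.\<close>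
  define y0 where "y0 = 1 - max \<delta> 0"
  have y0: "0 < y0" "y0 \<le> 1" using \<delta> by (auto simp: y0_def)
  \<comment> \<open>Applying the growth bound with exponent t + 1 instead of t leaves a spare factor
    1/j.\<close>
  have "(\<lambda>j. growth_const (t + 1) * y0 powr (-(t + 1)) * S / real j) \<longlonglongrightarrow> 0"
    by (intro tendsto_divide_0[OF tendsto_const] filterlim_at_top_imp_at_infinity filterlim_real_sequentially)
  then have "\<forall>\<^sub>F j in sequentially. growth_const (t + 1) * y0 powr (-(t + 1)) * S / real j < e"
    using e by (rule order_tendstoD)
  then show ?thesis
    using eventually_ge_at_top[of 1]
  proof eventually_elim
    case (elim j)
    show ?case
    proof
      fix z assume z: "z \<in> D"
      define y where "y = 1 - w z"
      have y: "0 < y" "y \<le> 1" "w z = 1 - y" using w[OF z] by (auto simp: y_def)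
      show "real j powr t * (w z ^ (j - 1) * X z) \<le> 2 powr t * growth_const t * Y + e"
      proof (cases "\<delta> < w z")
        case True
        have "1 - (w z)\<^sup>2 = y * (2 - y)"
          unfolding y(3) by (simp add: power2_eq_square algebra_simps)
        also have "\<dots> \<le> 2 * y" using y by (simp add: mult.commute[of y] mult_right_mono)
        finally have "(1 - (w z)\<^sup>2) powr t \<le> (2 * y) powr t"
          using w[OF z] t by (intro powr_mono2) (auto simp: power_le_one_iff)
        then have "Y * (1 - (w z)\<^sup>2) powr t \<le> Y * (2 powr t * y powr t)"
          using y Y(1) by (intro mult_left_mono) (auto simp: powr_mult)
        then have X: "X z \<le> Y * (2 powr t * y powr t)"
          using Y(2)[OF z True] by linarith
        have "real j powr t * (w z ^ (j - 1) * X z) \<le> real j powr t * (w z ^ (j - 1) * (Y * (2 powr t * y powr t)))"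
          using w[OF z] by (intro mult_left_mono X) auto
        also have "\<dots> = (real j powr t * (1 - y) ^ (j - 1)) * (Y * (2 powr t * y powr t))"
          by (simp add: y(3))
        also have "\<dots> \<le> (growth_const t * y powr (-t)) * (Y * (2 powr t * y powr t))"
          using y Y(1) t elim by (intro mult_right_mono powr_mult_power_le) auto
        also have "\<dots> = 2 powr t * growth_const t * Y"
          using y by (simp add: powr_minus field_simps)
        finally show ?thesis using e by simp
      next
        case False
        then have le: "w z \<le> 1 - y0" by (simp add: y0_def)
        have "real j powr t * (w z ^ (j - 1) * X z) \<le> real j powr t * (w z ^ (j - 1) * S)"
          using w[OF z] S(2)[OF z] by (intro mult_left_mono) auto
        also have "\<dots> \<le> real j powr t * ((1 - y0) ^ (j - 1) * S)"
          using w[OF z] le S(1) by (intro mult_left_mono mult_right_mono power_mono) auto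
        also have "\<dots> = (real j powr (t + 1) * (1 - y0) ^ (j - 1)) * S / real j"
          using elim by (simp add: powr_add)
        also have "\<dots> \<le> (growth_const (t + 1) * y0 powr (-(t + 1))) * S / real j"
          using y0 S t elim by (intro divide_right_mono mult_right_mono powr_mult_power_le) auto
        also have "\<dots> \<le> e" using elim by simp
        finally show ?thesis
          using Y(1) growth_const_pos[of t] by (simp add: add_increasing)
      qed
    qed
  qed
qed

lemma linear_op_lincomb:
  assumes "linear_op (bergman_norm p \<alpha>) M K" "bergman p \<alpha>"
    and f: "f \<in> fspace (bergman_norm p \<alpha>)" and g: "g \<in> fspace (bergman_norm p \<alpha>)"
  shows "K (\<lambda>z. b * f z + c * g z) = (\<lambda>z. b * K f z + c * K g z)"
proof -
  interpret bergman p \<alpha> by fact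
  have bf: "(\<lambda>z. b * f z) \<in> fspace BN" and cg: "(\<lambda>z. c * g z) \<in> fspace BN"
    using fspace_bergman_lincomb[OF f f, of b 0] fspace_bergman_lincomb[OF g g, of c 0] by simp_all
  have add: "K (\<lambda>z. f z + g z) = (\<lambda>z. K f z + K g z)" if "f \<in> fspace BN" "g \<in> fspace BN" for f g
    using assms(1) that by (simp add: linear_op_def)
  have "K (\<lambda>z. b * f z + c * g z) = (\<lambda>z. K (\<lambda>z. b * f z) z + K (\<lambda>z. c * g z) z)"
    by (rule add[OF bf cg])
  moreover have "K (\<lambda>z. b * f z) = (\<lambda>z. b * K f z)" "K (\<lambda>z. c * g z) = (\<lambda>z. c * K g z)"
    using assms(1) f g by (simp_all add: linear_op_def)
  ultimately show ?thesis by simp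
qed

section \<open>Compact perturbations tested on peaking functions\<close>

context bergman
begin

text \<open>The scaling by 4 M absorbs the loss in \<open>bergman_integral_lincomb_le\<close>: two
  terms of size 2^p 4^(-p) add up to 2 (1/2)^p, which is at most 1 because p \<ge> 1.\<close>

lemma bergman_norm_scaled_diff:
  assumes f: "f \<in> hol_disc" and g: "g \<in> hol_disc" and M: "0 < M"
    and "BN f \<le> ennreal M" "BN g \<le> ennreal M"
  shows "BN (\<lambda>z. of_real (1 / (4 * M)) * f z + (- of_real (1 / (4 * M))) * g z) \<le> 1"
proof -
  let ?c = "2 powr p * (1 / (4 * M)) powr p"
  have fg: "BI f \<le> ennreal (M powr p)" "BI g \<le> ennreal (M powr p)"
    using assms by (auto simp: bergman_norm_le_iff)
  have cm: "cmod (of_real (1 / (4 * M))) = 1 / (4 * M)" "cmod (- of_real (1 / (4 * M))) = 1 / (4 * M)"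
    unfolding norm_minus_cancel norm_of_real using M by simp_all
  have "BI (\<lambda>z. of_real (1 / (4 * M)) * f z + (- of_real (1 / (4 * M))) * g z)
    \<le> ennreal ?c * BI f + ennreal ?c * BI g"
    using bergman_integral_lincomb_le[OF f g, of "of_real (1 / (4 * M))" "- of_real (1 / (4 * M))"]
    unfolding cm .
  also have "\<dots> \<le> ennreal ?c * ennreal (M powr p) + ennreal ?c * ennreal (M powr p)"
    by (intro add_mono mult_left_mono fg) auto
  also have "\<dots> = ennreal (2 * (?c * M powr p))"
  proof -
    have "ennreal x * ennreal y + ennreal x * ennreal y = ennreal (2 * (x * y))" if "0 \<le> x" "0 \<le> y" for x y
    proof -
      have "ennreal x * ennreal y + ennreal x * ennreal y = ennreal (x * y) + ennreal (x * y)"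
        using that by (simp only: ennreal_mult)
      also have "\<dots> = ennreal (x * y + x * y)"
        using that by (intro ennreal_plus[symmetric] mult_nonneg_nonneg)
      finally show ?thesis by (simp only: mult_2)
    qed
    then show ?thesis by simp
  qed
  also have "?c * M powr p = (1 / 2) powr p"
    using M by (simp add: powr_mult[symmetric])
  also have "2 * (1 / 2) powr p \<le> (1::real) powr p"
    using powr_mono'[of 1 p "1 / 2"] p by simp
  finally show ?thesis
    using bergman_norm_le_iff[of 1] by (simp add: ennreal_leI)
qed

end

context bounded_wcomp
begin

lemma T_linear: "linear_op BN bloch_norm T"
  using bounded by (simp add: bounded_op_def)

lemma fspace_bloch_hol: "f \<in> fspace bloch_norm \<Longrightarrow> f \<in> hol_disc"
  by (simp add: fspace_def)

text \<open>
  Comparing \<open>F m\<close> with a fixed \<open>F n\<close> avoids weak convergence of the test functions, which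
  fails for \<open>p = 1\<close>.
\<close>
lemma compact_perturbation_test:
  fixes F :: "nat \<Rightarrow> complex \<Rightarrow> complex" and \<zeta> :: "nat \<Rightarrow> complex"
  assumes K: "compact_op BN bloch_norm K"
    and E: "op_norm BN bloch_norm (\<lambda>f z. T f z - K f z) \<le> ennreal E" "0 \<le> E"
    and F: "\<And>n. F n \<in> fspace BN" "\<And>n. BN (F n) \<le> ennreal M" and M: "0 < M"
    and \<zeta>: "\<And>n. \<zeta> n \<in> unit_disc"
    and lim: "\<And>n. (\<lambda>m. bloch_density (T (F n)) (\<zeta> m)) \<longlonglongrightarrow> 0"
    and \<epsilon>: "0 < \<epsilon>"
  shows "\<exists>m. bloch_density (T (F m)) (\<zeta> m) \<le> 4 * M * E + \<epsilon>"
proof -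
  have lin: "linear_op BN bloch_norm K" using K by (simp add: compact_op_def)
  have "(\<forall>n. F n \<in> fspace BN) \<and> (\<exists>B::real. \<forall>n. BN (F n) \<le> ennreal B)" using F by blast
  then obtain r g where r: "strict_mono r" and g: "g \<in> fspace bloch_norm"
    and "(\<lambda>n. bloch_norm (\<lambda>z. K (F (r n)) z - g z)) \<longlonglongrightarrow> 0"
    using K unfolding compact_op_def by blast
  then have "\<forall>\<^sub>F k in sequentially. bloch_norm (\<lambda>z. K (F (r k)) z - g z) < ennreal (\<epsilon> / 3)"
    using \<epsilon> by (intro order_tendstoD) auto
  then obtain k0 where k0: "\<And>k. k \<ge> k0 \<Longrightarrow> bloch_norm (\<lambda>z. K (F (r k)) z - g z) < ennreal (\<epsilon> / 3)"
    by (auto simp: eventually_sequentially)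
  \<comment> \<open>The index of comparison. For later m = r k both K (F m) and K (F n) lie within
    \<epsilon>/3 of g in the Bloch norm, while F n stays fixed as the points \<zeta> m move, so
    \<open>lim\<close> applies to it.\<close>
  define n where "n = r k0"
  have "(\<lambda>k. bloch_density (T (F n)) (\<zeta> (r k))) \<longlonglongrightarrow> 0"
    using LIMSEQ_subseq_LIMSEQ[OF lim[of n] r] by (simp add: o_def)
  then have "\<forall>\<^sub>F k in sequentially. bloch_density (T (F n)) (\<zeta> (r k)) < \<epsilon> / 3"
    using \<epsilon> by (intro order_tendstoD) auto
  then have "\<forall>\<^sub>F k in sequentially. bloch_density (T (F n)) (\<zeta> (r k)) < \<epsilon> / 3 \<and> k \<ge> k0"
    using eventually_ge_at_top[of k0] by (rule eventually_conj)
  then obtain k where k: "bloch_density (T (F n)) (\<zeta> (r k)) < \<epsilon> / 3" "k \<ge> k0"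
    by (auto dest: eventually_happens)
  define m where "m = r k"
  define z where "z = \<zeta> m"
  have z: "z \<in> unit_disc" using \<zeta> by (simp add: z_def)
  define w where "w = 1 - (cmod z)\<^sup>2"
  have w: "w > 0" using one_minus_cmod_sq_pos[OF z] by (simp add: w_def)
  define b where "b = 1 / (4 * M)"
  have b: "b > 0" using M by (simp add: b_def)
  define h where "h = (\<lambda>z. of_real b * F m z + (- of_real b) * F n z)"
  have h: "h \<in> fspace BN" unfolding h_def by (intro fspace_bergman_lincomb F)
  have hd: "F i \<in> hol_disc" for i using F(1)[of i] by (simp add: fspace_def)
  have hn: "BN h \<le> 1"
    unfolding h_def b_def by (intro bergman_norm_scaled_diff hd M F)
  have Th: "T h = (\<lambda>z. of_real b * T (F m) z + (- of_real b) * T (F n) z)"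
    unfolding h_def by (rule linear_op_lincomb[OF T_linear bergman_axioms F(1) F(1)])
  have Kh: "K h = (\<lambda>z. of_real b * K (F m) z + (- of_real b) * K (F n) z)"
    unfolding h_def by (rule linear_op_lincomb[OF lin bergman_axioms F(1) F(1)])
  have Thol: "T f \<in> hol_disc" and Khol: "K f \<in> hol_disc" if "f \<in> fspace BN" for f
    using T_linear lin that by (auto simp: linear_op_def fspace_def)
  have ghol: "g \<in> hol_disc" using g by (rule fspace_bloch_hol)
  have "bloch_norm (\<lambda>z. T h z - K h z) \<le> op_norm BN bloch_norm (\<lambda>f z. T f z - K f z)"
    unfolding op_norm_def by (rule SUP_upper) (use h hn in auto)
  then have "bloch_norm (\<lambda>z. T h z - K h z) \<le> ennreal E" using E(1) by (rule order_trans)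
  then have 1: "bloch_density (\<lambda>z. T h z - K h z) z \<le> E" by (rule bloch_density_le[OF _ E(2) z])
  have close: "w * cmod (deriv (K (F (r i))) z - deriv g z) \<le> \<epsilon> / 3" if "i \<ge> k0" for i
  proof -
    have "bloch_density (\<lambda>z. K (F (r i)) z - g z) z \<le> \<epsilon> / 3"
      using k0[OF that] \<epsilon> by (intro bloch_density_le z) auto
    then show ?thesis
      unfolding bloch_density_def deriv_diff_hol_disc[OF Khol[OF F(1)] ghol z] w_def .
  qed
  define P where "P = deriv (T (F m)) z"
  define Q where "Q = deriv (T (F n)) z"
  define P' where "P' = deriv (K (F m)) z - deriv g z"
  define Q' where "Q' = deriv (K (F n)) z - deriv g z"
  \<comment> \<open>The limit g cancels between P' and Q'. Undoing the scaling b = 1 / (4 M) turns E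
    into 4 M E, and Q, P', Q' cost \<epsilon>/3 each.\<close>
  have "deriv (\<lambda>z. T h z - K h z) z = of_real b * (P - Q - P' + Q')"
  proof -
    have "deriv (T h) z = of_real b * deriv (T (F m)) z + (- of_real b) * deriv (T (F n)) z"
      unfolding Th by (intro deriv_lincomb Thol F z)
    moreover have "deriv (K h) z = of_real b * deriv (K (F m)) z + (- of_real b) * deriv (K (F n)) z"
      unfolding Kh by (intro deriv_lincomb Khol F z)
    ultimately show ?thesis
      unfolding deriv_diff_hol_disc[OF Thol[OF h] Khol[OF h] z]
      by (simp add: P_def Q_def P'_def Q'_def algebra_simps)
  qed
  with 1 have "w * (b * cmod (P - Q - P' + Q')) \<le> E"
    using b by (simp add: bloch_density_def w_def norm_mult)
  then have "w * cmod (P - Q - P' + Q') \<le> 4 * M * E"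
    using M by (simp add: b_def field_simps)
  moreover have "w * cmod P' \<le> \<epsilon> / 3" "w * cmod Q' \<le> \<epsilon> / 3"
    using close[OF k(2)] close[of k0] by (simp_all add: P'_def Q'_def m_def n_def)
  moreover have "w * cmod Q \<le> \<epsilon> / 3"
    using k(1) by (simp add: Q_def w_def bloch_density_def z_def m_def)
  moreover have "w * cmod P \<le> w * (cmod (P - Q - P' + Q') + cmod Q + cmod P' + cmod Q')"
  proof (intro mult_left_mono)
    define R where "R = P - Q - P' + Q'"
    have "P = R + Q + P' - Q'" by (simp add: R_def)
    then show "cmod P \<le> cmod (P - Q - P' + Q') + cmod Q + cmod P' + cmod Q'"
      unfolding R_def[symmetric]
      using norm_triangle_ineq4[of "R + Q + P'" Q'] norm_triangle_ineq[of "R + Q" P'] norm_triangle_ineq[of R Q]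
      by simp
  qed (use w in auto)
  ultimately have "w * cmod P \<le> 4 * M * E + \<epsilon>" by (simp add: distrib_left)
  then show ?thesis
    by (intro exI[of _ m]) (simp add: bloch_density_def P_def w_def z_def)
qed

text \<open>Points violating the claim would form a sequence \<zeta> with |\<phi>(\<zeta> n)| -> 1.
  A fixed test function and its derivative are bounded on the disc, so by
  \<open>density_bounds\<close> the density of its image tends to 0 along \<zeta>, which is the
  hypothesis of \<open>compact_perturbation_test\<close>. The abstract family covers
  \<open>test_A\<close> and \<open>test_B\<close> at once.\<close>

lemma test_family_lower:
  assumes K: "compact_op BN bloch_norm K"
    and E: "op_norm BN bloch_norm (\<lambda>f z. T f z - K f z) \<le> ennreal E" "0 \<le> E" and \<epsilon>: "0 < \<epsilon>"
    and test: "\<And>a. cmod a < 1 \<Longrightarrow> test a = test_fun a (b a) (c a)"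
      "\<And>a. cmod a < 1 \<Longrightarrow> test a \<in> fspace BN" "\<And>a. cmod a < 1 \<Longrightarrow> BN (test a) \<le> ennreal test_const"
  shows "\<exists>\<delta><1. \<forall>z\<in>unit_disc. \<delta> < cmod (\<phi> z) \<longrightarrow>
    bloch_density (T (test (\<phi> z))) z \<le> 4 * test_const * E + \<epsilon>"
proof (rule ccontr)
  assume no: "\<not> ?thesis"
  have "\<exists>z\<in>unit_disc. 1 - 1 / real (Suc n) < cmod (\<phi> z)
      \<and> 4 * test_const * E + \<epsilon> < bloch_density (T (test (\<phi> z))) z" for n :: nat
  proof -
    have "1 - 1 / real (Suc n) < 1" by simp
    with no show ?thesis by (meson not_le)
  qed
  then obtain \<zeta> where \<zeta>: "\<And>n. \<zeta> n \<in> unit_disc" "\<And>n. 1 - 1 / real (Suc n) < cmod (\<phi> (\<zeta> n))"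
    "\<And>n. 4 * test_const * E + \<epsilon> < bloch_density (T (test (\<phi> (\<zeta> n)))) (\<zeta> n)"
    by metis
  define F where "F = (\<lambda>n. test (\<phi> (\<zeta> n)))"
  note a = norm_\<phi>[OF \<zeta>(1)]
  obtain S where S: "S \<ge> 0"
    "\<And>z. z \<in> unit_disc \<Longrightarrow> Au z \<le> S * (1 - (cmod (\<phi> z))\<^sup>2) powr s"
    "\<And>z. z \<in> unit_disc \<Longrightarrow> Bu z \<le> S * (1 - (cmod (\<phi> z))\<^sup>2) powr (s + 1)"
    by (rule density_bounds) (rule that)
  have lim: "(\<lambda>m. bloch_density (T (F n)) (\<zeta> m)) \<longlonglongrightarrow> 0" for n
  proof -
    obtain L where L: "\<And>z. z \<in> unit_disc \<Longrightarrow> cmod (F n z) \<le> L"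
      "\<And>z. z \<in> unit_disc \<Longrightarrow> cmod (deriv (F n) z) \<le> L"
      using test_fun_bounded[OF a] unfolding F_def test(1)[OF a] by metis
    have L0: "L \<ge> 0" using order_trans[OF norm_ge_zero L(1)[of 0]] by simp
    have hol: "F n holomorphic_on unit_disc"
      using test(2)[OF a] by (auto simp: F_def fspace_def hol_disc_def)
    let ?t = "\<lambda>m. 2 * (1 / real (Suc m))"
    have t0: "?t \<longlonglongrightarrow> 0"
      using tendsto_mult_left[OF LIMSEQ_Suc[OF lim_1_over_n], of 2] by simp
    have le: "bloch_density (T (F n)) (\<zeta> m) \<le> S * ?t m powr s * L + S * ?t m powr (s + 1) * L" for m
    proof -
      have "1 - (cmod (\<phi> (\<zeta> m)))\<^sup>2 = (1 - cmod (\<phi> (\<zeta> m))) * (1 + cmod (\<phi> (\<zeta> m)))"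
        by (simp add: power2_eq_square algebra_simps)
      also have "\<dots> \<le> 1 / real (Suc m) * 2"
        using \<zeta>(2)[of m] a[of m] by (intro mult_mono) auto
      finally have t: "1 - (cmod (\<phi> (\<zeta> m)))\<^sup>2 \<le> ?t m" by simp
      have pos: "0 \<le> 1 - (cmod (\<phi> (\<zeta> m)))\<^sup>2" using a[of m] by (simp add: power_le_one_iff)
      have A: "Au (\<zeta> m) \<le> S * ?t m powr s"
        by (rule order_trans[OF S(2)[OF \<zeta>(1)]])
          (use S(1) s_pos pos t in \<open>intro mult_left_mono powr_mono2, auto\<close>)
      have B: "Bu (\<zeta> m) \<le> S * ?t m powr (s + 1)"
        by (rule order_trans[OF S(3)[OF \<zeta>(1)]])
          (use S(1) s_pos pos t in \<open>intro mult_left_mono powr_mono2, auto\<close>)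
      have d: "\<phi> (\<zeta> m) \<in> unit_disc" using a[of m] by simp
      have "bloch_density (T (F n)) (\<zeta> m)
        \<le> Au (\<zeta> m) * cmod (F n (\<phi> (\<zeta> m))) + Bu (\<zeta> m) * cmod (deriv (F n) (\<phi> (\<zeta> m)))"
        by (rule bloch_density_wcomp_le[OF hol \<zeta>(1)])
      also have "\<dots> \<le> S * ?t m powr s * L + S * ?t m powr (s + 1) * L"
        using S(1) by (intro add_mono mult_mono A B L d) auto
      finally show ?thesis .
    qed
    have "(\<lambda>m. ?t m powr r) \<longlonglongrightarrow> 0" if "r > 0" for r
      using that by (intro tendsto_zero_powrI[OF t0 tendsto_const]) auto
    then have "(\<lambda>m. S * ?t m powr s * L + S * ?t m powr (s + 1) * L) \<longlonglongrightarrow> S * 0 * L + S * 0 * L"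
      using s_pos by (intro tendsto_add tendsto_mult tendsto_const) auto
    then have lim0: "(\<lambda>m. S * ?t m powr s * L + S * ?t m powr (s + 1) * L) \<longlonglongrightarrow> 0" by simp
    show ?thesis
      by (rule tendsto_sandwich[OF always_eventually always_eventually tendsto_const lim0])
        (intro allI le bloch_density_nonneg \<zeta>(1))+
  qed
  have "\<exists>m. bloch_density (T (F m)) (\<zeta> m) \<le> 4 * test_const * E + \<epsilon>"
    using compact_perturbation_test[OF K E _ _ test_const_pos \<zeta>(1) lim \<epsilon>] test(2,3)[OF a]
    by (simp add: F_def)
  with \<zeta>(3) show False by (auto simp: F_def not_le[symmetric])
qed

lemma density_le_at_boundary:
  assumes K: "compact_op BN bloch_norm K"
    and E: "op_norm BN bloch_norm (\<lambda>f z. T f z - K f z) \<le> ennreal E" "0 \<le> E" and \<epsilon>: "0 < \<epsilon>"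
  shows "\<exists>\<delta><1. \<forall>z\<in>unit_disc. \<delta> < cmod (\<phi> z) \<longrightarrow>
      Au z \<le> (4 * test_const * E + \<epsilon>) * (1 - (cmod (\<phi> z))\<^sup>2) powr s"
    and "\<exists>\<delta><1. \<forall>z\<in>unit_disc. \<delta> < cmod (\<phi> z) \<longrightarrow>
      Bu z \<le> (4 * test_const * E + \<epsilon>) * (1 - (cmod (\<phi> z))\<^sup>2) powr (s + 1)"
proof -
  have inv: "x \<le> Y * t powr r" if "x * t powr (-r) \<le> Y" "t > 0" for x t r Y :: real
    using that by (simp add: powr_minus field_simps)
  have t: "0 < 1 - (cmod (\<phi> z))\<^sup>2" if "z \<in> unit_disc" for z
    using norm_\<phi>[OF that] by (simp add: power_less_one_iff)
  have "\<exists>\<delta><1. \<forall>z\<in>unit_disc. \<delta> < cmod (\<phi> z) \<longrightarrow>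
      bloch_density (T (test_A (\<phi> z))) z \<le> 4 * test_const * E + \<epsilon>"
    by (rule test_family_lower[where b = "\<lambda>_. 1" and c = "\<lambda>a. - of_nat N * cnj a", OF K E \<epsilon>])
      (simp add: test_A_def, (erule test_AB_fspace)+)
  then show "\<exists>\<delta><1. \<forall>z\<in>unit_disc. \<delta> < cmod (\<phi> z) \<longrightarrow>
      Au z \<le> (4 * test_const * E + \<epsilon>) * (1 - (cmod (\<phi> z))\<^sup>2) powr s"
    using bloch_density_test_A inv t by metis
  have "\<exists>\<delta><1. \<forall>z\<in>unit_disc. \<delta> < cmod (\<phi> z) \<longrightarrow>
      bloch_density (T (test_B (\<phi> z))) z \<le> 4 * test_const * E + \<epsilon>"
    by (rule test_family_lower[where b = "\<lambda>_. 0" and c = "\<lambda>_. 1", OF K E \<epsilon>])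
      (simp add: test_B_def, (erule test_AB_fspace)+)
  then show "\<exists>\<delta><1. \<forall>z\<in>unit_disc. \<delta> < cmod (\<phi> z) \<longrightarrow>
      Bu z \<le> (4 * test_const * E + \<epsilon>) * (1 - (cmod (\<phi> z))\<^sup>2) powr (s + 1)"
    using bloch_density_test_B inv t by metis
qed

end

subsection \<open>Upper bound\<close>

text \<open>Uses the exponent \<open>j = \<lceil>1/(2y)\<rceil>\<close>, for which \<open>(1 - y) ^ (j - 1) \<ge> 1/2\<close> by Bernoulli's inequality.\<close>
lemma weight_le_of_powers_le:
  fixes X w :: "'a \<Rightarrow> real"
  assumes t: "0 < t" and w: "\<And>z. z \<in> D \<Longrightarrow> 0 \<le> w z \<and> w z < 1"
    and X: "\<And>z. z \<in> D \<Longrightarrow> 0 \<le> X z"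
    and le: "\<And>j z. J \<le> j \<Longrightarrow> z \<in> D \<Longrightarrow> real j powr t * (w z ^ (j - 1) * X z) \<le> \<rho>"
  shows "\<exists>\<delta><1. \<forall>z\<in>D. \<delta> < w z \<longrightarrow> X z \<le> 2 * 2 powr t * \<rho> * (1 - w z) powr t"
\<comment> \<open>Beyond this threshold y = 1 - w z is below 1 / (2 (J + 1)), so the chosen exponent
  j exceeds J and \<open>le\<close> applies.\<close>
proof (intro exI[of _ "1 - 1 / (2 * real (Suc J))"] conjI ballI impI)
  fix z assume z: "z \<in> D" and "1 - 1 / (2 * real (Suc J)) < w z"
  define y where "y = 1 - w z"
  have y: "0 < y" "y < 1 / (2 * real (Suc J))" "y \<le> 1"
    using w[OF z] \<open>_ < w z\<close> by (auto simp: y_def)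
  define j where "j = nat \<lceil>1 / (2 * y)\<rceil>"
  have Jj: "real (Suc J) < 1 / (2 * y)"
    using y(1,2) by (simp add: field_simps)
  have j: "1 / (2 * y) \<le> real j" unfolding j_def by (rule real_nat_ceiling_ge)
  have j': "real j < 1 / (2 * y) + 1"
    unfolding j_def using y(1) by (simp add: of_nat_nat ceiling_less_iff) linarith
  have "real (Suc J) \<le> real j" using Jj j by linarith
  then have jJ: "Suc J \<le> j" by (simp only: of_nat_le_iff)
  have "real (j - 1) * y \<le> 1 / 2"
  proof -
    have "real (j - 1) \<le> 1 / (2 * y)" using j' jJ by (simp add: of_nat_diff)
    then have "real (j - 1) * y \<le> 1 / (2 * y) * y" using y by (intro mult_right_mono) auto
    then show ?thesis using y by simp
  qed
  then have half: "1 / 2 \<le> (1 - y) ^ (j - 1)"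
    using Bernoulli_inequality[of "-y" "j - 1"] y by simp
  have "(1 / (2 * y)) powr t * (1 / 2 * X z) \<le> real j powr t * (w z ^ (j - 1) * X z)"
    using j half y t X[OF z] by (intro mult_mono powr_mono2) (auto simp: y_def)
  also have "\<dots> \<le> \<rho>" using jJ by (intro le z) auto
  finally show "X z \<le> 2 * 2 powr t * \<rho> * (1 - w z) powr t"
    using y(1) unfolding y_def[symmetric]
    by (simp add: powr_divide powr_mult field_simps)
qed auto

lemma cauchy_deriv_bound:
  assumes f: "f holomorphic_on S" and sub: "cball w d \<subseteq> S" and d: "0 < d"
    and le: "\<And>z. z \<in> cball w d \<Longrightarrow> cmod (f z) \<le> M"
  shows "cmod (deriv f w) \<le> M / d"
proof -
  have "cmod ((deriv ^^ 1) f w) \<le> fact 1 * M / d ^ 1"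
  proof (rule Cauchy_inequality)
    show "f holomorphic_on ball w d"
      using f sub by (meson ball_subset_cball holomorphic_on_subset subset_trans)
    show "continuous_on (cball w d) f"
      using f sub by (meson holomorphic_on_imp_continuous_on holomorphic_on_subset)
  qed (use d le in \<open>auto simp: dist_norm\<close>)
  then show ?thesis by simp
qed

lemma dilation_diff_le:
  assumes f: "f holomorphic_on unit_disc" and \<eta>: "\<eta> < 1"
    and le: "\<And>w. w \<in> cball 0 \<eta> \<Longrightarrow> cmod (deriv f w) \<le> L"
    and w: "w \<in> cball 0 \<eta>" and r: "0 \<le> r" "r \<le> 1"
  shows "cmod (f w - f (of_real r * w)) \<le> L * (1 - r)"
proof -
  have L: "0 \<le> L" using order_trans[OF norm_ge_zero le[OF w]] .
  have w1: "cmod w < 1" using w \<eta> by simp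
  have rw: "of_real r * w \<in> cball 0 \<eta>"
    using w r mult_left_le_one_le[of "cmod w" r] by (simp add: norm_mult)
  have "cmod (f w - f (of_real r * w)) \<le> L * cmod (w - of_real r * w)"
  proof (rule field_differentiable_bound[OF convex_cball])
    fix z assume z: "z \<in> cball (0::complex) \<eta>"
    then have "(f has_field_derivative deriv f z) (at z)"
      using \<eta> by (intro holomorphic_derivI[OF f]) auto
    then show "(f has_field_derivative deriv f z) (at z within cball 0 \<eta>)"
      by (rule has_field_derivative_at_within)
    show "cmod (deriv f z) \<le> L" by (rule le[OF z])
  qed (fact w, fact rw)
  also have "w - of_real r * w = of_real (1 - r) * w" by (simp add: algebra_simps)
  also have "L * cmod (of_real (1 - r) * w) \<le> L * (1 - r)"
    unfolding norm_mult norm_of_real using r L w1 by (intro mult_left_mono) (auto intro: mult_left_le)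
  finally show ?thesis .
qed

lemma ennreal_tendsto_0I:
  fixes f :: "'a \<Rightarrow> ennreal"
  assumes "\<And>e::real. 0 < e \<Longrightarrow> \<forall>\<^sub>F x in F. f x \<le> ennreal e"
  shows "(f \<longlongrightarrow> 0) F"
proof (rule order_tendstoI)
  fix a :: ennreal assume "0 < a"
  then obtain e :: real where e: "0 < e" "ennreal e < a"
  proof (cases a)
    case (real x)
    then show ?thesis using \<open>0 < a\<close> that[of "x / 2"] by (auto simp: ennreal_less_iff)
  next
    case top
    then show ?thesis using that[of 1] by auto
  qed
  show "\<forall>\<^sub>F x in F. f x < a"
    using assms[OF e(1)] by (rule eventually_mono) (use e(2) in auto)
qed simp

context bergman
begin

text \<open>The summand 2 bounds the value at 0 and the density where |\<phi>| is bounded away from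
  1. Near the boundary f(\<phi>) and f(r\<phi>) are estimated separately, hence the factor 2 before
  the growth constants of f and f'.\<close>

definition upper_const :: real where
  "upper_const = 2 + 2 * (eval_const + 2 powr (s + 1) * eval_const)"

lemma upper_const_pos: "0 < upper_const"
  using eval_const_pos by (simp add: upper_const_def add_pos_pos)

end

section \<open>Dilated operators: compactness and distance to the original\<close>

context bounded_wcomp
begin

definition dil :: "real \<Rightarrow> (complex \<Rightarrow> complex) \<Rightarrow> complex \<Rightarrow> complex" where
  "dil r = wcomp u (\<lambda>z. of_real r * \<phi> z)"

lemma dilated_symbol:
  assumes r: "0 \<le> r" "r \<le> 1"
  shows "(\<lambda>z. of_real r * \<phi> z) holomorphic_on unit_disc"
    "(\<lambda>z. of_real r * \<phi> z) ` unit_disc \<subseteq> unit_disc"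
    "z \<in> unit_disc \<Longrightarrow> cmod (of_real r * \<phi> z) \<le> cmod (\<phi> z)"
    "z \<in> unit_disc \<Longrightarrow> cmod (of_real r * \<phi> z) \<le> r"
proof -
  show 1: "cmod (of_real r * \<phi> z) \<le> cmod (\<phi> z)" for z
    using r by (simp add: norm_mult mult_left_le_one_le)
  show "(\<lambda>z. of_real r * \<phi> z) holomorphic_on unit_disc"
    by (intro holomorphic_intros \<phi>)
  show "(\<lambda>z. of_real r * \<phi> z) ` unit_disc \<subseteq> unit_disc"
    using le_less_trans[OF 1 norm_\<phi>] by (auto simp: dist_norm)
  show "cmod (of_real r * \<phi> z) \<le> r" if "z \<in> unit_disc" for z
    using r norm_\<phi>[OF that] by (simp add: norm_mult mult_left_le)
qed

lemma dil_hol_disc: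
  assumes "0 \<le> r" "r \<le> 1" "f holomorphic_on unit_disc"
  shows "dil r f \<in> hol_disc"
  unfolding dil_def by (intro wcomp_hol_disc u dilated_symbol assms)

lemma deriv_dil:
  assumes r: "0 \<le> r" "r \<le> 1" and f: "f holomorphic_on unit_disc" and z: "z \<in> unit_disc"
  shows "deriv (dil r f) z = deriv u z * f (of_real r * \<phi> z)
      + u z * (deriv f (of_real r * \<phi> z) * (of_real r * deriv \<phi> z))"
proof -
  have "deriv (\<lambda>z. of_real r * \<phi> z) z = of_real r * deriv \<phi> z"
    using \<phi> z by (intro deriv_cmult holomorphic_on_imp_differentiable_at[OF \<phi>]) auto
  then show ?thesis
    unfolding dil_def deriv_wcomp[OF u dilated_symbol(1,2)[OF r] f z] by simp
qed

text \<open>Only the values of f and f' on |w| \<le> r enter. This is what turns locally uniform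
  convergence into convergence in the Bloch norm.\<close>

lemma dil_bloch_norm_le:
  assumes r: "0 \<le> r" "r \<le> 1" and f: "f holomorphic_on unit_disc"
    and S: "\<And>z. z \<in> unit_disc \<Longrightarrow> Au z \<le> S" "\<And>z. z \<in> unit_disc \<Longrightarrow> Bu z \<le> S"
    and le: "\<And>w. w \<in> unit_disc \<Longrightarrow> cmod w \<le> r \<Longrightarrow> cmod (f w) \<le> a"
      "\<And>w. w \<in> unit_disc \<Longrightarrow> cmod w \<le> r \<Longrightarrow> cmod (deriv f w) \<le> a"
  shows "bloch_norm (dil r f) \<le> ennreal (cmod (u 0) * a + 2 * S * a)"
proof (rule bloch_norm_le)
  have mem: "of_real r * \<phi> z \<in> unit_disc" "cmod (of_real r * \<phi> z) \<le> r" if "z \<in> unit_disc" for z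
    using dilated_symbol(2,4)[OF r] that by blast+
  have a: "0 \<le> a" using order_trans[OF norm_ge_zero le(1)[OF mem[of 0]]] by simp
  have S0: "0 \<le> S" using order_trans[OF Au_nonneg S(1), of 0] by simp
  show "cmod (dil r f 0) \<le> cmod (u 0) * a"
    using le(1)[OF mem[of 0]] by (simp add: dil_def wcomp_def norm_mult mult_left_mono)
  show "0 \<le> 2 * S * a" using a S0 by simp
  fix z assume z: "z \<in> unit_disc"
  note m = mem[OF z]
  have "cmod (deriv (dil r f) z) \<le> cmod (deriv u z) * cmod (f (of_real r * \<phi> z))
      + cmod (u z) * (cmod (deriv f (of_real r * \<phi> z)) * (r * cmod (deriv \<phi> z)))"
    unfolding deriv_dil[OF r f z] using r
    by (intro norm_triangle_le) (simp add: norm_mult)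
  also have "\<dots> \<le> cmod (deriv u z) * a + cmod (u z) * (a * (1 * cmod (deriv \<phi> z)))"
    using r a by (intro add_mono mult_left_mono mult_mono le m) auto
  finally have "bloch_density (dil r f) z
     \<le> (1 - (cmod z)\<^sup>2) * (cmod (deriv u z) * a + cmod (u z) * (a * (1 * cmod (deriv \<phi> z))))"
    unfolding bloch_density_def using one_minus_cmod_sq_pos[OF z] by (intro mult_left_mono) auto
  also have "\<dots> = Au z * a + Bu z * a"
    by (simp add: Au_def Bu_def algebra_simps)
  also have "\<dots> \<le> S * a + S * a"
    using a by (intro add_mono mult_right_mono S z)
  finally show "bloch_density (dil r f) z \<le> 2 * S * a" by simp
qed

text \<open>A normal families argument. Point evaluations bound a norm-bounded sequence on compact
  sets, Montel extracts a locally uniform limit h, and Cauchy's estimate upgrades convergence on |w|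
  \<le> r + d to convergence of the derivatives on |w| \<le> r.\<close>

lemma dil_compact:
  assumes r: "0 \<le> r" "r < 1"
  shows "compact_op BN bloch_norm (dil r)"
proof -
  have r': "r \<le> 1" using r by simp
  obtain S0 where S0: "S0 \<ge> 0"
    "\<And>z. z \<in> unit_disc \<Longrightarrow> Au z \<le> S0" "\<And>z. z \<in> unit_disc \<Longrightarrow> Bu z \<le> S0"
    by (rule density_bounds) (rule that)
  \<comment> \<open>Stated for every f holomorphic on the disc because it is applied to the Montel
    limit h as well.\<close>
  have fin: "dil r f \<in> fspace bloch_norm" if f: "f holomorphic_on unit_disc" for f
  proof -
    have sub: "cball 0 r \<subseteq> unit_disc" using r by auto
    have "continuous_on (cball 0 r) f" "continuous_on (cball 0 r) (deriv f)"
      using holomorphic_on_subset[OF f sub] holomorphic_on_subset[OF holomorphic_deriv[OF f open_ball] sub]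
      by (auto intro: holomorphic_on_imp_continuous_on)
    then have "bounded (f ` cball 0 r)" "bounded (deriv f ` cball 0 r)"
      by (auto intro!: compact_imp_bounded compact_continuous_image)
    then obtain A B where "\<And>z. z \<in> cball 0 r \<Longrightarrow> cmod (f z) \<le> A" "\<And>z. z \<in> cball 0 r \<Longrightarrow> cmod (deriv f z) \<le> B"
      unfolding bounded_iff by blast
    then have "bloch_norm (dil r f) \<le> ennreal (cmod (u 0) * max A B + 2 * S0 * max A B)"
      by (intro dil_bloch_norm_le r r' f S0(2,3)) (auto simp: le_max_iff_disj)
    then show ?thesis
      using dil_hol_disc[OF r(1) r' f] by (auto simp: fspace_def intro: le_less_trans)
  qed
  have "linear_op BN bloch_norm (dil r)"
    unfolding linear_op_def
  proof (intro conjI ballI allI)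
    show "dil r f \<in> fspace bloch_norm" if "f \<in> fspace BN" for f
      using that by (intro fin) (auto simp: fspace_def hol_disc_def)
  qed (auto simp: dil_def wcomp_def algebra_simps)
  moreover have "\<exists>q g. strict_mono q \<and> g \<in> fspace bloch_norm \<and> (\<lambda>n. bloch_norm (\<lambda>z. dil r (F (q n)) z - g z)) \<longlonglongrightarrow> 0"
    if F: "\<And>n. F n \<in> fspace BN" and B: "\<And>n. BN (F n) \<le> ennreal B" for F :: "nat \<Rightarrow> complex \<Rightarrow> complex" and B :: real
  proof -
    define B' where "B' = max B 0"
    have B': "0 \<le> B'" "BN (F n) \<le> ennreal B'" for n
      using B[of n] by (auto simp: B'_def intro: order_trans ennreal_leI)
    define H where "H = {f. f holomorphic_on unit_disc \<and> (\<forall>z\<in>unit_disc. cmod (f z) \<le> eval_const * B' * (1 - cmod z) powr (-s))}"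
    have FH: "range F \<subseteq> H"
      using F B' by (auto simp: H_def fspace_def hol_discD intro!: bergman_point_evaluation)
    have bdd: "\<exists>C. \<forall>h\<in>H. \<forall>z\<in>K. cmod (h z) \<le> C" if K: "compact K" "K \<subseteq> unit_disc" for K
    proof -
      have "continuous_on K (\<lambda>z. eval_const * B' * (1 - cmod z) powr (-s))"
        using K(2) by (intro continuous_intros) (auto simp: subset_iff)
      then have "bounded ((\<lambda>z. eval_const * B' * (1 - cmod z) powr (-s)) ` K)"
        by (intro compact_imp_bounded compact_continuous_image K)
      then obtain C where "\<And>z. z \<in> K \<Longrightarrow> \<bar>eval_const * B' * (1 - cmod z) powr (-s)\<bar> \<le> C"
        unfolding bounded_iff by auto
      then show ?thesis
        using K(2) order_trans[OF _ order_trans[OF abs_ge_self]]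
        unfolding H_def by (intro exI[of _ C] ballI) blast
    qed
    have Hhol: "f holomorphic_on unit_disc" if "f \<in> H" for f
      using that by (simp add: H_def)
    obtain h q where h: "h holomorphic_on unit_disc" and q: "strict_mono (q :: nat \<Rightarrow> nat)"
      and lim: "\<And>K. \<lbrakk>compact K; K \<subseteq> unit_disc\<rbrakk> \<Longrightarrow> uniform_limit K (F \<circ> q) h sequentially"
      by (rule Montel[OF open_ball Hhol bdd FH]) (assumption, assumption, assumption, rule that)
    define d where "d = (1 - r) / 2"
    have d: "0 < d" "r + d < 1" "d \<le> 1" using r by (auto simp: d_def field_simps)
    have sub: "cball (0::complex) (r + d) \<subseteq> unit_disc" using d by auto
    have "(\<lambda>n. bloch_norm (\<lambda>z. dil r (F (q n)) z - dil r h z)) \<longlonglongrightarrow> 0"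
    proof (rule ennreal_tendsto_0I)
      fix e :: real assume e: "0 < e"
      \<comment> \<open>If |G| \<le> k on the larger disc, then k/d bounds both G and G' on |w|
        \<le> r; the rest of the quotient makes the resulting Bloch norm at most e, and the summand
        1 keeps the denominator positive.\<close>
      define k where "k = e * d / (cmod (u 0) + 2 * S0 + 1)"
      have k: "0 < k" using e d S0(1) by (simp add: k_def add_nonneg_pos)
      have "\<forall>\<^sub>F n in sequentially. \<forall>w\<in>cball 0 (r + d). dist ((F \<circ> q) n w) (h w) < k"
        using uniform_limitD[OF lim[OF compact_cball sub] k] .
      then show "\<forall>\<^sub>F n in sequentially. bloch_norm (\<lambda>z. dil r (F (q n)) z - dil r h z) \<le> ennreal e"
      proof eventually_elim
        case (elim n)
        define G where "G = (\<lambda>w. F (q n) w - h w)"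
        have Fhol: "F (q n) holomorphic_on unit_disc"
          using F by (auto simp: fspace_def hol_disc_def)
        have G: "G holomorphic_on unit_disc"
          unfolding G_def by (intro holomorphic_intros h Fhol)
        have G1: "cmod (G w) \<le> k" if "w \<in> cball 0 (r + d)" for w
          using elim that by (auto simp: G_def dist_norm intro: less_imp_le)
        have kd: "k \<le> k / d" using k d by (simp add: field_simps mult_left_le)
        have "bloch_norm (dil r G) \<le> ennreal (cmod (u 0) * (k / d) + 2 * S0 * (k / d))"
        proof (rule dil_bloch_norm_le[OF r(1) r' G S0(2,3)])
          fix w assume w: "cmod w \<le> r"
          show "cmod (G w) \<le> k / d" using G1[of w] kd w d by simp
          have "cball w d \<subseteq> cball 0 (r + d)"
          proof
            fix x assume "x \<in> cball w d"
            then show "x \<in> cball 0 (r + d)"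
              using w norm_triangle_ineq2[of x w] by (simp add: dist_norm norm_minus_commute)
          qed
          then show "cmod (deriv G w) \<le> k / d"
            using sub G1 by (intro cauchy_deriv_bound[OF G _ d(1)]) auto
        qed
        also have "cmod (u 0) * (k / d) + 2 * S0 * (k / d) \<le> e"
        proof -
          define W where "W = cmod (u 0) + 2 * S0"
          have W: "0 \<le> W" using S0(1) by (simp add: W_def)
          have "k / d = e / (W + 1)" using d by (simp add: k_def W_def)
          then have "cmod (u 0) * (k / d) + 2 * S0 * (k / d) = e * (W / (W + 1))"
            by (simp only: distrib_right[symmetric] W_def[symmetric]) simp
          also have "\<dots> \<le> e * 1" using e W by (intro mult_left_mono) auto
          finally show ?thesis by simp
        qed
        finally have "bloch_norm (dil r G) \<le> ennreal e" by (simp add: ennreal_leI)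
        moreover have "dil r G = (\<lambda>z. dil r (F (q n)) z - dil r h z)"
          by (auto simp: dil_def wcomp_def G_def algebra_simps)
        ultimately show ?case by simp
      qed
    qed
    then show ?thesis using q fin[OF h] by blast
  qed
  ultimately show ?thesis unfolding compact_op_def by blast
qed

text \<open>A single dilation with r close to 1 suffices. Where |\<phi>| \<le> \<eta>, the
  difference of f and its dilate is small uniformly on the unit ball, which beats S. Where |\<phi>|
  > \<eta>, the assumed decay of \<open>Au\<close> and \<open>Bu\<close> cancels the growth of f and
  f' at \<phi>(z) and at r \<phi>(z), term by term.\<close>

lemma essential_norm_le:
  assumes Y: "0 < Y" and \<delta>: "\<delta> < 1"
    and bA: "\<And>z. z \<in> unit_disc \<Longrightarrow> \<delta> < cmod (\<phi> z) \<Longrightarrow> Au z \<le> Y * (1 - cmod (\<phi> z)) powr s"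
    and bB: "\<And>z. z \<in> unit_disc \<Longrightarrow> \<delta> < cmod (\<phi> z) \<Longrightarrow> Bu z \<le> Y * (1 - cmod (\<phi> z)) powr (s + 1)"
  shows "essential_norm BN bloch_norm T \<le> ennreal (upper_const * Y)"
proof -
  obtain S where S: "S \<ge> 0"
    "\<And>z. z \<in> unit_disc \<Longrightarrow> Au z \<le> S" "\<And>z. z \<in> unit_disc \<Longrightarrow> Bu z \<le> S"
    by (rule density_bounds) (rule that)
  define e0 where "e0 = eval_const"
  define e1 where "e1 = 2 powr (s + 1) * e0"
  define e2 where "e2 = 2 powr ((s + 1) + 1) * e1"
  have e: "0 < e0" "0 < e1" "0 < e2" using eval_const_pos by (auto simp: e0_def e1_def e2_def)
  \<comment> \<open>Including |\<phi>(0)| lets the same estimate handle the value at 0 in the Bloch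
    norm.\<close>
  define \<eta> where "\<eta> = max \<delta> (cmod (\<phi> 0))"
  have \<eta>: "0 \<le> \<eta>" "\<eta> < 1" using \<delta> norm_\<phi>[of 0] by (auto simp: \<eta>_def le_max_iff_disj)
  \<comment> \<open>For f in the unit ball, L bounds |f'| + |f''| on |w| \<le> \<eta>.\<close>
  define L where "L = e1 * (1 - \<eta>) powr (-(s + 1)) + e2 * (1 - \<eta>) powr (-(s + 2))"
  have L: "0 < L" using e \<eta> by (simp add: L_def add_pos_pos)
  \<comment> \<open>k is 1 - r. The bound 1/2 keeps r nonnegative; the other makes the errors k L,
    multiplied by |u(0)| or by 2 S, at most Y.\<close>
  define k where "k = min (1 / 2) (Y / (L * (cmod (u 0) + 2 * S + 1)))"
  have den: "0 < L * (cmod (u 0) + 2 * S + 1)" using L S(1) by (intro mult_pos_pos add_nonneg_pos) auto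
  have k: "0 < k" "k \<le> 1 / 2" using Y den unfolding k_def by (simp, intro min.cobounded1)
  have kL: "k * L * (cmod (u 0) + 2 * S + 1) \<le> Y"
  proof -
    have "k \<le> Y / (L * (cmod (u 0) + 2 * S + 1))" unfolding k_def by (rule min.cobounded2)
    then show ?thesis unfolding pos_le_divide_eq[OF den] by (simp only: mult.assoc)
  qed
  have kL1: "cmod (u 0) * (k * L) \<le> Y" and kL2: "S * (k * L) + S * (k * L) \<le> Y"
  proof -
    have nn: "0 \<le> cmod (u 0) * (k * L)" "0 \<le> S * (k * L)" "0 \<le> k * L" using k L S(1) by simp_all
    have "cmod (u 0) * (k * L) + (S * (k * L) + S * (k * L)) + k * L \<le> Y"
      using kL by (simp add: algebra_simps)
    then show "cmod (u 0) * (k * L) \<le> Y" "S * (k * L) + S * (k * L) \<le> Y" using nn by linarith+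
  qed
  define r where "r = 1 - k"
  have r: "0 \<le> r" "r < 1" "r \<le> 1" using k by (auto simp: r_def)
  have main: "bloch_norm (\<lambda>z. T f z - dil r f z) \<le> ennreal (upper_const * Y)"
    if f: "f \<in> fspace BN" and n: "BN f \<le> 1" for f
  proof -
    have fh: "f \<in> hol_disc" using f by (simp add: fspace_def)
    note hol = hol_discD(1)[OF fh]
    have hol': "deriv f holomorphic_on unit_disc" by (intro holomorphic_deriv hol) auto
    have f0: "cmod (f w) \<le> e0 * (1 - cmod w) powr (-s)" if "w \<in> unit_disc" for w
      using bergman_point_evaluation[OF fh, of 1 w] n that by (simp add: e0_def)
    have f1: "cmod (deriv f w) \<le> e1 * (1 - cmod w) powr (-(s + 1))" if "w \<in> unit_disc" for w
      unfolding e1_def using s_pos by (intro deriv_growth[OF hol _ f0 that]) auto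
    have f2: "cmod (deriv (deriv f) w) \<le> e2 * (1 - cmod w) powr (-(s + 2))" if "w \<in> unit_disc" for w
      using deriv_growth[OF hol' _ f1 that] s_pos by (simp add: e2_def add.assoc)
    have in_disc: "w \<in> unit_disc" "1 - \<eta> \<le> 1 - cmod w" if "w \<in> cball 0 \<eta>" for w
      using that \<eta> by auto
    have small: "c * (1 - cmod w) powr (-t) \<le> c * (1 - \<eta>) powr (-t)" if "w \<in> cball 0 \<eta>" "0 \<le> c" "0 \<le> t" for w c t
      using in_disc[OF that(1)] that \<eta> by (intro mult_left_mono powr_mono2') auto
    have g1: "cmod (deriv f w) \<le> e1 * (1 - \<eta>) powr (-(s + 1))" if "w \<in> cball 0 \<eta>" for w
      using order_trans[OF f1[OF in_disc(1)[OF that]] small[OF that, of e1 "s + 1"]] e s_pos by simp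
    have g2: "cmod (deriv (deriv f) w) \<le> e2 * (1 - \<eta>) powr (-(s + 2))" if "w \<in> cball 0 \<eta>" for w
      using order_trans[OF f2[OF in_disc(1)[OF that]] small[OF that, of e2 "s + 2"]] e s_pos by simp
    have near0: "cmod (f w - f (of_real r * w)) \<le> k * L" if w: "w \<in> cball 0 \<eta>" for w
    proof -
      have "cmod (f w - f (of_real r * w)) \<le> e1 * (1 - \<eta>) powr (-(s + 1)) * (1 - r)"
        by (rule dilation_diff_le[OF hol \<eta>(2) g1 w r(1,3)])
      also have "\<dots> \<le> L * k"
        unfolding r_def using k e by (simp add: L_def mult_right_mono)
      finally show ?thesis by (simp add: mult.commute)
    qed
    \<comment> \<open>The chain rule leaves a factor r, so f'(w) is compared with r f'(r w). The
      difference f'(w) - f'(r w) is controlled by f'', and the remaining k f'(r w) by f'.\<close>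
    have near1: "cmod (deriv f w - deriv f (of_real r * w) * of_real r) \<le> k * L" if w: "w \<in> cball 0 \<eta>" for w
    proof -
      have rw: "of_real r * w \<in> cball 0 \<eta>"
        using w r mult_left_le_one_le[of "cmod w" r] by (simp add: norm_mult)
      have "deriv f w - deriv f (of_real r * w) * of_real r
          = (deriv f w - deriv f (of_real r * w)) + of_real k * deriv f (of_real r * w)"
        by (simp add: r_def algebra_simps)
      also have "cmod \<dots> \<le> cmod (deriv f w - deriv f (of_real r * w)) + k * cmod (deriv f (of_real r * w))"
        using k by (intro norm_triangle_le) (simp add: norm_mult)
      also have "\<dots> \<le> e2 * (1 - \<eta>) powr (-(s + 2)) * (1 - r) + k * (e1 * (1 - \<eta>) powr (-(s + 1)))"
        using k by (intro add_mono mult_left_mono dilation_diff_le[OF hol' \<eta>(2) g2 w r(1,3)] g1 rw) auto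
      also have "\<dots> = k * L" by (simp add: r_def L_def algebra_simps)
      finally show ?thesis .
    qed
    have "bloch_norm (\<lambda>z. T f z - dil r f z) \<le> ennreal (Y + (Y + 2 * (e0 + e1) * Y))"
    proof (rule bloch_norm_le)
      have "\<phi> 0 \<in> cball 0 \<eta>" by (simp add: \<eta>_def)
      from near0[OF this] have "cmod (u 0) * cmod (f (\<phi> 0) - f (of_real r * \<phi> 0)) \<le> cmod (u 0) * (k * L)"
        by (intro mult_left_mono) auto
      then show "cmod (T f 0 - dil r f 0) \<le> Y"
        using kL1 by (simp add: wcomp_def dil_def norm_mult flip: right_diff_distrib)
      show "0 \<le> Y + 2 * (e0 + e1) * Y" using Y e by simp
      fix z assume z: "z \<in> unit_disc"
      define D0 where "D0 = f (\<phi> z) - f (of_real r * \<phi> z)"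
      define D1 where "D1 = deriv f (\<phi> z) - deriv f (of_real r * \<phi> z) * of_real r"
      have Th: "T f \<in> hol_disc" by (intro wcomp_hol_disc u \<phi> \<phi>_disc hol)
      have "deriv (\<lambda>z. T f z - dil r f z) z = deriv u z * D0 + u z * (D1 * deriv \<phi> z)"
        unfolding deriv_diff_hol_disc[OF Th dil_hol_disc[OF r(1,3) hol] z]
          deriv_wcomp[OF u \<phi> \<phi>_disc hol z] deriv_dil[OF r(1,3) hol z]
        by (simp add: D0_def D1_def algebra_simps)
      then have "cmod (deriv (\<lambda>z. T f z - dil r f z) z)
          \<le> cmod (deriv u z) * cmod D0 + cmod (u z) * (cmod D1 * cmod (deriv \<phi> z))"
        using norm_triangle_ineq[of "deriv u z * D0" "u z * (D1 * deriv \<phi> z)"] by (simp add: norm_mult)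
      then have "bloch_density (\<lambda>z. T f z - dil r f z) z
          \<le> (1 - (cmod z)\<^sup>2) * (cmod (deriv u z) * cmod D0 + cmod (u z) * (cmod D1 * cmod (deriv \<phi> z)))"
        unfolding bloch_density_def using one_minus_cmod_sq_pos[OF z] by (intro mult_left_mono) auto
      also have "\<dots> = Au z * cmod D0 + Bu z * cmod D1"
        by (simp add: Au_def Bu_def algebra_simps)
      also have "\<dots> \<le> Y + 2 * (e0 + e1) * Y"
      proof (cases "cmod (\<phi> z) \<le> \<eta>")
        case True
        then have m: "\<phi> z \<in> cball 0 \<eta>" by simp
        have "Au z * cmod D0 + Bu z * cmod D1 \<le> S * (k * L) + S * (k * L)"
          unfolding D0_def D1_def
          by (intro add_mono mult_mono S(2,3) z near0 near1 m S(1) norm_ge_zero)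
        then show ?thesis using kL2 Y e by (simp add: add_increasing2)
      next
        case False
        then have d: "\<delta> < cmod (\<phi> z)" by (simp add: \<eta>_def)
        define y where "y = 1 - cmod (\<phi> z)"
        have y: "0 < y" using norm_\<phi>[OF z] by (simp add: y_def)
        have m1: "\<phi> z \<in> unit_disc" using norm_\<phi>[OF z] by simp
        have m2: "of_real r * \<phi> z \<in> unit_disc" using dilated_symbol(2)[OF r(1,3)] z by blast
        have ry: "y \<le> 1 - cmod (of_real r * \<phi> z)"
          using dilated_symbol(3)[OF r(1,3) z] by (simp add: y_def)
        have mono: "c * (1 - cmod (of_real r * \<phi> z)) powr (-t) \<le> c * y powr (-t)" if "0 \<le> c" "0 \<le> t" for c t
          using ry y that by (intro mult_left_mono powr_mono2') auto
        have a0: "cmod (f (\<phi> z)) \<le> e0 * y powr (-s)" "cmod (f (of_real r * \<phi> z)) \<le> e0 * y powr (-s)"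
          using f0[OF m1] order_trans[OF f0[OF m2] mono[of e0 s]] e s_pos by (auto simp: y_def)
        have a1: "cmod (deriv f (\<phi> z)) \<le> e1 * y powr (-(s + 1))"
          "cmod (deriv f (of_real r * \<phi> z)) \<le> e1 * y powr (-(s + 1))"
          using f1[OF m1] order_trans[OF f1[OF m2] mono[of e1 "s + 1"]] e s_pos by (auto simp: y_def)
        have "cmod D0 \<le> 2 * e0 * y powr (-s)"
          using norm_triangle_ineq4[of "f (\<phi> z)" "f (of_real r * \<phi> z)"] a0 by (simp add: D0_def)
        then have b0: "Au z * cmod D0 \<le> (Y * y powr s) * (2 * e0 * y powr (-s))"
          using bA[OF z d] Y by (intro mult_mono) (auto simp: y_def)
        have "cmod (deriv f (of_real r * \<phi> z) * of_real r) \<le> cmod (deriv f (of_real r * \<phi> z))"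
          using r by (simp add: norm_mult mult_left_le)
        then have "cmod D1 \<le> 2 * e1 * y powr (-(s + 1))"
          using norm_triangle_ineq4[of "deriv f (\<phi> z)" "deriv f (of_real r * \<phi> z) * of_real r"] a1
          by (simp add: D1_def)
        then have b1: "Bu z * cmod D1 \<le> (Y * y powr (s + 1)) * (2 * e1 * y powr (-(s + 1)))"
          using bB[OF z d] Y by (intro mult_mono) (auto simp: y_def)
        have cancel: "(Y * y powr t) * (c * y powr (-t)) = c * Y" for c t
          using y by (simp add: powr_minus field_simps)
        show ?thesis
          using b0 b1 Y unfolding cancel by (simp add: algebra_simps)
      qed
      finally show "bloch_density (\<lambda>z. T f z - dil r f z) z \<le> Y + 2 * (e0 + e1) * Y" .
    qed
    also have "Y + (Y + 2 * (e0 + e1) * Y) = upper_const * Y"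
      by (simp add: upper_const_def e0_def e1_def algebra_simps)
    finally show ?thesis .
  qed
  have "op_norm BN bloch_norm (\<lambda>f z. T f z - dil r f z) \<le> ennreal (upper_const * Y)"
    unfolding op_norm_def by (intro SUP_least) (use main in auto)
  moreover have "essential_norm BN bloch_norm T \<le> op_norm BN bloch_norm (\<lambda>f z. T f z - dil r f z)"
    unfolding essential_norm_def using dil_compact[OF r(1,2)] by (intro INF_lower) simp
  ultimately show ?thesis by (rule order_trans[rotated])
qed

end

subsection \<open>The essential norm\<close>

context bergman
begin

text \<open>The maximum covers the exponents s + 1 for I and s for J in
  \<open>eventually_powr_power_le\<close>; 4 * test_const is the factor lost in
  \<open>compact_perturbation_test\<close>.\<close>

definition lower_const :: real where
  "lower_const = max (2 powr (s + 1) * growth_const (s + 1)) (2 powr s * growth_const s) * (4 * test_const)"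

lemma lower_const_pos: "0 < lower_const"
  unfolding lower_const_def using growth_const_pos[of s] test_const_pos
  by (intro mult_pos_pos) (auto simp: less_max_iff_disj)

end

context bounded_wcomp
begin

definition seqI :: "nat \<Rightarrow> ennreal" where
  "seqI j = ennreal (real j powr s) * bloch_norm (I_op u (\<lambda>z. \<phi> z ^ j))"
definition seqJ :: "nat \<Rightarrow> ennreal" where
  "seqJ j = ennreal (real j powr s) * bloch_norm (J_op u (\<lambda>z. \<phi> z ^ (j - 1)))"

lemma scaled_bloch_density_le:
  assumes "ennreal c * bloch_norm g \<le> ennreal \<rho>" "0 < c" "0 \<le> \<rho>" "z \<in> unit_disc"
  shows "c * bloch_density g z \<le> \<rho>"
proof -
  have "bloch_norm g = ennreal (1 / c) * (ennreal c * bloch_norm g)"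
    using assms(2) by (simp add: mult.assoc[symmetric] ennreal_mult[symmetric])
  also have "\<dots> \<le> ennreal (1 / c) * ennreal \<rho>" by (intro mult_left_mono assms) simp
  also have "\<dots> = ennreal (\<rho> / c)" using assms by (simp add: ennreal_mult[symmetric])
  finally have "bloch_density g z \<le> \<rho> / c" using assms by (intro bloch_density_le) auto
  then show ?thesis using assms(2) by (simp add: field_simps)
qed

lemma scaled_bloch_norm_le:
  assumes "\<And>z. z \<in> unit_disc \<Longrightarrow> c * bloch_density g z \<le> \<rho>" "g 0 = 0" "0 < c" "0 \<le> \<rho>"
  shows "ennreal c * bloch_norm g \<le> ennreal \<rho>"
proof -
  have "bloch_norm g \<le> ennreal (0 + \<rho> / c)"
    using assms by (intro bloch_norm_le) (auto simp: field_simps)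
  then have "ennreal c * bloch_norm g \<le> ennreal c * ennreal (\<rho> / c)"
    by (intro mult_left_mono) auto
  also have "\<dots> = ennreal \<rho>" using assms by (simp add: ennreal_mult[symmetric])
  finally show ?thesis .
qed

text \<open>Differentiating \<phi>^j produces a factor j. It raises j^s to j^(s+1), which is why
  \<open>Bu\<close> is paired with the exponent s + 1.\<close>

lemma I_density_eq:
  assumes "1 \<le> j" "z \<in> unit_disc"
  shows "real j powr s * bloch_density (I_op u (\<lambda>z. \<phi> z ^ j)) z
    = real j powr (s + 1) * (cmod (\<phi> z) ^ (j - 1) * Bu z)"
  using assms by (simp add: bloch_density_I powr_add)

lemma limsup_lower_bound:
  assumes K: "compact_op BN bloch_norm K"
    and E: "op_norm BN bloch_norm (\<lambda>f z. T f z - K f z) \<le> ennreal E" "0 \<le> E" and \<epsilon>: "0 < \<epsilon>"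
  shows "limsup seqI \<le> ennreal (2 powr (s + 1) * growth_const (s + 1) * (4 * test_const * E + \<epsilon>) + \<epsilon>)"
    and "limsup seqJ \<le> ennreal (2 powr s * growth_const s * (4 * test_const * E + \<epsilon>) + \<epsilon>)"
proof -
  obtain S where S: "S \<ge> 0"
    "\<And>z. z \<in> unit_disc \<Longrightarrow> Au z \<le> S" "\<And>z. z \<in> unit_disc \<Longrightarrow> Bu z \<le> S"
    by (rule density_bounds) (rule that)
  define Y where "Y = 4 * test_const * E + \<epsilon>"
  have Y: "0 \<le> Y" using test_const_pos E(2) \<epsilon> by (simp add: Y_def)
  have w: "0 \<le> cmod (\<phi> z) \<and> cmod (\<phi> z) < 1" if "z \<in> unit_disc" for z
    using norm_\<phi>[OF that] by simp
  obtain \<delta>A \<delta>B where \<delta>: "\<delta>A < 1" "\<delta>B < 1"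
    and bA: "\<And>z. z \<in> unit_disc \<Longrightarrow> \<delta>A < cmod (\<phi> z) \<Longrightarrow> Au z \<le> Y * (1 - (cmod (\<phi> z))\<^sup>2) powr s"
    and bB: "\<And>z. z \<in> unit_disc \<Longrightarrow> \<delta>B < cmod (\<phi> z) \<Longrightarrow> Bu z \<le> Y * (1 - (cmod (\<phi> z))\<^sup>2) powr (s + 1)"
    using density_le_at_boundary[OF K E \<epsilon>] unfolding Y_def by metis
  have s1: "0 < s + 1" using s_pos by simp
  have nn: "0 \<le> 2 powr t * growth_const t * Y + \<epsilon>" for t
    using Y growth_const_pos[of t] \<epsilon> by simp
  have ev2: "\<forall>\<^sub>F j in sequentially. \<forall>z\<in>unit_disc.
      real j powr (s + 1) * (cmod (\<phi> z) ^ (j - 1) * Bu z) \<le> 2 powr (s + 1) * growth_const (s + 1) * Y + \<epsilon>"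
    by (rule eventually_powr_power_le[OF s1 \<delta>(2) w S(1) S(3) Y bB \<epsilon>])
  have ev1: "\<forall>\<^sub>F j in sequentially. \<forall>z\<in>unit_disc.
      real j powr s * (cmod (\<phi> z) ^ (j - 1) * Au z) \<le> 2 powr s * growth_const s * Y + \<epsilon>"
    by (rule eventually_powr_power_le[OF s_pos \<delta>(1) w S(1) S(2) Y bA \<epsilon>])
  show "limsup seqI \<le> ennreal (2 powr (s + 1) * growth_const (s + 1) * (4 * test_const * E + \<epsilon>) + \<epsilon>)"
    unfolding Y_def[symmetric]
  proof (rule Limsup_bounded)
    show "\<forall>\<^sub>F j in sequentially. seqI j \<le> ennreal (2 powr (s + 1) * growth_const (s + 1) * Y + \<epsilon>)"
      using ev2 eventually_ge_at_top[of 1]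
    proof eventually_elim
      case (elim j)
      show ?case unfolding seqI_def
        using elim by (intro scaled_bloch_norm_le nn I_op_0) (auto simp: I_density_eq)
    qed
  qed
  show "limsup seqJ \<le> ennreal (2 powr s * growth_const s * (4 * test_const * E + \<epsilon>) + \<epsilon>)"
    unfolding Y_def[symmetric]
  proof (rule Limsup_bounded)
    show "\<forall>\<^sub>F j in sequentially. seqJ j \<le> ennreal (2 powr s * growth_const s * Y + \<epsilon>)"
      using ev1 eventually_ge_at_top[of 1]
    proof eventually_elim
      case (elim j)
      show ?case unfolding seqJ_def
        using elim by (intro scaled_bloch_norm_le nn J_op_0) (auto simp: bloch_density_J)
    qed
  qed
qed

lemma limsup_le_essential_norm:
  "max (limsup seqI) (limsup seqJ) \<le> ennreal lower_const * essential_norm BN bloch_norm T"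
proof (rule ennreal_le_epsilon)
  fix e :: real
  assume fin: "ennreal lower_const * essential_norm BN bloch_norm T < top" and e: "0 < e"
  have "essential_norm BN bloch_norm T \<noteq> top"
    using fin lower_const_pos by (auto simp: ennreal_mult_top)
  then obtain E0 where E0: "essential_norm BN bloch_norm T = ennreal E0" "0 \<le> E0"
    by (cases "essential_norm BN bloch_norm T") auto
  define G where "G = max (2 powr (s + 1) * growth_const (s + 1)) (2 powr s * growth_const s)"
  have G: "0 < G" using growth_const_pos[of s] by (simp add: G_def less_max_iff_disj)
  \<comment> \<open>The infimum may not be attained, so K is optimal only up to \<epsilon>. The
    three errors carry the coefficients lower_const, G and 1, and this choice makes them add up to
    e.\<close>
  define \<epsilon> where "\<epsilon> = e / (lower_const + G + 1)"
  have \<epsilon>: "0 < \<epsilon>" using e lower_const_pos G by (simp add: \<epsilon>_def add_pos_pos)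
  have "essential_norm BN bloch_norm T < ennreal (E0 + \<epsilon>)"
    unfolding E0(1) using \<epsilon> E0(2) by (simp add: ennreal_less_iff)
  then obtain K where K: "compact_op BN bloch_norm K"
    and "op_norm BN bloch_norm (\<lambda>f z. T f z - K f z) < ennreal (E0 + \<epsilon>)"
    unfolding essential_norm_def INF_less_iff by blast
  then have le: "op_norm BN bloch_norm (\<lambda>f z. T f z - K f z) \<le> ennreal (E0 + \<epsilon>)" by simp
  have nn: "0 \<le> E0 + \<epsilon>" using E0 \<epsilon> by simp
  define Y where "Y = 4 * test_const * (E0 + \<epsilon>) + \<epsilon>"
  have Y: "0 \<le> Y" using test_const_pos nn \<epsilon> by (simp add: Y_def)
  have "max (limsup seqI) (limsup seqJ) \<le> ennreal (G * Y + \<epsilon>)"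
  proof (rule max.boundedI)
    have "limsup seqI \<le> ennreal (2 powr (s + 1) * growth_const (s + 1) * Y + \<epsilon>)"
      unfolding Y_def by (rule limsup_lower_bound(1)[OF K le nn \<epsilon>])
    also have "\<dots> \<le> ennreal (G * Y + \<epsilon>)"
      using Y by (intro ennreal_leI add_right_mono mult_right_mono) (auto simp: G_def)
    finally show "limsup seqI \<le> ennreal (G * Y + \<epsilon>)" .
    have "limsup seqJ \<le> ennreal (2 powr s * growth_const s * Y + \<epsilon>)"
      unfolding Y_def by (rule limsup_lower_bound(2)[OF K le nn \<epsilon>])
    also have "\<dots> \<le> ennreal (G * Y + \<epsilon>)"
      using Y by (intro ennreal_leI add_right_mono mult_right_mono) (auto simp: G_def)
    finally show "limsup seqJ \<le> ennreal (G * Y + \<epsilon>)" .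
  qed
  also have "G * Y + \<epsilon> = lower_const * E0 + \<epsilon> * (lower_const + G + 1)"
  proof -
    have "lower_const = G * (4 * test_const)" by (simp only: lower_const_def G_def)
    then show ?thesis by (simp add: Y_def algebra_simps)
  qed
  also have "\<epsilon> * (lower_const + G + 1) = e"
  proof -
    have "lower_const + G + 1 \<noteq> 0" using lower_const_pos G by linarith
    then show ?thesis by (simp add: \<epsilon>_def)
  qed
  also have "ennreal (lower_const * E0 + e) = ennreal lower_const * essential_norm BN bloch_norm T + ennreal e"
    using E0 e lower_const_pos by (simp add: ennreal_mult)
  finally show "max (limsup seqI) (limsup seqJ) \<le> ennreal lower_const * essential_norm BN bloch_norm T + ennreal e" .
qed

text \<open>The strict inequality puts both sequences below \<rho> for all large j, and
  \<open>weight_le_of_powers_le\<close> converts this into boundary bounds for \<open>Au\<close> and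
  \<open>Bu\<close>. The larger factor 2^(s+1) serves both.\<close>

lemma essential_norm_le_of_limsup_less:
  assumes \<rho>: "0 < \<rho>" and less: "max (limsup seqI) (limsup seqJ) < ennreal \<rho>"
  shows "essential_norm BN bloch_norm T \<le> ennreal (upper_const * (2 * 2 powr (s + 1) * \<rho>))"
proof -
  have "\<forall>\<^sub>F j in sequentially. seqI j < ennreal \<rho>" "\<forall>\<^sub>F j in sequentially. seqJ j < ennreal \<rho>"
    using less by (auto intro: Limsup_lessD)
  then have "\<forall>\<^sub>F j in sequentially. seqI j < ennreal \<rho> \<and> seqJ j < ennreal \<rho> \<and> 1 \<le> j"
    using eventually_ge_at_top[of "1::nat"] by (intro eventually_conj)
  then obtain J where J: "\<And>j. J \<le> j \<Longrightarrow> seqI j < ennreal \<rho> \<and> seqJ j < ennreal \<rho> \<and> 1 \<le> j"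
    unfolding eventually_sequentially by blast
  have w: "0 \<le> cmod (\<phi> z) \<and> cmod (\<phi> z) < 1" if "z \<in> unit_disc" for z
    using norm_\<phi>[OF that] by simp
  have s1: "0 < s + 1" using s_pos by simp
  have leB: "real j powr (s + 1) * (cmod (\<phi> z) ^ (j - 1) * Bu z) \<le> \<rho>" if "J \<le> j" "z \<in> unit_disc" for j z
    using scaled_bloch_density_le[of "real j powr s" "I_op u (\<lambda>z. \<phi> z ^ j)" \<rho> z] J[OF that(1)] that(2) \<rho>
    by (simp add: seqI_def I_density_eq less_imp_le)
  have leA: "real j powr s * (cmod (\<phi> z) ^ (j - 1) * Au z) \<le> \<rho>" if "J \<le> j" "z \<in> unit_disc" for j z
    using scaled_bloch_density_le[of "real j powr s" "J_op u (\<lambda>z. \<phi> z ^ (j - 1))" \<rho> z] J[OF that(1)] that(2) \<rho>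
    by (simp add: seqJ_def bloch_density_J less_imp_le)
  obtain \<delta>A \<delta>B where \<delta>: "\<delta>A < 1" "\<delta>B < 1"
    and bA: "\<And>z. z \<in> unit_disc \<Longrightarrow> \<delta>A < cmod (\<phi> z) \<Longrightarrow> Au z \<le> 2 * 2 powr s * \<rho> * (1 - cmod (\<phi> z)) powr s"
    and bB: "\<And>z. z \<in> unit_disc \<Longrightarrow> \<delta>B < cmod (\<phi> z) \<Longrightarrow> Bu z \<le> 2 * 2 powr (s + 1) * \<rho> * (1 - cmod (\<phi> z)) powr (s + 1)"
    using weight_le_of_powers_le[where D = unit_disc and w = "\<lambda>z. cmod (\<phi> z)", OF s_pos w Au_nonneg leA]
      weight_le_of_powers_le[where D = unit_disc and w = "\<lambda>z. cmod (\<phi> z)", OF s1 w Bu_nonneg leB]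
    by metis
  show ?thesis
  proof (rule essential_norm_le)
    show "0 < 2 * 2 powr (s + 1) * \<rho>" using \<rho> by simp
    show "max \<delta>A \<delta>B < 1" using \<delta> by simp
    fix z assume z: "z \<in> unit_disc" "max \<delta>A \<delta>B < cmod (\<phi> z)"
    have "Au z \<le> 2 * 2 powr s * \<rho> * (1 - cmod (\<phi> z)) powr s" using bA z by simp
    also have "\<dots> \<le> 2 * 2 powr (s + 1) * \<rho> * (1 - cmod (\<phi> z)) powr s"
      using \<rho> by (intro mult_right_mono mult_left_mono) auto
    finally show "Au z \<le> 2 * 2 powr (s + 1) * \<rho> * (1 - cmod (\<phi> z)) powr s" .
    show "Bu z \<le> 2 * 2 powr (s + 1) * \<rho> * (1 - cmod (\<phi> z)) powr (s + 1)" using bB z by simp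
  qed
qed

lemma essential_norm_le_limsup:
  "essential_norm BN bloch_norm T
    \<le> ennreal (upper_const * (2 * 2 powr (s + 1))) * max (limsup seqI) (limsup seqJ)"
proof (rule ennreal_le_epsilon)
  fix e :: real
  define C where "C = upper_const * (2 * 2 powr (s + 1))"
  have C: "0 < C" using upper_const_pos by (simp add: C_def)
  assume "ennreal (upper_const * (2 * 2 powr (s + 1))) * max (limsup seqI) (limsup seqJ) < top" and e: "0 < e"
  then have "max (limsup seqI) (limsup seqJ) \<noteq> top"
    using C unfolding C_def[symmetric] by (auto simp: ennreal_mult_top)
  then obtain R where R: "max (limsup seqI) (limsup seqJ) = ennreal R" "0 \<le> R"
    by (cases "max (limsup seqI) (limsup seqJ)") auto
  \<comment> \<open>R + e / C is strictly above R and positive even for R = 0, as the previous lemma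
    demands.\<close>
  have "essential_norm BN bloch_norm T \<le> ennreal (upper_const * (2 * 2 powr (s + 1) * (R + e / C)))"
    using R e C by (intro essential_norm_le_of_limsup_less) (auto simp: ennreal_less_iff add_nonneg_pos)
  also have "upper_const * (2 * 2 powr (s + 1) * (R + e / C)) = C * (R + e / C)"
    by (simp only: C_def mult.assoc)
  also have "\<dots> = C * R + e"
    using C by (simp add: distrib_left)
  also have "ennreal (C * R + e) = ennreal C * max (limsup seqI) (limsup seqJ) + ennreal e"
    using R C e by (simp add: ennreal_mult)
  finally show "essential_norm BN bloch_norm T
      \<le> ennreal (upper_const * (2 * 2 powr (s + 1))) * max (limsup seqI) (limsup seqJ) + ennreal e"
    by (simp add: C_def)
qed

end

theorem theorem3p2:
  fixes p \<alpha> :: real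
  assumes "1 \<le> p" and "-1 < \<alpha>"
  shows "\<exists>C::real. 0 < C \<and>
    (\<forall>u \<phi> :: complex \<Rightarrow> complex.
       u holomorphic_on unit_disc \<longrightarrow>
       \<phi> holomorphic_on unit_disc \<longrightarrow>
       \<phi> ` unit_disc \<subseteq> unit_disc \<longrightarrow>
       bounded_op (bergman_norm p \<alpha>) bloch_norm (wcomp u \<phi>) \<longrightarrow>
       (let E = essential_norm (bergman_norm p \<alpha>) bloch_norm (wcomp u \<phi>);
            R = max
              (limsup (\<lambda>j::nat. ennreal (real j powr ((2 + \<alpha>) / p)) *
                 bloch_norm (I_op u (\<lambda>z. \<phi> z ^ j))))
              (limsup (\<lambda>j::nat. ennreal (real j powr ((2 + \<alpha>) / p)) *
                 bloch_norm (J_op u (\<lambda>z. \<phi> z ^ (j - 1)))))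
        in E \<le> ennreal C * R \<and> R \<le> ennreal C * E))"
proof -
  interpret bergman p \<alpha> by unfold_locales fact+
  define C where "C = max (upper_const * (2 * 2 powr (s + 1))) lower_const"
  have C: "0 < C" using lower_const_pos by (simp add: C_def less_max_iff_disj)
  have "essential_norm BN bloch_norm (wcomp u \<phi>) \<le> ennreal C *
        max (limsup (\<lambda>j. ennreal (real j powr s) * bloch_norm (I_op u (\<lambda>z. \<phi> z ^ j))))
          (limsup (\<lambda>j. ennreal (real j powr s) * bloch_norm (J_op u (\<lambda>z. \<phi> z ^ (j - 1)))))
    \<and> max (limsup (\<lambda>j. ennreal (real j powr s) * bloch_norm (I_op u (\<lambda>z. \<phi> z ^ j))))
          (limsup (\<lambda>j. ennreal (real j powr s) * bloch_norm (J_op u (\<lambda>z. \<phi> z ^ (j - 1)))))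
        \<le> ennreal C * essential_norm BN bloch_norm (wcomp u \<phi>)"
    if "u holomorphic_on unit_disc" "\<phi> holomorphic_on unit_disc" "\<phi> ` unit_disc \<subseteq> unit_disc"
      "bounded_op BN bloch_norm (wcomp u \<phi>)" for u \<phi> :: "complex \<Rightarrow> complex"
  proof -
    interpret bounded_wcomp p \<alpha> u \<phi> by unfold_locales (fact that)+
    show ?thesis
      unfolding seqI_def[abs_def, symmetric] seqJ_def[abs_def, symmetric]
      by (intro conjI order_trans[OF essential_norm_le_limsup] order_trans[OF limsup_le_essential_norm]
          mult_right_mono ennreal_leI) (auto simp: C_def)
  qed
  with C show ?thesis
    unfolding Let_def s_def by blast
qed

end
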